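(* There is $\beta_0<\infty$ such that for all $\beta\ge\beta_0$ the following holds, with $U$ the telescoping potential of $\nu_\beta^+$. Let $\mu\in\mathcal{M}_\alpha$ and $\omega\in\Omega_\alpha$ for some $\alpha>1$. Then $$e^U_\mu=\lim_{V\uparrow\mathbb{Z}}\frac1{|V|}\,\mu(H^\omega_V).$$
   Context: Ising model on $\mathbb{Z}^2$ at zero field: for finite $\Lambda\subset\mathbb{Z}^2$, $\mu^+_{\Lambda,\beta}$ is the probability measure on $\{\pm1\}^\Lambda$ with weights proportional to $\exp[\beta\sum_{\langle xy\rangle:\{x,y\}\cap\Lambda\ne\emptyset}(\sigma_x\sigma_y-1)]$ (nearest neighbour pairs, $\sigma_y=+1$ for $y\notin\Lambda$); $\mu_\beta^+=\lim_\Lambda\mu^+_{\Lambda,\beta}$ is the plus phase with random field $X$. $\Omega=\{\pm1\}^{\mathbb{Z}}$, $\Omega_V=\{\pm1\}^V$; $\nu_\beta^+$ is the law on $\Omega$ of $(X((i,0)))_{i\in\mathbb{Z}}$. $\sigma_V\omega_{V^c}$ equals $\sigma$ on $V$ and $\omega$ off $V$; $\sigma^V$ equals $\sigma$ on $V$ and $+1$ off $V$; $+$ is the all-plus configuration. $V\uparrow\mathbb{Z}$ denotes the thermodynamic limit over finite volumes $V\subset\mathbb{Z}$. Specification $\Gamma$ (the monotone right-continuous specification with which $\nu_\beta^+$ is consistent): with $\Lambda_n=([-n,n]\cap\mathbb{Z})^2$, for finite $V\subset\mathbb{Z}$, $\sigma\in\Omega_V$, $\omega\in\Omega$, $$\gamma_V(\sigma|\omega)=\lim_{n\to\infty}\mu^+_{\Lambda_n,\beta}\big(X(i,0)=\sigma_i,\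 i\in V\,\big|\,X(i,0)=\omega_i,\ i\in[-n,n]\setminus V\big).$$ Telescoping potential $U$: for $i\in\mathbb{Z}$, $U(\{i\},\xi)=\ln\frac{\gamma_{\{i\}}(+|+)}{\gamma_{\{i\}}(\xi^{\{i\}}|+)}$; for $j<i$, with $\gamma=\gamma_{[j,i]}$, $$U([j,i],\xi)=\ln\frac{\gamma(\xi^{]j,i]}|+)\,\gamma(\xi^{[j,i[}|+)}{\gamma(\xi^{]j,i[}|+)\,\gamma(\xi^{[j,i]}|+)},$$ where $[j,i]=\{j,\dots,i\}$, $]j,i]=\{j+1,\dots,i\}$, $[j,i[=\{j,\dots,i-1\}$, $]j,i[=\{j+1,\dots,i-1\}$; $U(A,\cdot)=0$ for all other finite $A$. For $1\le\alpha<9/8$ and $i\in\mathbb{Z}$ ($\mathbb{N}=\{1,2,\dots\}$): $l_i^{\alpha,+}(\sigma)=\min\{n\in\mathbb{N}:\forall k\ge n,\ \frac1k\sum_{j=0}^{k-1}\sigma_{i+j}\ge\frac89\alpha\}$ and $l_i^{\alpha,-}(\sigma)=\min\{n\in\mathbb{N}:\forall k\ge n,\ \frac1k\sum_{j=0}^{k-1}\sigma_{i-j}\ge\frac89\alpha\}$ ($=\infty$ if there is no such $n$). $\mathcal{M}_\alpha$ is the set of translation invariant probability measures $\mu$ on $\Omega$ for which there is $c>0$ with $\mu[l_0^{\alpha,\pm}>n]\le e^{-cn}$ for all $n\in\mathbb{N}$ (both signs). $\Omega_\alpha$ is the set of $\omega\in\Omega$ for which there are $\epsilon>0$, $N\in\mathbb{N}$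 with $l_i^{\alpha,\pm}(\omega)\le|i|^{1/(3+\epsilon)}$ for all $|i|\ge N$ (both signs). $f_U(\sigma)=\sum_{A\ni0}\frac1{|A|}U(A,\sigma)$ and $e^U_\mu=\int f_U\,d\mu$ (well defined for $\mu\in\mathcal{M}_\alpha$, $\alpha>1$). The energy with boundary condition $\omega$ is $H^\omega_V(\sigma)=\sum_{A\cap V\ne\emptyset}U(A,\sigma_V\omega_{V^c})$.
   Formalization: The limit V↑Z is taken along intervals V=[a,b] with a→−∞ and b→+∞ independently; along all finite volumes the claim fails, e.g. for ω=+ and V consisting mostly of remote isolated points. *)

theory Defs
  imports "HOL-Probability.Probability"
begin

text \<open>
  Spins are the real numbers \<open>1\<close> and \<open>-1\<close>. A configuration on a set \<open>V\<close> of sites is a function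
  of which only the values on \<open>V\<close> matter; on \<open>\<int>\<^sup>2\<close> and \<open>\<int>\<close> the sites have type
  \<^typ>\<open>int \<times> int\<close> and \<^typ>\<open>int\<close>. The configuration equal to \<open>\<sigma>\<close> on \<open>V\<close> and to \<open>\<omega>\<close> off \<open>V\<close> is
  \<open>override_on \<omega> \<sigma> V\<close>.
\<close>

definition all_plus :: "'a \<Rightarrow> real" where
  "all_plus = (\<lambda>_. 1)"

abbreviation plus_off :: "'a set \<Rightarrow> ('a \<Rightarrow> real) \<Rightarrow> 'a \<Rightarrow> real" where
  "plus_off V \<sigma> \<equiv> override_on all_plus \<sigma> V"


subsection \<open>The Ising model in a finite volume with plus boundary condition\<close>

definition nn :: "int \<times> int \<Rightarrow> int \<times> int \<Rightarrow> bool" where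
  "nn x y \<longleftrightarrow> \<bar>fst x - fst y\<bar> + \<bar>snd x - snd y\<bar> = 1"

definition bonds :: "(int \<times> int) set \<Rightarrow> (int \<times> int) set set" where
  "bonds \<Lambda> = {{x, y} | x y. nn x y \<and> {x, y} \<inter> \<Lambda> \<noteq> {}}"

text \<open>For a bond \<open>e = {x, y}\<close> the product over \<open>e\<close> is \<open>\<sigma>\<^sub>x \<sigma>\<^sub>y\<close>.\<close>

definition ising_weight :: "real \<Rightarrow> (int \<times> int) set \<Rightarrow> (int \<times> int \<Rightarrow> real) \<Rightarrow> real" where
  "ising_weight \<beta> \<Lambda> \<sigma> = exp (\<beta> * (\<Sum>e\<in>bonds \<Lambda>. (\<Prod>z\<in>e. plus_off \<Lambda> \<sigma> z) - 1))"

definition ising_plus :: "real \<Rightarrow> (int \<times> int) set \<Rightarrow> (int \<times> int \<Rightarrow> real) measure" where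
  "ising_plus \<beta> \<Lambda> =
     point_measure (\<Lambda> \<rightarrow>\<^sub>E {-1, 1})
       (\<lambda>\<sigma>. ennreal (ising_weight \<beta> \<Lambda> \<sigma> / (\<Sum>\<tau>\<in>\<Lambda> \<rightarrow>\<^sub>E {-1, 1}. ising_weight \<beta> \<Lambda> \<tau>)))"

definition square :: "nat \<Rightarrow> (int \<times> int) set" where
  "square n = {- int n..int n} \<times> {- int n..int n}"


subsection \<open>The specification and the telescoping potential\<close>

text \<open>
  \<open>spec \<beta> V \<sigma> \<omega>\<close> is \<open>\<gamma>\<^sub>V(\<sigma>|\<omega>)\<close>; it depends on \<open>\<sigma>\<close> only through its restriction to \<open>V\<close>. The
  limit exists by monotonicity in \<open>n\<close>. The finitely many \<open>n\<close> for which the square does not contain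
  \<open>V\<close> are irrelevant.
\<close>

definition spec :: "real \<Rightarrow> int set \<Rightarrow> (int \<Rightarrow> real) \<Rightarrow> (int \<Rightarrow> real) \<Rightarrow> real" where
  "spec \<beta> V \<sigma> \<omega> =
     lim (\<lambda>n. cond_prob (ising_plus \<beta> (square n))
                (\<lambda>X. \<forall>i\<in>V. X (i, 0) = \<sigma> i)
                (\<lambda>X. \<forall>i\<in>{- int n..int n} - V. X (i, 0) = \<omega> i))"

definition telescoping_potential :: "real \<Rightarrow> int set \<Rightarrow> (int \<Rightarrow> real) \<Rightarrow> real" where
  "telescoping_potential \<beta> A \<xi> =
     (let j = Min A; i = Max A; g = (\<lambda>W. spec \<beta> A (plus_off W \<xi>) all_plus) in
      if A = {i} then ln (spec \<beta> {i} all_plus all_plus / g {i})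
      else if j < i \<and> A = {j..i} then
        ln (g {j<..i} * g {j..<i} / (g {j<..<i} * g {j..i}))
      else 0)"


subsection \<open>Good configurations and measures on the line\<close>

definition line_space :: "(int \<Rightarrow> real) measure" where
  "line_space = (\<Pi>\<^sub>M i\<in>UNIV. count_space {-1, 1})"

text \<open>
  \<open>run_len s \<alpha> i\<close> is \<open>l\<^sub>i\<close> with superscript \<open>\<alpha>,+\<close> for \<open>s = 1\<close> and \<open>\<alpha>,-\<close> for \<open>s = -1\<close>. The infimum
  is a minimum unless the set is empty, and then it is \<open>\<infinity>\<close>.
\<close>

definition run_len :: "int \<Rightarrow> real \<Rightarrow> int \<Rightarrow> (int \<Rightarrow> real) \<Rightarrow> enat" where
  "run_len s \<alpha> i \<sigma> =
     (INF n\<in>{n. n \<ge> 1 \<and> (\<forall>k\<ge>n. (\<Sum>j<k. \<sigma> (i + s * int j)) / real k \<ge> 8 / 9 * \<alpha>)}. enat n)"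

definition good_measures :: "real \<Rightarrow> (int \<Rightarrow> real) measure set" where
  "good_measures \<alpha> =
     {\<mu>. sets \<mu> = sets line_space \<and> prob_space \<mu> \<and>
         (\<forall>k. distr \<mu> line_space (\<lambda>\<sigma> i. \<sigma> (i + k)) = \<mu>) \<and>
         (\<exists>c>0. \<forall>n\<ge>1. \<forall>s\<in>{1, -1}.
            measure \<mu> {\<sigma>\<in>space \<mu>. run_len s \<alpha> 0 \<sigma> > enat n} \<le> exp (- c * real n))}"

definition good_configs :: "real \<Rightarrow> (int \<Rightarrow> real) set" where
  "good_configs \<alpha> =
     {\<omega>\<in>space line_space. \<exists>\<epsilon>>0. \<exists>N\<ge>1. \<forall>i. \<bar>i\<bar> \<ge> int N \<longrightarrow> (\<forall>s\<in>{1, -1}.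
        ereal_of_enat (run_len s \<alpha> i \<omega>) \<le> ereal (real_of_int \<bar>i\<bar> powr (1 / (3 + \<epsilon>))))}"


subsection \<open>Energies\<close>

definition site_energy :: "(int set \<Rightarrow> (int \<Rightarrow> real) \<Rightarrow> real) \<Rightarrow> (int \<Rightarrow> real) \<Rightarrow> real" where
  "site_energy U \<sigma> = (\<Sum>\<^sub>\<infinity>A\<in>{A. finite A \<and> 0 \<in> A}. U A \<sigma> / real (card A))"

definition energy_density :: "(int set \<Rightarrow> (int \<Rightarrow> real) \<Rightarrow> real) \<Rightarrow> (int \<Rightarrow> real) measure \<Rightarrow> real" where
  "energy_density U \<mu> = (\<integral>\<sigma>. site_energy U \<sigma> \<partial>\<mu>)"

definition hamiltonian ::
    "(int set \<Rightarrow> (int \<Rightarrow> real) \<Rightarrow> real) \<Rightarrow> int set \<Rightarrow> (int \<Rightarrow> real) \<Rightarrow> (int \<Rightarrow> real) \<Rightarrow> real" where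
  "hamiltonian U V \<omega> \<sigma> =
     (\<Sum>\<^sub>\<infinity>A\<in>{A. finite A \<and> A \<inter> V \<noteq> {}}. U A (override_on \<omega> \<sigma> V))"

text \<open>
  The thermodynamic limit in one dimension: intervals \<open>[a, b]\<close> with \<open>a\<close> tending to minus
  infinity and \<open>b\<close> tending to plus infinity independently of each other. Energy densities do not
  converge along the net of all finite sets ordered by inclusion, since such sets may consist
  mostly of isolated points.
\<close>

definition thermodynamic :: "int set filter" where
  "thermodynamic = filtermap (\<lambda>(a, b). {a..b}) (at_bot \<times>\<^sub>F at_top)"

end

theory Submission
  imports Defs
begin

text \<open>
  The proof has two parts, a contour argument on \<open>\<int>\<^sup>2\<close> which shows that \<open>U\<close> decays exponentially on
  intervals with few minus spins, and a counting argument on \<open>\<int>\<close> which needs only this decay.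

  Write \<open>q = exp (- 2 \<beta>)\<close>. A configuration in a box with plus spins outside has weight \<open>q\<close> to the
  number of its unsatisfied bonds, its contour bonds. Let \<open>Z(M)\<close> be the partition function when the
  line \<open>y = 0\<close> is minus exactly on the finite set \<open>M\<close>, and \<open>r(M)\<close> the limit of \<open>Z(M) / Z(\<emptyset>)\<close> over
  growing boxes. Normalizations cancel in \<open>U\<close>: if \<open>\<xi>\<close> is minus at both ends of \<open>[j, i]\<close> and on the
  set \<open>M\<close> between them, then
  \<open>U([j, i], \<xi>) = ln (r(M \<union> {i}) r(M \<union> {j}) / (r(M) r(M \<union> {j, i})))\<close>, and \<open>U([j, i], \<xi>) = 0\<close> if an
  end is plus and \<open>j < i\<close>.

  To compare the two products, superpose two independent configurations and exchange their contour
  bonds on those components, of the union of both contour sets, that touch the site \<open>j\<close>. This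
  preserves weights and turns \<open>(M, M \<union> {j, i})\<close> into \<open>(M \<union> {j}, M \<union> {i})\<close>, unless one of the components
  reaches \<open>i\<close> (lemma \<open>exchange_bound\<close>). In that case at least \<open>i - j - 1\<close> contour bonds form clusters
  attached to the line. Erasing these clusters gains a factor \<open>q\<close> per bond against an exponential
  number of clusters, and leaves two configurations that are plus on the line (lemma
  \<open>peierls_pairs\<close>). So the two products of partition functions differ by at most about
  \<open>(const q) ^ (i - j)\<close> in units of \<open>Z(\<emptyset>)\<^sup>2\<close>. Turning one spin of the line costs at most a factor
  \<open>q ^ 4\<close>, so each product of ratios is at least \<open>q ^ (8 N)\<close>, with \<open>N\<close> the number of minus spins in
  \<open>[j, i]\<close>. If the mean spin is at least \<open>8 / 9\<close>, then \<open>N\<close> is at most one eighteenth of the length, and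
  the decay wins for large \<open>\<beta>\<close> (lemma \<open>potential_decay\<close>). The same exchange between two different boxes shows that
  \<open>r(M)\<close> exists and is translation invariant. In all
  configurations \<open>U\<close> is bounded, because it compares spin flips (lemma \<open>potential_bounded\<close>).

  For the second part, suppose that the mean spin is at least \<open>8 / 9 + \<delta>\<close> to the left of \<open>x\<close> and to
  the right of \<open>x + 1\<close>, up to deficits \<open>b\<close> and \<open>b'\<close>. An interval of length at least \<open>(b + b') / \<delta>\<close>
  through \<open>x\<close> then has mean spin at least \<open>8 / 9\<close>. There are only quadratically many shorter ones, so
  the sum of \<open>\<bar>U\<bar>\<close> over all intervals through \<open>x\<close> is \<open>O(1 + (b + b')\<^sup>2)\<close> (lemma \<open>sum_crossing\<close>). The
  energy in \<open>V = [a, c]\<close> differs from the sum of the translated site energies only by intervals that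
  cross an end of \<open>V\<close> (lemma \<open>hamiltonian_site_energies\<close>). The deficits of \<open>\<sigma>\<close> at the ends have
  second moments under \<open>\<mu>\<close> that do not depend on \<open>V\<close>, and those of \<open>\<omega>\<close> have squares of order
  \<open>|V| powr (2 / 3)\<close> at most, since \<open>1 / (3 + \<epsilon>) < 1 / 3\<close>. The error is therefore \<open>o(|V|)\<close>, and by
  translation invariance the site energies contribute \<open>|V|\<close> times the energy density.
\<close>

section \<open>Bonds and contours\<close>

text \<open>
  Bonds are indexed by their left or lower end and their direction, so that the bonds that share a
  plaquette with a given bond can be listed. In the dual lattice, where bonds are edges and
  plaquettes are vertices, this is the adjacency of edges.
\<close>

datatype bond = Hor int int | Ver int int

fun ends :: "bond \<Rightarrow> (int \<times> int) set" where
  "ends (Hor x y) = {(x, y), (x + 1, y)}"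
| "ends (Ver x y) = {(x, y), (x, y + 1)}"

definition plaquette :: "int \<Rightarrow> int \<Rightarrow> bond set" where
  "plaquette x y = {Hor x y, Hor x (y + 1), Ver x y, Ver (x + 1) y}"

fun nbrs :: "bond \<Rightarrow> bond set" where
  "nbrs (Hor x y) = plaquette x y \<union> plaquette x (y - 1)"
| "nbrs (Ver x y) = plaquette x y \<union> plaquette (x - 1) y"

definition boundary :: "(int \<times> int \<Rightarrow> real) \<Rightarrow> bond set" where
  "boundary \<sigma> = {e. \<exists>p\<in>ends e. \<exists>p'\<in>ends e. \<sigma> p \<noteq> \<sigma> p'}"

definition touching :: "(int \<times> int) set \<Rightarrow> bond set" where
  "touching R = {e. ends e \<inter> R \<noteq> {}}"

definition spins :: "('a \<Rightarrow> real) set" where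
  "spins = {\<sigma>. \<forall>p. \<sigma> p = 1 \<or> \<sigma> p = -1}"

lemma Hor_boundary: "Hor x y \<in> boundary \<sigma> \<longleftrightarrow> \<sigma> (x, y) \<noteq> \<sigma> (x + 1, y)"
  and Ver_boundary: "Ver x y \<in> boundary \<sigma> \<longleftrightarrow> \<sigma> (x, y) \<noteq> \<sigma> (x, y + 1)"
  by (auto simp: boundary_def)

lemma spinsD: "\<sigma> \<in> spins \<Longrightarrow> \<sigma> p = 1 \<or> \<sigma> p = -1"
  by (auto simp: spins_def)

lemma spins_mult: "\<sigma> \<in> spins \<Longrightarrow> \<tau> \<in> spins \<Longrightarrow> (\<lambda>p. \<sigma> p * \<tau> p) \<in> spins"
  unfolding spins_def by (simp, metis mult_1 mult_minus1 minus_minus)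

lemma spins_square: "\<sigma> \<in> spins \<Longrightarrow> \<sigma> p * \<sigma> p = 1"
  by (drule spinsD[of _ p]) auto

text \<open>
  Contours of products are symmetric differences of contours. This makes multiplication by a
  suitable configuration the tool for erasing and for exchanging contours.
\<close>

lemma boundary_mult:
  assumes "\<sigma> \<in> spins" "\<tau> \<in> spins"
  shows "boundary (\<lambda>p. \<sigma> p * \<tau> p) = (boundary \<sigma> - boundary \<tau>) \<union> (boundary \<tau> - boundary \<sigma>)"
proof -
  have "e \<in> boundary (\<lambda>p. \<sigma> p * \<tau> p) \<longleftrightarrow> (e \<in> boundary \<sigma>) \<noteq> (e \<in> boundary \<tau>)" for e
  proof (cases e)
    case (Hor x y)
    show ?thesis unfolding Hor Hor_boundary
      using spinsD[OF assms(1), of "(x, y)"] spinsD[OF assms(1), of "(x + 1, y)"]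
        spinsD[OF assms(2), of "(x, y)"] spinsD[OF assms(2), of "(x + 1, y)"] by auto
  next
    case (Ver x y)
    show ?thesis unfolding Ver Ver_boundary
      using spinsD[OF assms(1), of "(x, y)"] spinsD[OF assms(1), of "(x, y + 1)"]
        spinsD[OF assms(2), of "(x, y)"] spinsD[OF assms(2), of "(x, y + 1)"] by auto
  qed
  then show ?thesis by blast
qed

lemma boundary_touching: "(\<And>p. p \<notin> \<Lambda> \<Longrightarrow> \<sigma> p = 1) \<Longrightarrow> boundary \<sigma> \<subseteq> touching \<Lambda>"
proof
  fix e assume \<sigma>: "\<And>p. p \<notin> \<Lambda> \<Longrightarrow> \<sigma> p = 1" and "e \<in> boundary \<sigma>"
  then obtain p p' where "p \<in> ends e" "p' \<in> ends e" "\<sigma> p \<noteq> \<sigma> p'" by (auto simp: boundary_def)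
  then show "e \<in> touching \<Lambda>" using \<sigma>[of p] \<sigma>[of p'] unfolding touching_def by fastforce
qed

lemma card_le4: "card {a, b, c, d} \<le> 4"
  using card_insert_le_m1[of 4 "{b,c,d}" a] by (simp add: card_insert_if)

lemma card_plaquette: "finite (plaquette x y)" "card (plaquette x y) \<le> 4"
  unfolding plaquette_def by (auto intro: card_le4)

lemma card_nbrs: "finite (nbrs e)" "card (nbrs e) \<le> 8"
proof -
  have "card (plaquette x y \<union> plaquette x' y') \<le> 8" for x y x' y'
    using card_Un_le[of "plaquette x y" "plaquette x' y'"] card_plaquette(2)[of x y]
      card_plaquette(2)[of x' y'] by linarith
  then show "card (nbrs e) \<le> 8" by (cases e) auto
  show "finite (nbrs e)" by (cases e) (auto intro: card_plaquette)
qed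

definition star_of :: "(int \<times> int) \<Rightarrow> bond set" where
  "star_of p = (case p of (x, y) \<Rightarrow> {Hor x y, Hor (x - 1) y, Ver x y, Ver x (y - 1)})"

lemma star_of_iff: "e \<in> star_of p \<longleftrightarrow> p \<in> ends e"
  by (cases e; cases p) (auto simp: star_of_def)

lemma touching_eq: "touching R = (\<Union>p\<in>R. star_of p)"
  by (auto simp: touching_def star_of_iff)

lemma card_star_of: "finite (star_of p)" "card (star_of p) \<le> 4"
  unfolding star_of_def by (auto intro: card_le4 split: prod.split)

lemma finite_touching: "finite R \<Longrightarrow> finite (touching R)"
  unfolding touching_eq using card_star_of(1) by auto

lemma card_touching: "finite R \<Longrightarrow> card (touching R) \<le> 4 * card R"
proof -
  assume R: "finite R"
  have "card (touching R) \<le> (\<Sum>p\<in>R. card (star_of p))"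
    unfolding touching_eq by (rule card_UN_le[OF R])
  also have "\<dots> \<le> (\<Sum>p\<in>R. 4)" by (rule sum_mono) (rule card_star_of(2))
  finally show ?thesis by simp
qed

section \<open>Configurations with prescribed contours\<close>

text \<open>
  In the dual lattice these are the edge sets with even degree at every vertex. For finite sets on
  the plane they are exactly the contours of configurations that are plus near infinity.
\<close>

definition closed_bonds :: "bond set \<Rightarrow> bool" where
  "closed_bonds F \<longleftrightarrow> (\<forall>x y. even (card (plaquette x y \<inter> F)))"

text \<open>
  The configuration with contour \<open>F\<close>: a site is minus if the horizontal ray to its right crosses
  \<open>F\<close> an odd number of times.
\<close>

definition fill :: "bond set \<Rightarrow> int \<times> int \<Rightarrow> real" where
  "fill F = (\<lambda>(x, y). (-1) ^ card {x'. x \<le> x' \<and> Hor x' y \<in> F})"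

lemma card_plaquette_Int:
  "card (plaquette x y \<inter> F) = of_bool (Hor x y \<in> F) + of_bool (Hor x (y + 1) \<in> F)
     + of_bool (Ver x y \<in> F) + of_bool (Ver (x + 1) y \<in> F)"
proof -
  have "card (plaquette x y \<inter> F) = (\<Sum>e\<in>plaquette x y. of_bool (e \<in> F))"
    by (subst sum_of_bool_eq) (auto simp: card_plaquette Int_def)
  also have "\<dots> = of_bool (Hor x y \<in> F) + of_bool (Hor x (y + 1) \<in> F)
     + of_bool (Ver x y \<in> F) + of_bool (Ver (x + 1) y \<in> F)"
    unfolding plaquette_def by simp
  finally show ?thesis .
qed

lemma closed_boundary: "\<sigma> \<in> spins \<Longrightarrow> closed_bonds (boundary \<sigma>)"
  unfolding closed_bonds_def card_plaquette_Int Hor_boundary Ver_boundary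
proof (intro allI)
  fix x y assume s: "\<sigma> \<in> spins"
  show "even ((of_bool (\<sigma> (x, y) \<noteq> \<sigma> (x + 1, y)) + of_bool (\<sigma> (x, y + 1) \<noteq> \<sigma> (x + 1, y + 1)) +
            of_bool (\<sigma> (x, y) \<noteq> \<sigma> (x, y + 1)) + of_bool (\<sigma> (x + 1, y) \<noteq> \<sigma> (x + 1, y + 1))) :: nat)"
    using spinsD[OF s, of "(x, y)"] spinsD[OF s, of "(x + 1, y)"]
      spinsD[OF s, of "(x, y + 1)"] spinsD[OF s, of "(x + 1, y + 1)"]
    by (elim disjE) simp_all
qed

text \<open>
  Bonds of one plaquette are adjacent, so a union of components of a larger set contains either
  all bonds of \<open>F\<close> in a plaquette or none of them.
\<close>

lemma closed_Int_component:
  assumes "closed_bonds F" "F \<subseteq> X" "K \<subseteq> X"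
    and K: "\<And>e f. e \<in> K \<Longrightarrow> f \<in> X \<Longrightarrow> f \<in> nbrs e \<Longrightarrow> f \<in> K"
  shows "closed_bonds (F \<inter> K)"
  unfolding closed_bonds_def
proof (intro allI)
  fix x y
  have nb: "f \<in> nbrs e" if "e \<in> plaquette x y" "f \<in> plaquette x y" for e f
    using that unfolding plaquette_def by (elim insertE) (auto simp: plaquette_def)
  have "plaquette x y \<inter> (F \<inter> K) = plaquette x y \<inter> F \<or> plaquette x y \<inter> (F \<inter> K) = {}"
  proof (cases "plaquette x y \<inter> K = {}")
    case False
    then obtain e where e: "e \<in> plaquette x y" "e \<in> K" by auto
    have "f \<in> K" if "f \<in> plaquette x y" "f \<in> F" for f
      using K[OF e(2), of f] nb[OF e(1) that(1)] that(2) assms(2) by auto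
    then show ?thesis by blast
  qed auto
  then show "even (card (plaquette x y \<inter> (F \<inter> K)))"
    using assms(1) unfolding closed_bonds_def by (elim disjE) (simp_all only: card.empty even_zero)
qed

lemma fill_spins: "fill F \<in> spins"
  unfolding spins_def fill_def by (auto split: prod.split simp: minus_one_power_iff)

lemma finite_row: "finite F \<Longrightarrow> finite {x'. x \<le> x' \<and> Hor x' y \<in> F}"
  by (rule finite_subset[of _ "(\<lambda>e. case e of Hor x y \<Rightarrow> x | Ver x y \<Rightarrow> x) ` F"])
     (auto intro!: rev_image_eqI)

lemma fill_step:
  assumes "finite F"
  shows "fill F (x, y) = (if Hor x y \<in> F then -1 else 1) * fill F (x + 1, y)"
proof (cases "Hor x y \<in> F")
  case True
  then have "{x'. x \<le> x' \<and> Hor x' y \<in> F} = insert x {x'. x + 1 \<le> x' \<and> Hor x' y \<in> F}"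
    by (auto simp: le_less)
  then show ?thesis using True finite_row[OF assms, of "x + 1" y] unfolding fill_def by simp
next
  case False
  then have "{x'. x \<le> x' \<and> Hor x' y \<in> F} = {x'. x + 1 \<le> x' \<and> Hor x' y \<in> F}"
    by (auto simp: le_less)
  then show ?thesis using False unfolding fill_def by simp
qed

lemma fill_right:
  assumes "\<And>x'. x \<le> x' \<Longrightarrow> Hor x' y \<notin> F"
  shows "fill F (x, y) = 1"
proof -
  have "{x'. x \<le> x' \<and> Hor x' y \<in> F} = {}" using assms by auto
  then show ?thesis unfolding fill_def by (simp only: prod.case card.empty power_0)
qed

lemma exists_right:
  assumes "finite F"
  obtains M where "\<And>x y. M \<le> x \<Longrightarrow> Hor x y \<notin> F \<and> Ver x y \<notin> F"
proof -
  let ?c = "\<lambda>e. case e of Hor x y \<Rightarrow> x | Ver x y \<Rightarrow> x"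
  have b: "bdd_above (?c ` F)" using assms by auto
  then obtain B where B: "\<And>e. e \<in> F \<Longrightarrow> ?c e \<le> B" unfolding bdd_above_def by auto
  show ?thesis using B that[of "B + 1"] by fastforce
qed

text \<open>
  Horizontal steps obey the rule by definition. A vertical step reduces to the one right of it,
  since the plaquette between them contains an even number of bonds, and far to the right there
  are no bonds.
\<close>

lemma fill_vertical:
  assumes "finite F" "closed_bonds F"
  shows "fill F (x, y) = (if Ver x y \<in> F then -1 else 1) * fill F (x, y + 1)"
proof -
  obtain M where M: "\<And>x y. M \<le> x \<Longrightarrow> Hor x y \<notin> F \<and> Ver x y \<notin> F"
    using exists_right[OF assms(1)] by metis
  have far: "fill F (x, y) = (if Ver x y \<in> F then -1 else 1) * fill F (x, y + 1)" if "x \<ge> M" for x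
    using that M by (simp add: fill_right[of x y] fill_right[of x "y + 1"])
  show ?thesis
  proof (cases "x \<ge> M")
    case True then show ?thesis by (rule far)
  next
    case False
    then have "x \<le> M" by simp
    then show ?thesis
    proof (induction rule: int_le_induct)
      case base show ?case by (rule far) simp
    next
      case (step i)
      have "even (card (plaquette (i - 1) y \<inter> F))" using assms(2) unfolding closed_bonds_def by blast
      then have p: "even ((of_bool (Hor (i - 1) y \<in> F) + of_bool (Hor (i - 1) (y + 1) \<in> F)
        + of_bool (Ver (i - 1) y \<in> F) + of_bool (Ver i y \<in> F)) :: nat)"
        unfolding card_plaquette_Int by simp
      show ?case
        using step.IH fill_step[OF assms(1), of "i - 1" y] fill_step[OF assms(1), of "i - 1" "y + 1"] p
        by (cases "Hor (i - 1) y \<in> F"; cases "Hor (i - 1) (y + 1) \<in> F"; cases "Ver (i - 1) y \<in> F";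
            cases "Ver i y \<in> F") simp_all
    qed
  qed
qed

lemma boundary_fill:
  assumes "finite F" "closed_bonds F"
  shows "boundary (fill F) = F"
proof -
  have "e \<in> boundary (fill F) \<longleftrightarrow> e \<in> F" for e
  proof (cases e)
    case (Hor x y)
    then show ?thesis using fill_step[OF assms(1), of x y] spinsD[OF fill_spins[of F], of "(x + 1, y)"]
      by (auto simp: Hor_boundary)
  next
    case (Ver x y)
    then show ?thesis using fill_vertical[OF assms, of x y] spinsD[OF fill_spins[of F], of "(x, y + 1)"]
      by (auto simp: Ver_boundary)
  qed
  then show ?thesis by blast
qed

text \<open>
  A ray that starts above, below or to the right of the rectangle misses \<open>F\<close>. A site to the left
  is joined to a site above the rectangle by a vertical path that misses \<open>F\<close>.
\<close>

lemma fill_outside: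
  assumes "finite F" "closed_bonds F" "F \<subseteq> touching ({x1..x2} \<times> {y1..y2})"
    "p \<notin> {x1..x2} \<times> {y1..y2}"
  shows "fill F p = 1"
proof -
  obtain x y where p: "p = (x, y)" by (cases p)
  have off: "fill F (x, y) = 1" if "y \<notin> {y1..y2}" for x y
    by (rule fill_right) (use that assms(3) in \<open>auto simp: touching_def subset_eq\<close>)
  show ?thesis
  proof (cases "y \<in> {y1..y2} \<and> x < x1")
    case True
    then have "y \<le> y2 + 1" by simp
    then have "fill F (x, y) = 1"
    proof (induction rule: int_le_induct)
      case base then show ?case by (rule off) auto
    next
      case (step i)
      have "Ver x (i - 1) \<notin> F" using True assms(3) by (auto simp: touching_def subset_eq)
      then show ?case using step.IH fill_vertical[OF assms(1,2), of x "i - 1"] by simp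
    qed
    then show ?thesis using p by simp
  next
    case False
    then consider "y \<notin> {y1..y2}" | "x > x2" using assms(4) p by fastforce
    then show ?thesis
    proof cases
      case 1 then show ?thesis using off p by simp
    next
      case 2
      then have "\<And>x'. x \<le> x' \<Longrightarrow> Hor x' y \<notin> F" using assms(3) by (auto simp: touching_def subset_eq)
      then show ?thesis using p by (simp add: fill_right)
    qed
  qed
qed

text \<open>
  In one row the filling depends only on the horizontal bonds of that row. This controls the
  layer after contours have been erased or exchanged.
\<close>

lemma fill_row:
  assumes "\<sigma> \<in> spins" "finite F" "finite {p. \<sigma> p \<noteq> 1}"
    and row: "\<And>x. Hor x y \<in> F \<longleftrightarrow> Hor x y \<in> boundary \<sigma>"
  shows "fill F (x, y) = \<sigma> (x, y)"
proof -
  obtain M where M: "\<And>x. M \<le> x \<Longrightarrow> \<sigma> (x, y) = 1"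
  proof -
    have b: "bdd_above (fst ` {p. \<sigma> p \<noteq> 1})" using assms(3) by auto
    then obtain B where B: "\<And>p. \<sigma> p \<noteq> 1 \<Longrightarrow> fst p \<le> B" unfolding bdd_above_def by force
    have "\<sigma> (x, y) = 1" if "B + 1 \<le> x" for x using B[of "(x, y)"] that by force
    then show ?thesis by (rule that)
  qed
  have far: "fill F (x, y) = \<sigma> (x, y)" if "x \<ge> M" for x
    using that M row by (simp add: fill_right Hor_boundary)
  show ?thesis
  proof (cases "x \<ge> M")
    case True then show ?thesis by (rule far)
  next
    case False
    then have "x \<le> M" by simp
    then show ?thesis
    proof (induction rule: int_le_induct)
      case base show ?case by (rule far) simp
    next
      case (step i)
      then show ?case using fill_step[OF assms(2), of "i - 1" y] row[of "i - 1"]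
        spinsD[OF assms(1), of "(i, y)"] spinsD[OF assms(1), of "(i - 1, y)"]
        by (auto simp: Hor_boundary)
    qed
  qed
qed

section \<open>Components of bond sets and their number\<close>

text \<open>
  The union of those components of \<open>X\<close> that meet \<open>T\<close>.
\<close>

inductive_set reach :: "bond set \<Rightarrow> bond set \<Rightarrow> bond set" for X T where
  start: "e \<in> T \<Longrightarrow> e \<in> X \<Longrightarrow> e \<in> reach X T"
| step: "e \<in> reach X T \<Longrightarrow> f \<in> X \<Longrightarrow> f \<in> nbrs e \<Longrightarrow> f \<in> reach X T"

lemma reach_subset: "reach X T \<subseteq> X"
  by (auto elim: reach.induct)

lemma reach_mono: "T \<subseteq> T' \<Longrightarrow> reach X T \<subseteq> reach X T'"
proof
  fix e assume "T \<subseteq> T'" "e \<in> reach X T"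
  from this(2,1) show "e \<in> reach X T'" by induction (auto intro: reach.intros)
qed

lemma reach_idem: "reach (reach X T) T = reach X T"
proof
  show "reach X T \<subseteq> reach (reach X T) T"
  proof
    fix e assume "e \<in> reach X T"
    then show "e \<in> reach (reach X T) T"
      by induction (auto intro: reach.intros)
  qed
qed (rule reach_subset)

lemma reach_delete:
  assumes "e \<in> reach K T" "e \<noteq> t"
  shows "e \<in> reach (K - {t}) ((T - {t}) \<union> nbrs t)"
  using assms
proof induction
  case (step e f)
  then show ?case by (cases "e = t") (auto intro: reach.intros)
qed (auto intro: reach.intros)

lemma reach_avoid:
  assumes "e \<in> reach K T" "t \<notin> K"
  shows "e \<in> reach K (T - {t})"
  using assms by induction (auto intro: reach.intros)

text \<open>
  Sets all of whose components meet \<open>T\<close> are explored one bond at a time. If a bond \<open>t\<close> of \<open>T\<close> is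
  absent, it can be discarded; if it is present, it can be removed after its at most eight
  neighbours have been added to \<open>T\<close>. With weight \<open>1 / 256 = 2 ^ -8\<close> per bond each of the two
  alternatives accounts for at most half of \<open>2 ^ card T\<close>.
\<close>

lemma sum_reachable_sets:
  assumes "finite U" "finite T"
  shows "(\<Sum>K | K \<subseteq> U \<and> reach K T = K. (1 / 256) ^ card K) \<le> (2 :: real) ^ card T"
  using assms
proof (induction "card U" arbitrary: U T rule: less_induct)
  case less
  let ?C = "\<lambda>U T. {K. K \<subseteq> U \<and> reach K T = K}"
  let ?w = "\<lambda>K. (1 / 256 :: real) ^ card K"
  have finC: "finite (?C U' T')" if "finite U'" for U' T'
    by (rule finite_subset[of _ "Pow U'"]) (use that in auto)
  show ?case
  proof (cases "T \<inter> U = {}")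
    case True
    have "K = {}" if "K \<in> ?C U T" for K
    proof -
      have "False" if "e \<in> reach K T" for e
        using that by induction (use \<open>K \<in> ?C U T\<close> True in auto)
      then show ?thesis using that by blast
    qed
    then have "?C U T \<subseteq> {{}}" by blast
    then have "sum ?w (?C U T) \<le> sum ?w {{}}" using sum_mono2[of "{{}}" "?C U T" ?w] by simp
    moreover have "(1::real) \<le> 2 ^ card T" by simp
    ultimately show ?thesis by (simp only: sum.insert finite.emptyI empty_iff not_False_eq_True sum.empty card.empty power_0 add_0_right)
  next
    case False
    then obtain t where t: "t \<in> T" "t \<in> U" by auto
    let ?U = "U - {t}"
    have cU: "card ?U < card U" using t less.prems by (meson card_Diff1_less)
    have cT: "card (T - {t}) = card T - 1" "card T > 0" using t less.prems by (auto simp: card_gt_0_iff)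
    have IH: "sum ?w (?C ?U T') \<le> 2 ^ card T'" if "finite T'" for T'
      using less.hyps[OF cU _ that] less.prems by simp
    \<comment> \<open>Expose the bond \<open>t\<close>, absent in the first family and present in the second.\<close>
    have split: "?C U T \<subseteq> ?C ?U (T - {t}) \<union> insert t ` ?C ?U ((T - {t}) \<union> nbrs t)"
    proof
      fix K assume K: "K \<in> ?C U T"
      show "K \<in> ?C ?U (T - {t}) \<union> insert t ` ?C ?U ((T - {t}) \<union> nbrs t)"
      proof (cases "t \<in> K")
        case True
        have "reach (K - {t}) ((T - {t}) \<union> nbrs t) = K - {t}"
          using reach_subset[of "K - {t}"] reach_delete[of _ K T t] K by blast
        then have "K - {t} \<in> ?C ?U ((T - {t}) \<union> nbrs t)" using K by blast
        moreover have "K = insert t (K - {t})" using True by blast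
        ultimately show ?thesis by blast
      next
        case False
        have "reach K (T - {t}) = K" using reach_subset[of K] reach_avoid[of _ K T t] K False by blast
        then show ?thesis using K False by blast
      qed
    qed
    have "sum ?w (?C U T) \<le> sum ?w (?C ?U (T - {t}) \<union> insert t ` ?C ?U ((T - {t}) \<union> nbrs t))"
      by (rule sum_mono2[OF _ split]) (use finC less.prems in auto)
    also have "\<dots> \<le> sum ?w (?C ?U (T - {t})) + sum ?w (insert t ` ?C ?U ((T - {t}) \<union> nbrs t))"
    proof -
      have f: "finite (?C ?U (T - {t}))" "finite (insert t ` ?C ?U ((T - {t}) \<union> nbrs t))"
        using finC less.prems by auto
      have "0 \<le> sum ?w (?C ?U (T - {t}) \<inter> insert t ` ?C ?U ((T - {t}) \<union> nbrs t))"
        by (rule sum_nonneg) simp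
      then show ?thesis using sum.union_inter[OF f, of ?w] by linarith
    qed
    also have "sum ?w (insert t ` ?C ?U ((T - {t}) \<union> nbrs t))
        = (\<Sum>K\<in>?C ?U ((T - {t}) \<union> nbrs t). ?w K / 256)"
    proof (subst sum.reindex)
      show "inj_on (insert t) (?C ?U ((T - {t}) \<union> nbrs t))"
        by (rule inj_onI) blast
      show "sum (?w \<circ> insert t) (?C ?U ((T - {t}) \<union> nbrs t))
        = (\<Sum>K\<in>?C ?U ((T - {t}) \<union> nbrs t). ?w K / 256)"
      proof (rule sum.cong)
        fix K assume "K \<in> ?C ?U ((T - {t}) \<union> nbrs t)"
        then have "t \<notin> K" "finite K" using less.prems finite_subset[of K "U - {t}"] by auto
        then show "(?w \<circ> insert t) K = ?w K / 256" by simp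
      qed simp
    qed
    also have "\<dots> = sum ?w (?C ?U ((T - {t}) \<union> nbrs t)) / 256" by (rule sum_divide_distrib[symmetric])
    also have "sum ?w (?C ?U ((T - {t}) \<union> nbrs t)) \<le> 2 ^ card ((T - {t}) \<union> nbrs t)"
      by (rule IH) (use less.prems card_nbrs in auto)
    also have "\<dots> \<le> 2 ^ (card T - 1 + 8)"
      using card_Un_le[of "T - {t}" "nbrs t"] card_nbrs(2)[of t] cT by (intro power_increasing) auto
    also have "sum ?w (?C ?U (T - {t})) \<le> 2 ^ card (T - {t})" by (rule IH) (use less.prems in auto)
    also have "2 ^ card (T - {t}) + 2 ^ (card T - 1 + 8) / 256 = (2 ^ card T :: real)"
      using cT by (cases "card T") (auto simp: power_add)
    finally show ?thesis by simp
  qed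
qed

lemma reach_intermediate:
  fixes c :: "bond \<Rightarrow> int"
  assumes step: "\<And>e f. f \<in> nbrs e \<Longrightarrow> c f \<le> c e + 1"
    and start: "\<And>e. e \<in> T \<Longrightarrow> c e \<le> a"
    and "e \<in> reach X T" "a < v" "v \<le> c e"
  shows "v \<in> c ` reach X T"
  using assms(3-)
proof induction
  case (start e) then show ?case using assms(2)[of e] by simp
next
  case (step e f)
  show ?case
  proof (cases "v \<le> c e")
    case False
    then have "v = c f" using step assms(1)[of f e] by simp
    then show ?thesis using reach.step[OF step.hyps] by blast
  qed (use step in auto)
qed

text \<open>
  A coordinate that changes by at most one between neighbours takes all intermediate values on a
  component, so far-reaching components are large.
\<close>

lemma card_reach_ge:
  fixes c :: "bond \<Rightarrow> int"
  assumes "\<And>e f. f \<in> nbrs e \<Longrightarrow> c f \<le> c e + 1"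
    and "\<And>e. e \<in> T \<Longrightarrow> c e \<le> a"
    and "e \<in> reach X T" "finite X"
  shows "c e - a \<le> int (card (reach X T))"
proof -
  have f: "finite (reach X T)" using reach_subset assms(4) by (rule finite_subset)
  have "{a<..c e} \<subseteq> c ` reach X T" using reach_intermediate[OF assms(1-3)] by auto
  then have "card {a<..c e} \<le> card (c ` reach X T)" using f by (intro card_mono) auto
  also have "\<dots> \<le> card (reach X T)" by (rule card_image_le[OF f])
  finally show ?thesis by simp
qed

section \<open>Partition functions with prescribed spins on the line\<close>

definition configs :: "(int \<times> int) set \<Rightarrow> (int \<Rightarrow> real) \<Rightarrow> (int \<times> int \<Rightarrow> real) set" where
  "configs \<Lambda> \<eta> = {\<sigma> \<in> spins. (\<forall>p. p \<notin> \<Lambda> \<longrightarrow> \<sigma> p = 1) \<and> (\<forall>k. \<sigma> (k, 0) = \<eta> k)}"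

definition weight :: "real \<Rightarrow> (int \<times> int \<Rightarrow> real) \<Rightarrow> real" where
  "weight q \<sigma> = q ^ card (boundary \<sigma>)"

definition part_fun :: "real \<Rightarrow> (int \<times> int) set \<Rightarrow> (int \<Rightarrow> real) \<Rightarrow> real" where
  "part_fun q \<Lambda> \<eta> = (\<Sum>\<sigma>\<in>configs \<Lambda> \<eta>. weight q \<sigma>)"

definition star :: "int set \<Rightarrow> bond set" where
  "star J = touching ((\<lambda>k. (k, 0)) ` J)"

lemma finite_star: "finite J \<Longrightarrow> finite (star J)"
  unfolding star_def by (intro finite_touching finite_imageI)

lemma card_star:
  assumes "finite J" shows "card (star J) \<le> 4 * card J"
proof -
  have "card (star J) \<le> 4 * card ((\<lambda>k::int. (k, 0::int)) ` J)"
    unfolding star_def using assms by (intro card_touching) simp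
  also have "\<dots> \<le> 4 * card J" using card_image_le[OF assms, of "\<lambda>k. (k, 0::int)"] by simp
  finally show ?thesis .
qed

lemma star_Hor: "Hor x y \<in> star J \<longleftrightarrow> y = 0 \<and> (x \<in> J \<or> x + 1 \<in> J)"
  unfolding star_def touching_def by auto

lemma star_Ver: "Ver x y \<in> star J \<longleftrightarrow> x \<in> J \<and> (y = 0 \<or> y + 1 = 0)"
  unfolding star_def touching_def by auto

lemma finite_configs: assumes "finite \<Lambda>" shows "finite (configs \<Lambda> \<eta>)"
proof (rule finite_subset)
  show "configs \<Lambda> \<eta> \<subseteq> (\<lambda>f p. if p \<in> \<Lambda> then f p else 1) ` (\<Lambda> \<rightarrow>\<^sub>E {1, -1})"
  proof
    fix \<sigma> assume "\<sigma> \<in> configs \<Lambda> \<eta>"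
    then show "\<sigma> \<in> (\<lambda>f p. if p \<in> \<Lambda> then f p else 1) ` (\<Lambda> \<rightarrow>\<^sub>E {1, -1})"
      by (intro image_eqI[of _ _ "restrict \<sigma> \<Lambda>"])
         (auto simp: configs_def spins_def fun_eq_iff)
  qed
  show "finite ((\<lambda>f p. if p \<in> \<Lambda> then f p else (1::real)) ` (\<Lambda> \<rightarrow>\<^sub>E {1, -1}))"
    using assms by (intro finite_imageI finite_PiE) auto
qed

lemma configsD: assumes "\<sigma> \<in> configs \<Lambda> \<eta>"
  shows "\<sigma> \<in> spins" "p \<notin> \<Lambda> \<Longrightarrow> \<sigma> p = 1" "\<sigma> (k, 0) = \<eta> k" "boundary \<sigma> \<subseteq> touching \<Lambda>"
  using assms boundary_touching[of \<Lambda> \<sigma>] unfolding configs_def by blast+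

lemma configs_finite:
  assumes "\<sigma> \<in> configs \<Lambda> \<eta>" "finite \<Lambda>"
  shows "finite (boundary \<sigma>)" "finite {p. \<sigma> p \<noteq> 1}"
proof -
  show "finite (boundary \<sigma>)" using configsD(4)[OF assms(1)] finite_touching[OF assms(2)] by (rule finite_subset)
  show "finite {p. \<sigma> p \<noteq> 1}" by (rule finite_subset[OF _ assms(2)]) (use configsD(2)[OF assms(1)] in auto)
qed

lemma part_fun_nonneg: "0 \<le> q \<Longrightarrow> 0 \<le> part_fun q \<Lambda> \<eta>"
  unfolding part_fun_def weight_def by (intro sum_nonneg) simp

lemma part_fun_plus_pos:
  assumes "0 < q" "finite \<Lambda>" shows "0 < part_fun q \<Lambda> (\<lambda>_. 1)"
proof -
  have "(\<lambda>_. 1) \<in> configs \<Lambda> (\<lambda>_. 1)" by (auto simp: configs_def spins_def)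
  then show ?thesis unfolding part_fun_def
    by (intro sum_pos2[OF finite_configs[OF assms(2)]]) (use assms in \<open>auto simp: weight_def\<close>)
qed

section \<open>Erasing contours\<close>

text \<open>
  Any union of components of a set that contains a contour cuts out a contour again.
\<close>

lemma boundary_fill_component:
  assumes "\<tau> \<in> spins" "boundary \<tau> \<subseteq> X" "finite X"
  shows "boundary (fill (boundary \<tau> \<inter> reach X T)) = boundary \<tau> \<inter> reach X T"
    and "boundary \<tau> \<inter> reach X T \<subseteq> touching ({a..b} \<times> {c..d}) \<Longrightarrow> p \<notin> {a..b} \<times> {c..d} \<Longrightarrow>
      fill (boundary \<tau> \<inter> reach X T) p = 1"
proof -
  have fin: "finite (boundary \<tau> \<inter> reach X T)" using assms(2,3) finite_subset by blast
  have cl: "closed_bonds (boundary \<tau> \<inter> reach X T)"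
    using closed_boundary[OF assms(1)] assms(2) reach_subset
    by (rule closed_Int_component) (auto intro: reach.step)
  show "boundary (fill (boundary \<tau> \<inter> reach X T)) = boundary \<tau> \<inter> reach X T"
    by (rule boundary_fill[OF fin cl])
  show "boundary \<tau> \<inter> reach X T \<subseteq> touching ({a..b} \<times> {c..d}) \<Longrightarrow> p \<notin> {a..b} \<times> {c..d} \<Longrightarrow>
      fill (boundary \<tau> \<inter> reach X T) p = 1"
    using fill_outside[OF fin cl] by blast
qed

text \<open>
  Every contour bond on the line lies in the star of \<open>J\<close>, since the line is plus off \<open>J\<close>. Erasing
  all components that meet this star therefore leaves a configuration that is plus on the whole
  line, whatever it was on \<open>J\<close>.
\<close>

lemma erase_component:
  assumes \<sigma>: "\<sigma> \<in> configs ({a..b} \<times> {c..d}) \<eta>" and \<eta>: "\<And>k. k \<notin> J \<Longrightarrow> \<eta> k = 1"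
    and X: "boundary \<sigma> \<subseteq> X" "finite X"
  defines "F \<equiv> boundary \<sigma> \<inter> reach X (star J)"
  shows "(\<lambda>p. \<sigma> p * fill F p) \<in> configs ({a..b} \<times> {c..d}) (\<lambda>_. 1)"
    and "boundary (\<lambda>p. \<sigma> p * fill F p) = boundary \<sigma> - reach X (star J)"
proof -
  have bF: "boundary (fill F) = F"
    unfolding F_def by (rule boundary_fill_component(1)[OF configsD(1)[OF \<sigma>] X])
  have fF: "finite F" unfolding F_def using X finite_subset by blast
  have out: "fill F p = 1" if "p \<notin> {a..b} \<times> {c..d}" for p
    unfolding F_def by (rule boundary_fill_component(2)[OF configsD(1)[OF \<sigma>] X _ that])
      (use configsD(4)[OF \<sigma>] in auto)
  have "Hor x 0 \<in> F \<longleftrightarrow> Hor x 0 \<in> boundary \<sigma>" for x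
  proof -
    have "Hor x 0 \<in> star J" if "Hor x 0 \<in> boundary \<sigma>"
      using \<eta>[of x] \<eta>[of "x + 1"] configsD(3)[OF \<sigma>] that unfolding star_Hor Hor_boundary by metis
    then show ?thesis using X(1) reach.start[of "Hor x 0" "star J" X] unfolding F_def by blast
  qed
  then have "fill F (k, 0) = \<sigma> (k, 0)" for k
    by (intro fill_row[OF configsD(1)[OF \<sigma>] fF] configs_finite(2)[OF \<sigma>]) auto
  then have "\<sigma> (k, 0) * fill F (k, 0) = 1" for k
    using spins_square[OF configsD(1)[OF \<sigma>]] by metis
  moreover have "\<sigma> p * fill F p = 1" if "p \<notin> {a..b} \<times> {c..d}" for p
    using out[OF that] configsD(2)[OF \<sigma> that] by simp
  ultimately show "(\<lambda>p. \<sigma> p * fill F p) \<in> configs ({a..b} \<times> {c..d}) (\<lambda>_. 1)"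
    using spins_mult[OF configsD(1)[OF \<sigma>] fill_spins, of F]
    unfolding configs_def by blast
  show "boundary (\<lambda>p. \<sigma> p * fill F p) = boundary \<sigma> - reach X (star J)"
    unfolding boundary_mult[OF configsD(1)[OF \<sigma>] fill_spins] bF unfolding F_def by blast
qed

text \<open>
  The factor \<open>1024 = 4 * 256\<close> splits into the number \<open>4 ^ card K\<close> of pairs of subsets of \<open>K\<close> and the
  weight for which the sum over all \<open>K\<close> is bounded.
\<close>

lemma sum_large_components:
  fixes q :: real
  assumes "finite U" "finite T" "0 \<le> q" "1024 * q \<le> 1"
  shows "(\<Sum>K | K \<subseteq> U \<and> reach K T = K \<and> r \<le> card K. (4 * q) ^ card K)
    \<le> 2 ^ card T * (1024 * q) ^ r"
proof -
  let ?A = "{K. K \<subseteq> U \<and> reach K T = K \<and> r \<le> card K}"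
  let ?B = "{K. K \<subseteq> U \<and> reach K T = K}"
  have "finite ?B" using assms(1) by (auto intro: finite_subset[of _ "Pow U"])
  have "(4 * q) ^ n = (1024 * q) ^ n * (1 / 256) ^ n" for n
    by (subst power_mult_distrib[symmetric]) simp
  then have "(\<Sum>K\<in>?A. (4 * q) ^ card K) = (\<Sum>K\<in>?A. (1024 * q) ^ card K * (1 / 256) ^ card K)"
    by (simp only:)
  also have "\<dots> \<le> (\<Sum>K\<in>?A. (1024 * q) ^ r * (1 / 256) ^ card K)"
    using assms by (intro sum_mono mult_right_mono power_decreasing) auto
  also have "\<dots> \<le> (\<Sum>K\<in>?B. (1024 * q) ^ r * (1 / 256) ^ card K)"
    using assms \<open>finite ?B\<close> by (intro sum_mono2) auto
  also have "\<dots> = (1024 * q) ^ r * (\<Sum>K\<in>?B. (1 / 256) ^ card K)" by (simp add: sum_distrib_left)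
  also have "\<dots> \<le> (1024 * q) ^ r * 2 ^ card T"
    using assms by (intro mult_left_mono sum_reachable_sets) auto
  finally show ?thesis by (simp add: mult.commute)
qed

text \<open>
  A pair of configurations is recovered from the set \<open>K\<close> of components, the parts of \<open>K\<close> that belong
  to either contour, and the two configurations left after \<open>K\<close> is erased. Erasing gains a factor
  \<open>q\<close> for each bond of \<open>K\<close>. The remaining configurations are plus on the line, so the bound does not
  depend on \<open>\<eta>\<close> and \<open>\<eta>'\<close>; the price of their minus spins is paid only later, when partition functions
  are divided by each other.
\<close>

lemma peierls_pairs:
  fixes \<Lambda> \<Lambda>' :: "(int \<times> int) set"
  assumes \<Lambda>: "\<Lambda> = {a..b} \<times> {c..d}" "\<Lambda>' = {a'..b'} \<times> {c'..d'}"
    and \<eta>: "\<And>k. k \<notin> J \<Longrightarrow> \<eta> k = 1" "\<And>k. k \<notin> J \<Longrightarrow> \<eta>' k = 1" and J: "finite J"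
    and q: "0 < q" "1024 * q \<le> 1"
  shows "(\<Sum>(\<sigma>, \<sigma>') | \<sigma> \<in> configs \<Lambda> \<eta> \<and> \<sigma>' \<in> configs \<Lambda>' \<eta>' \<and>
        r \<le> card (reach (boundary \<sigma> \<union> boundary \<sigma>') (star J)). weight q \<sigma> * weight q \<sigma>')
      \<le> 2 ^ card (star J) * (1024 * q) ^ r * (part_fun q \<Lambda> (\<lambda>_. 1) * part_fun q \<Lambda>' (\<lambda>_. 1))"
proof -
  have fin\<Lambda>: "finite \<Lambda>" "finite \<Lambda>'" using \<Lambda> by auto
  let ?K = "\<lambda>\<sigma> \<sigma>'. reach (boundary \<sigma> \<union> boundary \<sigma>') (star J)"
  let ?S = "{(\<sigma>, \<sigma>'). \<sigma> \<in> configs \<Lambda> \<eta> \<and> \<sigma>' \<in> configs \<Lambda>' \<eta>' \<and> r \<le> card (?K \<sigma> \<sigma>')}"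
  let ?U = "touching (\<Lambda> \<union> \<Lambda>')"
  let ?KK = "{K. K \<subseteq> ?U \<and> reach K (star J) = K \<and> r \<le> card K}"
  let ?C = "configs \<Lambda> (\<lambda>_. 1)" and ?C' = "configs \<Lambda>' (\<lambda>_. 1)"
  let ?D = "SIGMA K:?KK. (Pow K \<times> Pow K) \<times> (?C \<times> ?C')"
  define \<phi> where "\<phi> = (\<lambda>(\<sigma>, \<sigma>'). (?K \<sigma> \<sigma>', (boundary \<sigma> \<inter> ?K \<sigma> \<sigma>', boundary \<sigma>' \<inter> ?K \<sigma> \<sigma>'),
    ((\<lambda>p. \<sigma> p * fill (boundary \<sigma> \<inter> ?K \<sigma> \<sigma>') p), (\<lambda>p. \<sigma>' p * fill (boundary \<sigma>' \<inter> ?K \<sigma> \<sigma>') p))))"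
  define g :: "bond set \<times> (bond set \<times> bond set) \<times> ((int \<times> int \<Rightarrow> real) \<times> (int \<times> int \<Rightarrow> real)) \<Rightarrow> real"
    where "g = (\<lambda>(K, _, \<rho>, \<rho>'). q ^ card K * (weight q \<rho> * weight q \<rho>'))"
  have finU: "finite ?U" using fin\<Lambda> by (intro finite_touching) auto
  have finKK: "finite ?KK" using finU by (auto intro: finite_subset[of _ "Pow ?U"])
  have finD: "finite ?D"
    by (intro finite_SigmaI finKK finite_cartesian_product finite_configs fin\<Lambda>)
       (use finU finite_subset in auto)
  have inj: "inj_on \<phi> ?S"
  proof (rule inj_onI, clarify)
    fix \<sigma> \<sigma>' \<tau> \<tau>'
    assume "\<phi> (\<sigma>, \<sigma>') = \<phi> (\<tau>, \<tau>')"
    then have e: "boundary \<sigma> \<inter> ?K \<sigma> \<sigma>' = boundary \<tau> \<inter> ?K \<tau> \<tau>'"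
        "boundary \<sigma>' \<inter> ?K \<sigma> \<sigma>' = boundary \<tau>' \<inter> ?K \<tau> \<tau>'"
      and f: "(\<lambda>p. \<sigma> p * fill (boundary \<sigma> \<inter> ?K \<sigma> \<sigma>') p) = (\<lambda>p. \<tau> p * fill (boundary \<tau> \<inter> ?K \<tau> \<tau>') p)"
        "(\<lambda>p. \<sigma>' p * fill (boundary \<sigma>' \<inter> ?K \<sigma> \<sigma>') p) = (\<lambda>p. \<tau>' p * fill (boundary \<tau>' \<inter> ?K \<tau> \<tau>') p)"
      unfolding \<phi>_def by auto
    have n: "fill F p \<noteq> 0" for F p using spinsD[OF fill_spins[of F], of p] by auto
    show "\<sigma> = \<tau> \<and> \<sigma>' = \<tau>'"
      using f unfolding e by (auto simp: fun_eq_iff n)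
  qed
  have main: "\<phi> s \<in> ?D \<and> (case s of (\<sigma>, \<sigma>') \<Rightarrow> weight q \<sigma> * weight q \<sigma>') \<le> g (\<phi> s)" if sS: "s \<in> ?S" for s
  proof -
    obtain \<sigma> \<sigma>' where s: "s = (\<sigma>, \<sigma>')" "\<sigma> \<in> configs \<Lambda> \<eta>" "\<sigma>' \<in> configs \<Lambda>' \<eta>'" "r \<le> card (?K \<sigma> \<sigma>')"
      using sS by auto
    let ?X = "boundary \<sigma> \<union> boundary \<sigma>'"
    have fb: "finite (boundary \<sigma>)" "finite (boundary \<sigma>')"
      using configs_finite(1)[OF s(2) fin\<Lambda>(1)] configs_finite(1)[OF s(3) fin\<Lambda>(2)] .
    then have fX: "finite ?X" by simp
    have sub: "?X \<subseteq> ?U" using configsD(4)[OF s(2)] configsD(4)[OF s(3)] unfolding touching_def by blast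
    have fK: "finite (?K \<sigma> \<sigma>')" using reach_subset fX by (rule finite_subset)
    note er = erase_component[OF s(2)[unfolded \<Lambda>] \<eta>(1), of J ?X]
    note er' = erase_component[OF s(3)[unfolded \<Lambda>] \<eta>(2), of J ?X]
    have D: "\<phi> s \<in> ?D" unfolding s(1) \<phi>_def
      using er(1) er'(1) fX s(4) sub reach_subset[of ?X "star J"] by (auto simp: reach_idem \<Lambda>)
    have card: "card (boundary \<sigma>) = card (boundary \<sigma> \<inter> ?K \<sigma> \<sigma>') + card (boundary \<sigma> - ?K \<sigma> \<sigma>')"
      "card (boundary \<sigma>') = card (boundary \<sigma>' \<inter> ?K \<sigma> \<sigma>') + card (boundary \<sigma>' - ?K \<sigma> \<sigma>')"
      using fb by (metis card_Int_Diff)+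
    have "?K \<sigma> \<sigma>' = (boundary \<sigma> \<inter> ?K \<sigma> \<sigma>') \<union> (boundary \<sigma>' \<inter> ?K \<sigma> \<sigma>')"
      using reach_subset[of ?X "star J"] by blast
    then have "card (?K \<sigma> \<sigma>') \<le> card (boundary \<sigma> \<inter> ?K \<sigma> \<sigma>') + card (boundary \<sigma>' \<inter> ?K \<sigma> \<sigma>')"
      by (metis card_Un_le)
    then have le: "card (?K \<sigma> \<sigma>') + card (boundary \<sigma> - ?K \<sigma> \<sigma>') + card (boundary \<sigma>' - ?K \<sigma> \<sigma>')
      \<le> card (boundary \<sigma>) + card (boundary \<sigma>')" using card by linarith
    have "weight q \<sigma> * weight q \<sigma>' = q ^ (card (boundary \<sigma>) + card (boundary \<sigma>'))"
      unfolding weight_def by (simp add: power_add)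
    also have "\<dots> \<le> q ^ (card (?K \<sigma> \<sigma>') + card (boundary \<sigma> - ?K \<sigma> \<sigma>') + card (boundary \<sigma>' - ?K \<sigma> \<sigma>'))"
      using q by (intro power_decreasing le) auto
    also have "\<dots> = g (\<phi> s)"
      unfolding g_def s(1) \<phi>_def using er(2) er'(2) fX by (simp add: weight_def power_add)
    finally show ?thesis using D s(1) by simp
  qed
  have "(\<Sum>s\<in>?S. case s of (\<sigma>, \<sigma>') \<Rightarrow> weight q \<sigma> * weight q \<sigma>') \<le> (\<Sum>s\<in>?S. g (\<phi> s))"
    by (rule sum_mono) (use main in blast)
  also have "\<dots> = sum g (\<phi> ` ?S)" using sum.reindex[OF inj, of g] by simp
  also have "\<dots> \<le> sum g ?D"
  proof (rule sum_mono2[OF finD])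
    show "\<phi> ` ?S \<subseteq> ?D" using main by blast
    show "0 \<le> g x" for x using q by (cases x) (auto simp: g_def weight_def)
  qed
  also have "\<dots> = (\<Sum>K\<in>?KK. \<Sum>x\<in>(Pow K \<times> Pow K) \<times> (?C \<times> ?C'). g (K, x))"
  proof -
    have "(\<Sum>K\<in>?KK. \<Sum>x\<in>(Pow K \<times> Pow K) \<times> (?C \<times> ?C'). g (K, x)) = (\<Sum>(K, x)\<in>?D. g (K, x))"
      by (rule sum.Sigma[OF finKK])
        (use finU finite_configs[OF fin\<Lambda>(1)] finite_configs[OF fin\<Lambda>(2)] in
        \<open>auto intro!: finite_cartesian_product dest: finite_subset\<close>)
    then show ?thesis by simp
  qed
  also have "\<dots> = (\<Sum>K\<in>?KK. (4 * q) ^ card K * (part_fun q \<Lambda> (\<lambda>_. 1) * part_fun q \<Lambda>' (\<lambda>_. 1)))"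
  proof (rule sum.cong[OF refl])
    fix K assume "K \<in> ?KK"
    then have fK: "finite K" using finU finite_subset by auto
    have "(\<Sum>x\<in>(Pow K \<times> Pow K) \<times> (?C \<times> ?C'). g (K, x))
      = (\<Sum>x\<in>Pow K \<times> Pow K. \<Sum>(\<rho>, \<rho>')\<in>?C \<times> ?C'. q ^ card K * (weight q \<rho> * weight q \<rho>'))"
      unfolding sum.cartesian_product by (rule sum.cong[OF refl]) (simp add: g_def split_def)
    also have "\<dots> = real (card (Pow K \<times> Pow K)) * (q ^ card K * (\<Sum>(\<rho>, \<rho>')\<in>?C \<times> ?C'. weight q \<rho> * weight q \<rho>'))"
      by (simp add: sum_distrib_left split_def del: sum.cartesian_product)
    also have "(\<Sum>(\<rho>, \<rho>')\<in>?C \<times> ?C'. weight q \<rho> * weight q \<rho>') = part_fun q \<Lambda> (\<lambda>_. 1) * part_fun q \<Lambda>' (\<lambda>_. 1)"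
      unfolding part_fun_def by (simp add: sum_product sum.cartesian_product)
    also have "real (card (Pow K \<times> Pow K)) = 2 ^ card K * 2 ^ card K"
      using fK by (simp add: card_cartesian_product card_Pow)
    also have "\<dots> = 4 ^ card K" by (subst power_mult_distrib[symmetric]) simp
    finally show "(\<Sum>x\<in>(Pow K \<times> Pow K) \<times> (?C \<times> ?C'). g (K, x))
      = (4 * q) ^ card K * (part_fun q \<Lambda> (\<lambda>_. 1) * part_fun q \<Lambda>' (\<lambda>_. 1))"
      by (simp add: power_mult_distrib)
  qed
  also have "\<dots> = (\<Sum>K\<in>?KK. (4 * q) ^ card K) * (part_fun q \<Lambda> (\<lambda>_. 1) * part_fun q \<Lambda>' (\<lambda>_. 1))"
    by (simp add: sum_distrib_right)
  also have "\<dots> \<le> 2 ^ card (star J) * (1024 * q) ^ r * (part_fun q \<Lambda> (\<lambda>_. 1) * part_fun q \<Lambda>' (\<lambda>_. 1))"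
    using q by (intro mult_right_mono sum_large_components finU finite_star J mult_nonneg_nonneg part_fun_nonneg) auto
  finally show ?thesis by (simp add: split_def)
qed

section \<open>Exchanging contours\<close>

text \<open>
  The configuration by which both \<open>\<sigma>\<close> and \<open>\<sigma>'\<close> have to be multiplied to exchange their contours on
  the components of the joint contour set that meet \<open>T\<close>.
\<close>

definition exchange :: "bond set \<Rightarrow> (int \<times> int \<Rightarrow> real) \<Rightarrow> (int \<times> int \<Rightarrow> real) \<Rightarrow> int \<times> int \<Rightarrow> real" where
  "exchange T \<sigma> \<sigma>' = fill (boundary (\<lambda>p. \<sigma> p * \<sigma>' p) \<inter> reach (boundary \<sigma> \<union> boundary \<sigma>') T)"

text \<open>
  The joint contour set does not change, so neither do its components, and the exchange is an
  involution.
\<close>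

lemma exchange_boundaries:
  fixes \<sigma> \<sigma>' :: "int \<times> int \<Rightarrow> real" and T :: "bond set"
  assumes s: "\<sigma> \<in> spins" "\<sigma>' \<in> spins" and fin: "finite (boundary \<sigma>)" "finite (boundary \<sigma>')"
  defines "t \<equiv> exchange T \<sigma> \<sigma>'" and "K \<equiv> reach (boundary \<sigma> \<union> boundary \<sigma>') T"
  shows "boundary (\<lambda>p. \<sigma> p * t p) = (boundary \<sigma> - K) \<union> (boundary \<sigma>' \<inter> K)"
    and "boundary (\<lambda>p. \<sigma>' p * t p) = (boundary \<sigma>' - K) \<union> (boundary \<sigma> \<inter> K)"
    and "weight q (\<lambda>p. \<sigma> p * t p) * weight q (\<lambda>p. \<sigma>' p * t p) = weight q \<sigma> * weight q \<sigma>'"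
    and "exchange T (\<lambda>p. \<sigma> p * t p) (\<lambda>p. \<sigma>' p * t p) = t"
proof -
  note bm = boundary_mult[OF s]
  have bt: "boundary t = boundary (\<lambda>p. \<sigma> p * \<sigma>' p) \<inter> K"
    unfolding t_def exchange_def K_def
    by (rule boundary_fill_component(1)[OF spins_mult[OF s]]) (use fin in \<open>auto simp: bm\<close>)
  have ts: "t \<in> spins" unfolding t_def exchange_def by (rule fill_spins)
  show 1: "boundary (\<lambda>p. \<sigma> p * t p) = (boundary \<sigma> - K) \<union> (boundary \<sigma>' \<inter> K)"
    unfolding boundary_mult[OF s(1) ts] bt bm by blast
  show 2: "boundary (\<lambda>p. \<sigma>' p * t p) = (boundary \<sigma>' - K) \<union> (boundary \<sigma> \<inter> K)"
    unfolding boundary_mult[OF s(2) ts] bt bm by blast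
  have c: "card ((A - K) \<union> (B \<inter> K)) = card (A - K) + card (B \<inter> K)" if "finite A" "finite B" for A B :: "bond set"
    using that by (intro card_Un_disjoint) auto
  have d: "card A = card (A - K) + card (A \<inter> K)" if "finite A" for A :: "bond set"
    using that by (metis card_Int_Diff add.commute)
  show "weight q (\<lambda>p. \<sigma> p * t p) * weight q (\<lambda>p. \<sigma>' p * t p) = weight q \<sigma> * weight q \<sigma>'"
    unfolding weight_def 1 2 c[OF fin] c[OF fin(2,1)] d[OF fin(1)] d[OF fin(2)]
    by (simp add: power_add)
  have u: "boundary (\<lambda>p. \<sigma> p * t p) \<union> boundary (\<lambda>p. \<sigma>' p * t p) = boundary \<sigma> \<union> boundary \<sigma>'"
    unfolding 1 2 by blast
  have p: "(\<lambda>p. (\<sigma> p * t p) * (\<sigma>' p * t p)) = (\<lambda>p. \<sigma> p * \<sigma>' p)"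
    using spins_square[OF ts] by (simp add: fun_eq_iff mult.assoc mult.left_commute)
  show "exchange T (\<lambda>p. \<sigma> p * t p) (\<lambda>p. \<sigma>' p * t p) = t"
    unfolding exchange_def[of T "\<lambda>p. \<sigma> p * t p"] u p unfolding t_def exchange_def ..
qed

text \<open>
  On pairs with small components the exchange is injective and preserves the product of the
  weights. The other pairs are estimated by the Peierls bound.
\<close>

lemma exchange_bound:
  fixes \<Lambda> \<Lambda>' :: "(int \<times> int) set"
  assumes \<Lambda>: "\<Lambda> = {a..b} \<times> {c..d}" "\<Lambda>' = {a'..b'} \<times> {c'..d'}"
    and \<eta>: "\<And>k. k \<notin> J \<Longrightarrow> \<eta> k = 1" "\<And>k. k \<notin> J \<Longrightarrow> \<eta>' k = 1" and J: "finite J"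
    and q: "0 < q" "1024 * q \<le> 1"
    and good: "\<And>\<sigma> \<sigma>'. \<sigma> \<in> configs \<Lambda> \<eta> \<Longrightarrow> \<sigma>' \<in> configs \<Lambda>' \<eta>' \<Longrightarrow>
       card (reach (boundary \<sigma> \<union> boundary \<sigma>') (star J)) < r \<Longrightarrow>
       (\<lambda>p. \<sigma> p * exchange T \<sigma> \<sigma>' p) \<in> configs \<Lambda> \<theta> \<and> (\<lambda>p. \<sigma>' p * exchange T \<sigma> \<sigma>' p) \<in> configs \<Lambda>' \<theta>'"
  shows "part_fun q \<Lambda> \<eta> * part_fun q \<Lambda>' \<eta>' \<le> part_fun q \<Lambda> \<theta> * part_fun q \<Lambda>' \<theta>'
     + 2 ^ card (star J) * (1024 * q) ^ r * (part_fun q \<Lambda> (\<lambda>_. 1) * part_fun q \<Lambda>' (\<lambda>_. 1))"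
proof -
  have fin\<Lambda>: "finite \<Lambda>" "finite \<Lambda>'" using \<Lambda> by auto
  let ?w = "\<lambda>(\<sigma>, \<sigma>'). weight q \<sigma> * weight q \<sigma>'"
  let ?bad = "{(\<sigma>, \<sigma>'). \<sigma> \<in> configs \<Lambda> \<eta> \<and> \<sigma>' \<in> configs \<Lambda>' \<eta>' \<and> r \<le> card (reach (boundary \<sigma> \<union> boundary \<sigma>') (star J))}"
  let ?good = "{(\<sigma>, \<sigma>'). \<sigma> \<in> configs \<Lambda> \<eta> \<and> \<sigma>' \<in> configs \<Lambda>' \<eta>' \<and> card (reach (boundary \<sigma> \<union> boundary \<sigma>') (star J)) < r}"
  define \<psi> where "\<psi> = (\<lambda>(\<sigma>, \<sigma>'). ((\<lambda>p. \<sigma> p * exchange T \<sigma> \<sigma>' p), (\<lambda>p. \<sigma>' p * exchange T \<sigma> \<sigma>' p)))"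
  have finp: "finite (configs \<Lambda> \<eta> \<times> configs \<Lambda>' \<eta>')" "finite (configs \<Lambda> \<theta> \<times> configs \<Lambda>' \<theta>')"
    using fin\<Lambda> by (auto intro: finite_configs)
  have prod: "part_fun q \<Lambda> \<eta> * part_fun q \<Lambda>' \<eta>' = sum ?w (configs \<Lambda> \<eta> \<times> configs \<Lambda>' \<eta>')" for \<eta> \<eta>'
    unfolding part_fun_def by (simp add: sum_product sum.cartesian_product)
  have ex: "exchange T (fst (\<psi> (\<sigma>, \<sigma>'))) (snd (\<psi> (\<sigma>, \<sigma>'))) = exchange T \<sigma> \<sigma>'" "?w (\<psi> (\<sigma>, \<sigma>')) = ?w (\<sigma>, \<sigma>')"
    if "(\<sigma>, \<sigma>') \<in> ?good" for \<sigma> \<sigma>'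
  proof -
    have s: "\<sigma> \<in> configs \<Lambda> \<eta>" "\<sigma>' \<in> configs \<Lambda>' \<eta>'" using that by auto
    note e = exchange_boundaries[OF configsD(1)[OF s(1)] configsD(1)[OF s(2)] configs_finite(1)[OF s(1) fin\<Lambda>(1)] configs_finite(1)[OF s(2) fin\<Lambda>(2)], where T = T]
    show "exchange T (fst (\<psi> (\<sigma>, \<sigma>'))) (snd (\<psi> (\<sigma>, \<sigma>'))) = exchange T \<sigma> \<sigma>'" "?w (\<psi> (\<sigma>, \<sigma>')) = ?w (\<sigma>, \<sigma>')"
      unfolding \<psi>_def using e(3,4) by simp_all
  qed
  have n: "exchange T \<sigma> \<sigma>' p \<noteq> 0" for \<sigma> \<sigma>' p
    using spinsD[OF fill_spins, of _ p] unfolding exchange_def by (metis zero_neq_neg_one zero_neq_one)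
  have inj: "inj_on \<psi> ?good"
  proof (rule inj_onI)
    fix s s' assume s: "s \<in> ?good" "s' \<in> ?good" "\<psi> s = \<psi> s'"
    obtain \<sigma> \<sigma>' \<tau> \<tau>' where p: "s = (\<sigma>, \<sigma>')" "s' = (\<tau>, \<tau>')" by (metis surj_pair)
    have "exchange T \<sigma> \<sigma>' = exchange T \<tau> \<tau>'" using ex(1)[of \<sigma> \<sigma>'] ex(1)[of \<tau> \<tau>'] s p by simp
    then show "s = s'" using s(3) n unfolding p \<psi>_def by (auto simp: fun_eq_iff)
  qed
  have "part_fun q \<Lambda> \<eta> * part_fun q \<Lambda>' \<eta>' = sum ?w (?good \<union> ?bad)"
    unfolding prod by (rule sum.cong) auto
  also have "\<dots> = sum ?w ?good + sum ?w ?bad"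
    by (rule sum.union_disjoint) (use finp(1) in \<open>auto intro: finite_subset[rotated]\<close>)
  also have "sum ?w ?good = sum ?w (\<psi> ` ?good)"
    unfolding sum.reindex[OF inj] by (rule sum.cong) (use ex(2) in auto)
  also have "\<dots> \<le> sum ?w (configs \<Lambda> \<theta> \<times> configs \<Lambda>' \<theta>')"
    by (rule sum_mono2[OF finp(2)]) (use good q in \<open>auto simp: \<psi>_def weight_def\<close>)
  also have "sum ?w ?bad \<le> 2 ^ card (star J) * (1024 * q) ^ r * (part_fun q \<Lambda> (\<lambda>_. 1) * part_fun q \<Lambda>' (\<lambda>_. 1))"
    using peierls_pairs[OF \<Lambda> \<eta> J q] by simp
  finally show ?thesis unfolding prod by simp
qed

section \<open>Locality of the dependence on box and line\<close>

definition minus_on :: "int set \<Rightarrow> int \<Rightarrow> real" where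
  "minus_on M = (\<lambda>k. if k \<in> M then -1 else 1)"

lemma minus_on_empty: "minus_on {} = (\<lambda>_. 1)"
  by (simp add: minus_on_def)

definition x_coord :: "bond \<Rightarrow> int" where
  "x_coord e = (case e of Hor x y \<Rightarrow> x | Ver x y \<Rightarrow> x)"

definition y_coord :: "bond \<Rightarrow> int" where
  "y_coord e = (case e of Hor x y \<Rightarrow> y | Ver x y \<Rightarrow> y)"

lemma coord_nbrs:
  assumes "f \<in> nbrs e"
  shows "\<bar>x_coord f - x_coord e\<bar> \<le> 1" "\<bar>y_coord f - y_coord e\<bar> \<le> 1"
  using assms by (cases e; cases f; auto simp: x_coord_def y_coord_def plaquette_def)+

lemma coord_star:
  assumes "e \<in> star J"
  shows "\<exists>k\<in>J. k - 1 \<le> x_coord e \<and> x_coord e \<le> k" "-1 \<le> y_coord e" "y_coord e \<le> 0"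
proof -
  show "\<exists>k\<in>J. k - 1 \<le> x_coord e \<and> x_coord e \<le> k"
  proof (cases e)
    case (Hor x y)
    then consider "x \<in> J" | "x + 1 \<in> J" using assms by (auto simp: star_Hor)
    then show ?thesis unfolding Hor x_coord_def bond.case
      by cases (auto intro: bexI[of _ x] bexI[of _ "x + 1"])
  next
    case (Ver x y)
    then show ?thesis using assms unfolding x_coord_def by (auto simp: star_Ver intro: bexI[of _ x])
  qed
  show "-1 \<le> y_coord e" "y_coord e \<le> 0"
    using assms by (cases e; auto simp: y_coord_def star_Hor star_Ver)+
qed

text \<open>
  Small components do not see the boundary of a large box.
\<close>

lemma reach_star_localized:
  assumes "finite X" "card (reach X (star {j..i})) < r" "e \<in> reach X (star {j..i})"
  shows "j - int r \<le> x_coord e" "x_coord e \<le> i + int r" "- int r \<le> y_coord e" "y_coord e \<le> int r"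
proof -
  have "x_coord e - i \<le> int (card (reach X (star {j..i})))"
    by (rule card_reach_ge[OF _ _ assms(3,1)]) (use coord_nbrs(1) coord_star(1) in fastforce)+
  then show "x_coord e \<le> i + int r" using assms(2) by linarith
  have "- x_coord e - (1 - j) \<le> int (card (reach X (star {j..i})))"
    by (rule card_reach_ge[OF _ _ assms(3,1), where c = "\<lambda>e. - x_coord e"])
       (use coord_nbrs(1) coord_star(1) in fastforce)+
  then show "j - int r \<le> x_coord e" using assms(2) by linarith
  have "y_coord e - 0 \<le> int (card (reach X (star {j..i})))"
    by (rule card_reach_ge[OF _ _ assms(3,1)]) (use coord_nbrs(2) coord_star(3) in fastforce)+
  then show "y_coord e \<le> int r" using assms(2) by linarith
  have "- y_coord e - 1 \<le> int (card (reach X (star {j..i})))"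
    by (rule card_reach_ge[OF _ _ assms(3,1), where c = "\<lambda>e. - y_coord e"])
       (use coord_nbrs(2) coord_star(2) in fastforce)+
  then show "- int r \<le> y_coord e" using assms(2) by linarith
qed

lemma touching_coord: "(x_coord e, y_coord e) \<in> R \<Longrightarrow> e \<in> touching R"
  by (cases e) (auto simp: touching_def x_coord_def y_coord_def)

text \<open>
  The exchange on all components that meet the star of the interval moves the minus spins \<open>M\<close> from one box to the
  other. Small components lie in both boxes, so the exchanged configurations are still plus outside
  their boxes.
\<close>

lemma box_independence_aux:
  assumes \<Lambda>: "\<Lambda> = {a..b} \<times> {c..d}" "\<Lambda>' = {a'..b'} \<times> {c'..d'}"
    and sub: "{j - int r..i + int r} \<times> {- int r..int r} \<subseteq> \<Lambda>" "{j - int r..i + int r} \<times> {- int r..int r} \<subseteq> \<Lambda>'"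
    and M: "M \<subseteq> {j..i}" and q: "0 < q" "1024 * q \<le> 1"
  shows "part_fun q \<Lambda> (minus_on M) * part_fun q \<Lambda>' (minus_on {}) \<le> part_fun q \<Lambda> (minus_on {}) * part_fun q \<Lambda>' (minus_on M)
    + 2 ^ card (star {j..i}) * (1024 * q) ^ r * (part_fun q \<Lambda> (minus_on {}) * part_fun q \<Lambda>' (minus_on {}))"
proof -
  have fin\<Lambda>: "finite \<Lambda>" "finite \<Lambda>'" using \<Lambda> by auto
  have main: "(\<lambda>p. \<sigma> p * exchange (star {j..i}) \<sigma> \<sigma>' p) \<in> configs \<Lambda> (minus_on {})
     \<and> (\<lambda>p. \<sigma>' p * exchange (star {j..i}) \<sigma> \<sigma>' p) \<in> configs \<Lambda>' (minus_on M)"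
    if s: "\<sigma> \<in> configs \<Lambda> (minus_on M)" "\<sigma>' \<in> configs \<Lambda>' (minus_on {})"
      and K: "card (reach (boundary \<sigma> \<union> boundary \<sigma>') (star {j..i})) < r" for \<sigma> \<sigma>'
  proof -
    let ?X = "boundary \<sigma> \<union> boundary \<sigma>'"
    let ?\<tau> = "\<lambda>p. \<sigma> p * \<sigma>' p"
    let ?F = "boundary ?\<tau> \<inter> reach ?X (star {j..i})"
    note sp = configsD(1)[OF s(1)] configsD(1)[OF s(2)]
    have \<tau>: "?\<tau> \<in> spins" by (rule spins_mult[OF sp])
    have fX: "finite ?X" using configs_finite(1)[OF s(1) fin\<Lambda>(1)] configs_finite(1)[OF s(2) fin\<Lambda>(2)] by simp
    have bX: "boundary ?\<tau> \<subseteq> ?X" unfolding boundary_mult[OF sp] by blast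
    have int: "\<Lambda> \<inter> \<Lambda>' = {max a a'..min b b'} \<times> {max c c'..min d d'}"
      unfolding \<Lambda> by auto
    have "reach ?X (star {j..i}) \<subseteq> touching (\<Lambda> \<inter> \<Lambda>')"
    proof
      fix e assume "e \<in> reach ?X (star {j..i})"
      then have "(x_coord e, y_coord e) \<in> {j - int r..i + int r} \<times> {- int r..int r}"
        using reach_star_localized[OF fX K] by auto
      then show "e \<in> touching (\<Lambda> \<inter> \<Lambda>')" using sub by (intro touching_coord) auto
    qed
    then have F: "?F \<subseteq> touching ({max a a'..min b b'} \<times> {max c c'..min d d'})" unfolding int by blast
    have out: "fill ?F p = 1" if "p \<notin> \<Lambda> \<or> p \<notin> \<Lambda>'" for p
      by (rule boundary_fill_component(2)[OF \<tau> bX fX F]) (use that int in blast)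
    have layer: "?\<tau> (k, 0) = minus_on M k" for k
      using configsD(3)[OF s(1)] configsD(3)[OF s(2)] by (simp add: minus_on_def)
    have "Hor x 0 \<in> ?F \<longleftrightarrow> Hor x 0 \<in> boundary ?\<tau>" for x
    proof -
      have "Hor x 0 \<in> star {j..i}" if "Hor x 0 \<in> boundary ?\<tau>"
        using that layer M unfolding star_Hor Hor_boundary minus_on_def by (auto split: if_splits)
      then show ?thesis using bX reach.start[of "Hor x 0" "star {j..i}" ?X] by blast
    qed
    then have row: "fill ?F (k, 0) = \<sigma> (k, 0) * \<sigma>' (k, 0)" for k
    proof (intro fill_row[OF \<tau>])
      show "finite ?F" using fX bX finite_subset by blast
      show "finite {p. \<sigma> p * \<sigma>' p \<noteq> 1}"
        by (rule finite_subset[of _ "\<Lambda> \<union> \<Lambda>'"])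
          (use fin\<Lambda> configsD(2)[OF s(1)] configsD(2)[OF s(2)] in force)+
    qed
    have e: "exchange (star {j..i}) \<sigma> \<sigma>' = fill ?F" unfolding exchange_def ..
    have "\<sigma> (k, 0) * fill ?F (k, 0) = minus_on {} k" "\<sigma>' (k, 0) * fill ?F (k, 0) = minus_on M k" for k
      unfolding row using configsD(3)[OF s(1)] configsD(3)[OF s(2)] by (auto simp: minus_on_def)
    moreover have "\<sigma> p * fill ?F p = 1" if "p \<notin> \<Lambda>" for p using out configsD(2)[OF s(1) that] that by simp
    moreover have "\<sigma>' p * fill ?F p = 1" if "p \<notin> \<Lambda>'" for p using out configsD(2)[OF s(2) that] that by simp
    ultimately show ?thesis
      unfolding e configs_def using spins_mult[OF sp(1) fill_spins] spins_mult[OF sp(2) fill_spins]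
      by blast
  qed
  have "part_fun q \<Lambda> (minus_on M) * part_fun q \<Lambda>' (minus_on {}) \<le> part_fun q \<Lambda> (minus_on {}) * part_fun q \<Lambda>' (minus_on M)
    + 2 ^ card (star {j..i}) * (1024 * q) ^ r * (part_fun q \<Lambda> (\<lambda>_. 1) * part_fun q \<Lambda>' (\<lambda>_. 1))"
    by (rule exchange_bound[OF \<Lambda> _ _ _ q main]) (use M in \<open>auto simp: minus_on_def\<close>)
  then show ?thesis unfolding minus_on_empty .
qed

lemma box_independence:
  assumes "\<Lambda> = {a..b} \<times> {c..d}" "\<Lambda>' = {a'..b'} \<times> {c'..d'}"
    and "{j - int r..i + int r} \<times> {- int r..int r} \<subseteq> \<Lambda>" "{j - int r..i + int r} \<times> {- int r..int r} \<subseteq> \<Lambda>'"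
    and "M \<subseteq> {j..i}" and q: "0 < q" "1024 * q \<le> 1"
  shows "\<bar>part_fun q \<Lambda> (minus_on M) / part_fun q \<Lambda> (minus_on {}) - part_fun q \<Lambda>' (minus_on M) / part_fun q \<Lambda>' (minus_on {})\<bar>
    \<le> 2 ^ card (star {j..i}) * (1024 * q) ^ r"
proof -
  have "finite \<Lambda>" "finite \<Lambda>'" using assms(1,2) by auto
  then have pos: "0 < part_fun q \<Lambda> (minus_on {})" "0 < part_fun q \<Lambda>' (minus_on {})"
    using part_fun_plus_pos q unfolding minus_on_empty by auto
  define E :: real where "E = 2 ^ card (star {j..i}) * (1024 * q) ^ r"
  have 1: "part_fun q \<Lambda> (minus_on M) * part_fun q \<Lambda>' (minus_on {}) \<le> part_fun q \<Lambda> (minus_on {}) * part_fun q \<Lambda>' (minus_on M)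
    + E * (part_fun q \<Lambda> (minus_on {}) * part_fun q \<Lambda>' (minus_on {}))"
    unfolding E_def by (rule box_independence_aux) (fact assms)+
  have 2: "part_fun q \<Lambda>' (minus_on M) * part_fun q \<Lambda> (minus_on {}) \<le> part_fun q \<Lambda>' (minus_on {}) * part_fun q \<Lambda> (minus_on M)
    + E * (part_fun q \<Lambda>' (minus_on {}) * part_fun q \<Lambda> (minus_on {}))"
    unfolding E_def by (rule box_independence_aux) (fact assms)+
  have "part_fun q \<Lambda> (minus_on M) / part_fun q \<Lambda> (minus_on {}) \<le> part_fun q \<Lambda>' (minus_on M) / part_fun q \<Lambda>' (minus_on {}) + E"
    using 1 pos by (simp add: field_simps)
  moreover have "part_fun q \<Lambda>' (minus_on M) / part_fun q \<Lambda>' (minus_on {}) \<le> part_fun q \<Lambda> (minus_on M) / part_fun q \<Lambda> (minus_on {}) + E"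
    using 2 pos by (simp add: field_simps)
  ultimately show ?thesis unfolding E_def by linarith
qed

text \<open>
  The two layers differ at \<open>j\<close> and \<open>i\<close> only. A component around \<open>j\<close> that does not reach \<open>i\<close> contains,
  among the bonds on the line where the two contours differ, just the two bonds at \<open>j\<close>. The exchange
  thus swaps the spins at \<open>j\<close> and leaves all others on the line as they are.
\<close>

lemma decoupling_aux:
  assumes \<Lambda>: "\<Lambda> = {a..b} \<times> {c..d}" and ji: "j + 2 \<le> i" and q: "0 < q" "1024 * q \<le> 1"
    and M: "M \<subseteq> {j..i}" "M' \<subseteq> {j..i}" "\<And>k. k \<noteq> j \<Longrightarrow> k \<noteq> i \<Longrightarrow> k \<in> M \<longleftrightarrow> k \<in> M'"
      "j \<in> M \<longleftrightarrow> j \<notin> M'" "i \<in> M \<longleftrightarrow> i \<notin> M'"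
    and N: "N = (M - {j}) \<union> (M' \<inter> {j})" "N' = (M' - {j}) \<union> (M \<inter> {j})"
  shows "part_fun q \<Lambda> (minus_on M) * part_fun q \<Lambda> (minus_on M') \<le> part_fun q \<Lambda> (minus_on N) * part_fun q \<Lambda> (minus_on N')
    + 2 ^ card (star {j..i}) * (1024 * q) ^ nat (i - j - 1) * (part_fun q \<Lambda> (minus_on {}) * part_fun q \<Lambda> (minus_on {}))"
proof -
  have fin\<Lambda>: "finite \<Lambda>" using \<Lambda> by auto
  have main: "(\<lambda>p. \<sigma> p * exchange (star {j}) \<sigma> \<sigma>' p) \<in> configs \<Lambda> (minus_on N)
     \<and> (\<lambda>p. \<sigma>' p * exchange (star {j}) \<sigma> \<sigma>' p) \<in> configs \<Lambda> (minus_on N')"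
    if s: "\<sigma> \<in> configs \<Lambda> (minus_on M)" "\<sigma>' \<in> configs \<Lambda> (minus_on M')"
      and K: "card (reach (boundary \<sigma> \<union> boundary \<sigma>') (star {j..i})) < nat (i - j - 1)" for \<sigma> \<sigma>'
  proof -
    let ?X = "boundary \<sigma> \<union> boundary \<sigma>'"
    let ?K = "reach ?X (star {j})"
    let ?\<tau> = "\<lambda>p. \<sigma> p * \<sigma>' p"
    let ?F = "boundary ?\<tau> \<inter> ?K"
    note sp = configsD(1)[OF s(1)] configsD(1)[OF s(2)]
    have \<tau>: "?\<tau> \<in> spins" by (rule spins_mult[OF sp])
    have fX: "finite ?X" using configs_finite(1)[OF s(1) fin\<Lambda>] configs_finite(1)[OF s(2) fin\<Lambda>] by simp
    have bX: "boundary ?\<tau> \<subseteq> ?X" unfolding boundary_mult[OF sp] by blast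
    have "?X \<subseteq> touching \<Lambda>" using configsD(4)[OF s(1)] configsD(4)[OF s(2)] by blast
    then have F: "?F \<subseteq> touching ({a..b} \<times> {c..d})" using bX unfolding \<Lambda> by blast
    have out: "fill ?F p = 1" if "p \<notin> \<Lambda>" for p
      by (rule boundary_fill_component(2)[OF \<tau> bX fX F]) (use that \<Lambda> in blast)
    have "star {j} \<subseteq> star {j..i}" using ji unfolding star_def touching_def by auto
    then have "?K \<subseteq> reach ?X (star {j..i})" by (rule reach_mono)
    then have cK: "card ?K < nat (i - j - 1)"
      using K card_mono[of "reach ?X (star {j..i})" ?K] finite_subset[OF reach_subset fX] by fastforce
    \<comment> \<open>The bonds at \<open>i\<close> have abscissa \<open>i - 1\<close> or \<open>i\<close>, out of reach for so few bonds.\<close>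
    have far: "e \<notin> ?K" if "x_coord e \<ge> i - 1" for e
    proof
      assume e: "e \<in> ?K"
      have "x_coord e - j \<le> int (card ?K)"
        by (rule card_reach_ge[OF _ _ e fX]) (use coord_nbrs(1) coord_star(1) in fastforce)+
      then show False using cK that by linarith
    qed
    have layer: "?\<tau> (k, 0) = (if k = j \<or> k = i then -1 else 1)" for k
      using configsD(3)[OF s(1)] configsD(3)[OF s(2)] M(3)[of k] M(4,5) by (auto simp: minus_on_def)
    \<comment> \<open>On the line, the exchange acts like the flip of the single site \<open>j\<close>.\<close>
    let ?\<delta> = "\<lambda>p. if p = (j, 0) then -1 else 1 :: real"
    have "Hor x 0 \<in> ?F \<longleftrightarrow> Hor x 0 \<in> boundary ?\<delta>" for x
    proof -
      have b: "Hor x 0 \<in> boundary ?\<tau> \<longleftrightarrow> x = j - 1 \<or> x = j \<or> x = i - 1 \<or> x = i"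
        unfolding Hor_boundary layer using ji by auto
      have d: "Hor x 0 \<in> boundary ?\<delta> \<longleftrightarrow> x = j - 1 \<or> x = j" unfolding Hor_boundary by auto
      have "Hor x 0 \<in> ?K" if "x = j - 1 \<or> x = j"
        using that b bX by (intro reach.start) (auto simp: star_Hor)
      moreover have "Hor x 0 \<notin> ?K" if "x = i - 1 \<or> x = i"
        by (rule far) (use that in \<open>auto simp: x_coord_def\<close>)
      ultimately show ?thesis using b d by blast
    qed
    then have Hrow: "\<And>x. Hor x 0 \<in> ?F \<longleftrightarrow> Hor x 0 \<in> boundary ?\<delta>" .
    have fF: "finite ?F" using fX bX finite_subset by blast
    have f\<delta>: "finite {p. ?\<delta> p \<noteq> 1}" by (rule finite_subset[of _ "{(j, 0)}"]) auto
    have \<delta>: "?\<delta> \<in> spins" by (auto simp: spins_def)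
    have row: "fill ?F (k, 0) = (if k = j then -1 else 1)" for k
      using fill_row[OF \<delta> fF f\<delta> Hrow, of k] by simp
    have e: "exchange (star {j}) \<sigma> \<sigma>' = fill ?F" unfolding exchange_def ..
    have "\<sigma> (k, 0) * fill ?F (k, 0) = minus_on N k" "\<sigma>' (k, 0) * fill ?F (k, 0) = minus_on N' k" for k
      unfolding row N using configsD(3)[OF s(1), of k] configsD(3)[OF s(2), of k] M(4) by (auto simp: minus_on_def)
    moreover have "\<sigma> p * fill ?F p = 1" if "p \<notin> \<Lambda>" for p using out configsD(2)[OF s(1) that] that by simp
    moreover have "\<sigma>' p * fill ?F p = 1" if "p \<notin> \<Lambda>" for p using out configsD(2)[OF s(2) that] that by simp
    ultimately show ?thesis
      unfolding e configs_def using spins_mult[OF sp(1) fill_spins] spins_mult[OF sp(2) fill_spins]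
      by blast
  qed
  have "part_fun q \<Lambda> (minus_on M) * part_fun q \<Lambda> (minus_on M') \<le> part_fun q \<Lambda> (minus_on N) * part_fun q \<Lambda> (minus_on N')
    + 2 ^ card (star {j..i}) * (1024 * q) ^ nat (i - j - 1) * (part_fun q \<Lambda> (\<lambda>_. 1) * part_fun q \<Lambda> (\<lambda>_. 1))"
    by (rule exchange_bound[OF \<Lambda> \<Lambda> _ _ _ q main]) (use M in \<open>auto simp: minus_on_def\<close>)
  then show ?thesis unfolding minus_on_empty .
qed

text \<open>
  Both inequalities come from the same exchange, applied to either pair of layers.
\<close>

lemma decoupling:
  assumes \<Lambda>: "\<Lambda> = {a..b} \<times> {c..d}" and ji: "j + 2 \<le> i" and q: "0 < q" "1024 * q \<le> 1"
    and M: "M \<subseteq> {j<..<i}"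
  shows "\<bar>part_fun q \<Lambda> (minus_on (insert j M)) * part_fun q \<Lambda> (minus_on (insert i M))
      - part_fun q \<Lambda> (minus_on M) * part_fun q \<Lambda> (minus_on (insert j (insert i M)))\<bar>
    \<le> 2 ^ card (star {j..i}) * (1024 * q) ^ nat (i - j - 1) * (part_fun q \<Lambda> (minus_on {}) * part_fun q \<Lambda> (minus_on {}))"
proof -
  have ni: "j \<notin> M" "i \<notin> M" "j \<noteq> i" using M ji by auto
  have "part_fun q \<Lambda> (minus_on (insert j M)) * part_fun q \<Lambda> (minus_on (insert i M))
    \<le> part_fun q \<Lambda> (minus_on M) * part_fun q \<Lambda> (minus_on (insert j (insert i M)))
    + 2 ^ card (star {j..i}) * (1024 * q) ^ nat (i - j - 1) * (part_fun q \<Lambda> (minus_on {}) * part_fun q \<Lambda> (minus_on {}))"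
    by (rule decoupling_aux[OF \<Lambda> ji q]) (use M ji ni in auto)
  moreover have "part_fun q \<Lambda> (minus_on M) * part_fun q \<Lambda> (minus_on (insert j (insert i M)))
    \<le> part_fun q \<Lambda> (minus_on (insert j M)) * part_fun q \<Lambda> (minus_on (insert i M))
    + 2 ^ card (star {j..i}) * (1024 * q) ^ nat (i - j - 1) * (part_fun q \<Lambda> (minus_on {}) * part_fun q \<Lambda> (minus_on {}))"
    by (rule decoupling_aux[OF \<Lambda> ji q]) (use M ji ni in auto)
  ultimately show ?thesis by linarith
qed

text \<open>
  A flip changes the state of the four bonds at the site only.
\<close>

lemma single_flip:
  assumes "finite \<Lambda>" "0 < q" "q \<le> 1" "(k, 0) \<in> \<Lambda>" and \<eta>': "\<eta>' = \<eta>(k := - \<eta> k)"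
  shows "q ^ 4 * part_fun q \<Lambda> \<eta> \<le> part_fun q \<Lambda> \<eta>'"
proof -
  let ?f = "\<lambda>\<sigma>::int \<times> int \<Rightarrow> real. \<sigma>((k, 0) := - \<sigma> (k, 0))"
  have inj: "inj_on ?f (configs \<Lambda> \<eta>)"
  proof (rule inj_onI)
    fix \<sigma> \<tau> assume *: "?f \<sigma> = ?f \<tau>"
    have "\<sigma> p = \<tau> p" for p using fun_cong[OF *, of p] by (cases "p = (k, 0)") auto
    then show "\<sigma> = \<tau>" by blast
  qed
  have sub: "?f ` configs \<Lambda> \<eta> \<subseteq> configs \<Lambda> \<eta>'"
  proof (rule image_subsetI)
    fix \<sigma> assume \<sigma>: "\<sigma> \<in> configs \<Lambda> \<eta>"
    have "?f \<sigma> p = 1 \<or> ?f \<sigma> p = -1" for p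
      using spinsD[OF configsD(1)[OF \<sigma>], of p] spinsD[OF configsD(1)[OF \<sigma>], of "(k, 0)"] by auto
    then show "?f \<sigma> \<in> configs \<Lambda> \<eta>'"
      using configsD(2,3)[OF \<sigma>] assms(4) unfolding configs_def spins_def \<eta>' mem_Collect_eq by auto
  qed
  have "q ^ 4 * weight q \<sigma> \<le> weight q (?f \<sigma>)" if \<sigma>: "\<sigma> \<in> configs \<Lambda> \<eta>" for \<sigma>
  proof -
    have "boundary (?f \<sigma>) \<subseteq> boundary \<sigma> \<union> star_of (k, 0)"
    proof
      fix e assume "e \<in> boundary (?f \<sigma>)"
      then show "e \<in> boundary \<sigma> \<union> star_of (k, 0)"
        unfolding Un_iff star_of_iff boundary_def by (force split: if_splits)
    qed
    then have "card (boundary (?f \<sigma>)) \<le> card (boundary \<sigma> \<union> star_of (k, 0))"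
      using configs_finite(1)[OF \<sigma> assms(1)] card_star_of(1) by (intro card_mono) auto
    also have "\<dots> \<le> card (boundary \<sigma>) + 4"
      using card_Un_le[of "boundary \<sigma>" "star_of (k, 0)"] card_star_of(2)[of "(k, 0)"] by linarith
    finally have "q ^ (card (boundary \<sigma>) + 4) \<le> q ^ card (boundary (?f \<sigma>))"
      using assms by (intro power_decreasing) auto
    then show ?thesis unfolding weight_def by (simp add: power_add mult.commute)
  qed
  then have "q ^ 4 * part_fun q \<Lambda> \<eta> \<le> (\<Sum>\<sigma>\<in>configs \<Lambda> \<eta>. weight q (?f \<sigma>))"
    unfolding part_fun_def sum_distrib_left by (rule sum_mono)
  also have "\<dots> = sum (weight q) (?f ` configs \<Lambda> \<eta>)" by (simp add: sum.reindex[OF inj])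
  also have "\<dots> \<le> part_fun q \<Lambda> \<eta>'" unfolding part_fun_def
    by (rule sum_mono2[OF finite_configs[OF assms(1)] sub]) (use assms in \<open>auto simp: weight_def\<close>)
  finally show ?thesis .
qed

section \<open>The infinite volume ratios\<close>

definition ratio :: "real \<Rightarrow> int set \<Rightarrow> nat \<Rightarrow> real" where
  "ratio q M n = part_fun q (square n) (minus_on M) / part_fun q (square n) (minus_on {})"

definition plus_ratio :: "real \<Rightarrow> int set \<Rightarrow> real" where
  "plus_ratio q M = lim (ratio q M)"

lemma geometric_small:
  fixes q :: real
  assumes "0 < q" "1024 * q < 1" "0 < e"
  obtains r where "c * (1024 * q) ^ r < e"
proof -
  have "(\<lambda>r. c * (1024 * q) ^ r) \<longlonglongrightarrow> c * 0"
    using assms by (intro tendsto_mult_left LIMSEQ_power_zero) auto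
  then have "eventually (\<lambda>r. c * (1024 * q) ^ r < e) sequentially"
    using assms(3) by (intro order_tendstoD) auto
  then show ?thesis using that by (auto simp: eventually_sequentially)
qed

lemma finite_interval_cover:
  assumes "finite (M :: int set)" obtains j i where "M \<subseteq> {j..i}"
proof (cases "M = {}")
  case False
  have "M \<subseteq> {Min M..Max M}" using assms by auto
  then show ?thesis by (rule that)
qed (use that in auto)

lemma square_rect: "square n = {- int n..int n} \<times> {- int n..int n}"
  by (simp add: square_def)

text \<open>
  Two large boxes have nearly the same ratio, so the ratios form a Cauchy sequence.
\<close>

lemma ratio_tendsto:
  assumes q: "0 < q" "1024 * q < 1" and M: "finite M"
  shows "ratio q M \<longlonglongrightarrow> plus_ratio q M"
proof -
  obtain j i where ji: "M \<subseteq> {j..i}" using finite_interval_cover[OF M] .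
  have "Cauchy (ratio q M)"
  proof (rule metric_CauchyI)
    fix e :: real assume "0 < e"
    then obtain r where r: "2 ^ card (star {j..i}) * (1024 * q) ^ r < e"
      using geometric_small[OF q] by metis
    show "\<exists>N. \<forall>m\<ge>N. \<forall>n\<ge>N. dist (ratio q M m) (ratio q M n) < e"
    proof (intro exI allI impI)
      fix m n assume "nat (\<bar>j\<bar> + \<bar>i\<bar>) + r \<le> m" "nat (\<bar>j\<bar> + \<bar>i\<bar>) + r \<le> n"
      then have "\<bar>ratio q M m - ratio q M n\<bar> \<le> 2 ^ card (star {j..i}) * (1024 * q) ^ r"
        unfolding ratio_def using q by (intro box_independence[OF square_rect square_rect _ _ ji])
          (auto simp: square_def)
      then show "dist (ratio q M m) (ratio q M n) < e" using r by (simp add: dist_real_def)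
    qed
  qed
  then show ?thesis unfolding plus_ratio_def
    using Cauchy_convergent convergent_LIMSEQ_iff by blast
qed

lemma plus_ratio_empty: "0 < q \<Longrightarrow> plus_ratio q {} = 1"
proof -
  assume "0 < q"
  then have "ratio q {} n = 1" for n
    using part_fun_plus_pos[of q "square n"] unfolding ratio_def minus_on_empty by (simp add: square_def)
  then have "ratio q {} = (\<lambda>_. 1)" by blast
  then show ?thesis unfolding plus_ratio_def by simp
qed

lemma part_fun_translate:
  "part_fun q ({a..b} \<times> {c..d}) (minus_on M) = part_fun q ({a + s..b + s} \<times> {c..d}) (minus_on ((\<lambda>k. k + s) ` M))"
proof -
  let ?f = "\<lambda>(\<sigma> :: int \<times> int \<Rightarrow> real) (x, y). \<sigma> (x - s, y)"
  let ?g = "\<lambda>(\<sigma> :: int \<times> int \<Rightarrow> real) (x, y). \<sigma> (x + s, y)"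
  let ?sh = "\<lambda>e. case e of Hor x y \<Rightarrow> Hor (x + s) y | Ver x y \<Rightarrow> Ver (x + s) y"
  show ?thesis unfolding part_fun_def
  proof (rule sum.reindex_bij_witness[where j = ?f and i = ?g])
    fix \<sigma> assume \<sigma>: "\<sigma> \<in> configs ({a..b} \<times> {c..d}) (minus_on M)"
    show "?g (?f \<sigma>) = \<sigma>" by auto
    have im: "k \<in> (\<lambda>k. k + s) ` M \<longleftrightarrow> k - s \<in> M" for k by force
    show "?f \<sigma> \<in> configs ({a + s..b + s} \<times> {c..d}) (minus_on ((\<lambda>k. k + s) ` M))"
      using \<sigma> unfolding configs_def spins_def minus_on_def im by (auto simp: algebra_simps)
    have "boundary (?f \<sigma>) = ?sh ` boundary \<sigma>"
    proof (intro equalityI subsetI)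
      fix e assume "e \<in> boundary (?f \<sigma>)"
      then show "e \<in> ?sh ` boundary \<sigma>"
      proof (cases e)
        case (Hor x y)
        then have "Hor (x - s) y \<in> boundary \<sigma>"
          using \<open>e \<in> boundary (?f \<sigma>)\<close> by (auto simp: Hor_boundary algebra_simps)
        then show ?thesis by (rule rev_image_eqI) (simp add: Hor)
      next
        case (Ver x y)
        then have "Ver (x - s) y \<in> boundary \<sigma>"
          using \<open>e \<in> boundary (?f \<sigma>)\<close> by (auto simp: Ver_boundary algebra_simps)
        then show ?thesis by (rule rev_image_eqI) (simp add: Ver)
      qed
    next
      fix e assume "e \<in> ?sh ` boundary \<sigma>"
      then obtain e' where "e' \<in> boundary \<sigma>" "e = ?sh e'" by blast
      then show "e \<in> boundary (?f \<sigma>)"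
        by (cases e') (auto simp: Hor_boundary Ver_boundary algebra_simps)
    qed
    moreover have "inj_on ?sh (boundary \<sigma>)"
      by (rule inj_onI) (auto split: bond.splits)
    ultimately show "weight q (?f \<sigma>) = weight q \<sigma>"
      unfolding weight_def by (simp add: card_image)
  next
    fix \<sigma> assume \<sigma>: "\<sigma> \<in> configs ({a + s..b + s} \<times> {c..d}) (minus_on ((\<lambda>k. k + s) ` M))"
    show "?f (?g \<sigma>) = \<sigma>" by auto
    show "?g \<sigma> \<in> configs ({a..b} \<times> {c..d}) (minus_on M)"
      using \<sigma> unfolding configs_def spins_def minus_on_def by auto
  qed
qed

text \<open>
  Translating \<open>M\<close> is translating the box, which does not matter in the limit.
\<close>

lemma plus_ratio_translate:
  assumes q: "0 < q" "1024 * q < 1" and M: "finite M"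
  shows "plus_ratio q ((\<lambda>k. k + s) ` M) = plus_ratio q M"
proof -
  let ?M = "(\<lambda>k. k + s) ` M"
  obtain j i where ji: "?M \<subseteq> {j..i}" using finite_interval_cover[of ?M] M by blast
  have "(\<lambda>n. ratio q M n - ratio q ?M n) \<longlonglongrightarrow> 0"
  proof (rule LIMSEQ_I)
    fix e :: real assume "0 < e"
    then obtain r where r: "2 ^ card (star {j..i}) * (1024 * q) ^ r < e"
      using geometric_small[OF q] by metis
    show "\<exists>N. \<forall>n\<ge>N. norm (ratio q M n - ratio q ?M n - 0) < e"
    proof (intro exI allI impI)
      fix n assume n: "nat (\<bar>j\<bar> + \<bar>i\<bar> + \<bar>s\<bar>) + r \<le> n"
      have t: "ratio q M n = part_fun q ({- int n + s..int n + s} \<times> {- int n..int n}) (minus_on ?M)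
         / part_fun q ({- int n + s..int n + s} \<times> {- int n..int n}) (minus_on {})"
        unfolding ratio_def square_def
        using part_fun_translate[of q "- int n" "int n" "- int n" "int n" M s]
          part_fun_translate[of q "- int n" "int n" "- int n" "int n" "{}" s] by simp
      have "\<bar>ratio q M n - ratio q ?M n\<bar> \<le> 2 ^ card (star {j..i}) * (1024 * q) ^ r"
        unfolding t unfolding ratio_def using q n
        by (intro box_independence[OF refl square_rect _ _ ji]) (auto simp: square_def)
      then show "norm (ratio q M n - ratio q ?M n - 0) < e" using r by simp
    qed
  qed
  moreover have "(\<lambda>n. ratio q M n - ratio q ?M n) \<longlonglongrightarrow> plus_ratio q M - plus_ratio q ?M"
    using M by (intro tendsto_diff ratio_tendsto q) auto
  ultimately show ?thesis using LIMSEQ_unique by fastforce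
qed

lemma plus_ratio_flip:
  assumes q: "0 < q" "1024 * q < 1" and M: "finite M" "k \<notin> M"
  shows "q ^ 4 * plus_ratio q M \<le> plus_ratio q (insert k M)"
    and "q ^ 4 * plus_ratio q (insert k M) \<le> plus_ratio q M"
proof -
  have Zp: "0 < part_fun q (square n) (minus_on {})" for n
    unfolding minus_on_empty by (rule part_fun_plus_pos) (use q in \<open>auto simp: square_def\<close>)
  have f: "q ^ 4 * ratio q N n \<le> ratio q N' n"
    if "nat \<bar>k\<bar> \<le> n" "minus_on N' = (minus_on N)(k := - minus_on N k)" for N N' n
  proof -
    have "q ^ 4 * part_fun q (square n) (minus_on N) \<le> part_fun q (square n) (minus_on N')"
      by (rule single_flip[where k = k]) (use q that in \<open>auto simp: square_def\<close>)
    then show ?thesis unfolding ratio_def using Zp[of n] by (simp add: divide_right_mono)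
  qed
  have t: "q ^ 4 * plus_ratio q N \<le> plus_ratio q N'"
    if "finite N" "finite N'" "minus_on N' = (minus_on N)(k := - minus_on N k)" for N N'
    by (rule LIMSEQ_le[OF tendsto_mult_left[OF ratio_tendsto[OF q that(1)]] ratio_tendsto[OF q that(2)]])
       (use f[OF _ that(3)] in blast)
  show "q ^ 4 * plus_ratio q M \<le> plus_ratio q (insert k M)"
    by (rule t) (use M in \<open>auto simp: minus_on_def\<close>)
  show "q ^ 4 * plus_ratio q (insert k M) \<le> plus_ratio q M"
    by (rule t) (use M in \<open>auto simp: minus_on_def\<close>)
qed

lemma plus_ratio_ge:
  assumes q: "0 < q" "1024 * q < 1" and M: "finite M"
  shows "q ^ (4 * card M) \<le> plus_ratio q M"
  using M
proof (induction M rule: finite_induct)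
  case empty then show ?case using plus_ratio_empty[OF q(1)] by simp
next
  case (insert k M)
  have "q ^ (4 * card (insert k M)) = q ^ 4 * q ^ (4 * card M)"
    using insert by (simp add: power_add[symmetric])
  also have "\<dots> \<le> q ^ 4 * plus_ratio q M" using insert.IH q by (intro mult_left_mono) auto
  also have "\<dots> \<le> plus_ratio q (insert k M)" by (rule plus_ratio_flip(1)[OF q insert.hyps])
  finally show ?case .
qed

lemma plus_ratio_pos: "0 < q \<Longrightarrow> 1024 * q < 1 \<Longrightarrow> finite M \<Longrightarrow> 0 < plus_ratio q M"
  by (rule less_le_trans[OF _ plus_ratio_ge]) auto

lemma plus_ratio_decoupling:
  assumes q: "0 < q" "1024 * q < 1" and M: "M \<subseteq> {j<..<i}" and ji: "j + 2 \<le> i"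
  shows "\<bar>plus_ratio q (insert j M) * plus_ratio q (insert i M)
      - plus_ratio q M * plus_ratio q (insert j (insert i M))\<bar>
    \<le> 2 ^ card (star {j..i}) * (1024 * q) ^ nat (i - j - 1)"
proof (rule LIMSEQ_le_const2)
  have fM: "finite M" using M finite_subset by blast
  show "(\<lambda>n. \<bar>ratio q (insert j M) n * ratio q (insert i M) n - ratio q M n * ratio q (insert j (insert i M)) n\<bar>)
    \<longlonglongrightarrow> \<bar>plus_ratio q (insert j M) * plus_ratio q (insert i M)
      - plus_ratio q M * plus_ratio q (insert j (insert i M))\<bar>"
    by (intro tendsto_intros ratio_tendsto q) (use fM in auto)
  have "\<bar>ratio q (insert j M) n * ratio q (insert i M) n - ratio q M n * ratio q (insert j (insert i M)) n\<bar>
      \<le> 2 ^ card (star {j..i}) * (1024 * q) ^ nat (i - j - 1)" for n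
  proof -
    let ?part_fun = "\<lambda>M. part_fun q (square n) (minus_on M)"
    have Zp: "0 < ?part_fun {}"
      unfolding minus_on_empty by (rule part_fun_plus_pos) (use q in \<open>auto simp: square_def\<close>)
    have "ratio q (insert j M) n * ratio q (insert i M) n - ratio q M n * ratio q (insert j (insert i M)) n
      = (?part_fun (insert j M) * ?part_fun (insert i M) - ?part_fun M * ?part_fun (insert j (insert i M))) / (?part_fun {} * ?part_fun {})"
      unfolding ratio_def by (simp add: diff_divide_distrib)
    then show ?thesis
      using decoupling[OF square_rect ji q(1) _ M, of n] q Zp
      by (simp add: abs_mult pos_divide_le_eq)
  qed
  then show "\<exists>N. \<forall>n\<ge>N. \<bar>ratio q (insert j M) n * ratio q (insert i M) n - ratio q M n * ratio q (insert j (insert i M)) n\<bar>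
      \<le> 2 ^ card (star {j..i}) * (1024 * q) ^ nat (i - j - 1)" by blast
qed

section \<open>The specification\<close>

lemma bonds_eq: "bonds \<Lambda> = ends ` touching \<Lambda>"
proof (intro equalityI subsetI)
  fix b assume "b \<in> bonds \<Lambda>"
  then obtain x y x' y' where b: "b = {(x, y), (x', y')}" "nn (x, y) (x', y')" "b \<inter> \<Lambda> \<noteq> {}"
    unfolding bonds_def by auto
  have im: "b \<in> ends ` touching \<Lambda>" if "b = ends e" for e
    using b(3) unfolding that touching_def by blast
  have "\<bar>x - x'\<bar> + \<bar>y - y'\<bar> = 1" using b(2) by (simp add: nn_def)
  then have "(x' = x + 1 \<and> y' = y) \<or> (x = x' + 1 \<and> y' = y) \<or> (x' = x \<and> y' = y + 1) \<or> (x' = x \<and> y = y' + 1)"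
    by (smt (verit))
  then consider "x' = x + 1" "y' = y" | "x = x' + 1" "y' = y" | "x' = x" "y' = y + 1" | "x' = x" "y = y' + 1"
    by blast
  then show "b \<in> ends ` touching \<Lambda>"
  proof cases
    case 1
    then have "b = ends (Hor x y)" using b(1) by simp
    then show ?thesis by (rule im)
  next
    case 2
    then have "b = ends (Hor x' y)" using b(1) by auto
    then show ?thesis by (rule im)
  next
    case 3
    then have "b = ends (Ver x y)" using b(1) by simp
    then show ?thesis by (rule im)
  next
    case 4
    then have "b = ends (Ver x y')" using b(1) by auto
    then show ?thesis by (rule im)
  qed
next
  fix b assume "b \<in> ends ` touching \<Lambda>"
  then obtain e where e: "b = ends e" "ends e \<inter> \<Lambda> \<noteq> {}" by (auto simp: touching_def)
  show "b \<in> bonds \<Lambda>"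
  proof (cases e)
    case (Hor x y)
    have "nn (x, y) (x + 1, y)" by (simp add: nn_def)
    then show ?thesis using e unfolding Hor ends.simps bonds_def by blast
  next
    case (Ver x y)
    have "nn (x, y) (x, y + 1)" by (simp add: nn_def)
    then show ?thesis using e unfolding Ver ends.simps bonds_def by blast
  qed
qed

lemma inj_ends: "inj ends"
proof (rule injI)
  fix e f assume "ends e = ends f"
  then show "e = f" by (cases e; cases f) (auto simp: doubleton_eq_iff)
qed

lemma ising_weight_eq:
  assumes "finite \<Lambda>" "plus_off \<Lambda> X \<in> spins"
  shows "ising_weight \<beta> \<Lambda> X = weight (exp (- 2 * \<beta>)) (plus_off \<Lambda> X)"
proof -
  let ?s = "plus_off \<Lambda> X"
  have bond: "(\<Prod>z\<in>ends e. ?s z) - 1 = (if e \<in> boundary ?s then -2 else 0)" for e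
  proof (cases e)
    case (Hor x y)
    then show ?thesis
      using spinsD[OF assms(2), of "(x, y)"] spinsD[OF assms(2), of "(x + 1, y)"]
      by (auto simp: Hor_boundary)
  next
    case (Ver x y)
    then show ?thesis
      using spinsD[OF assms(2), of "(x, y)"] spinsD[OF assms(2), of "(x, y + 1)"]
      by (auto simp: Ver_boundary)
  qed
  have "?s p = 1" if "p \<notin> \<Lambda>" for p using that by (simp add: override_on_def all_plus_def)
  then have sub: "boundary ?s \<subseteq> touching \<Lambda>" by (rule boundary_touching)
  have "(\<Sum>b\<in>bonds \<Lambda>. (\<Prod>z\<in>b. ?s z) - 1) = (\<Sum>e\<in>touching \<Lambda>. (\<Prod>z\<in>ends e. ?s z) - 1)"
    unfolding bonds_eq by (subst sum.reindex) (auto intro: inj_on_subset[OF inj_ends])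
  also have "\<dots> = (\<Sum>e\<in>touching \<Lambda>. if e \<in> boundary ?s then -2 else 0)" unfolding bond ..
  also have "\<dots> = (\<Sum>e\<in>boundary ?s. -2)"
    by (rule sum.mono_neutral_cong_right[OF finite_touching[OF assms(1)] sub]) auto
  also have "\<dots> = -2 * real (card (boundary ?s))" by simp
  finally have "ising_weight \<beta> \<Lambda> X = exp (real (card (boundary ?s)) * (- 2 * \<beta>))"
    unfolding ising_weight_def by (simp add: algebra_simps)
  then show ?thesis unfolding weight_def exp_of_nat_mult .
qed

lemma plus_off_spins: "X \<in> \<Lambda> \<rightarrow>\<^sub>E {-1, 1} \<Longrightarrow> plus_off \<Lambda> X \<in> spins"
  unfolding spins_def override_on_def all_plus_def by (auto simp: PiE_def Pi_def)

lemma sum_layer_weights: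
  assumes M: "M \<subseteq> {- int n..int n}"
  shows "(\<Sum>X | X \<in> square n \<rightarrow>\<^sub>E {-1, 1} \<and> (\<forall>i\<in>{- int n..int n}. X (i, 0) = minus_on M i).
      ising_weight \<beta> (square n) X) = part_fun (exp (- 2 * \<beta>)) (square n) (minus_on M)"
  unfolding part_fun_def
proof (rule sum.reindex_bij_witness[where j = "plus_off (square n)" and i = "\<lambda>\<sigma>. restrict \<sigma> (square n)"])
  have fin: "finite (square n)" by (simp add: square_def)
  fix X assume "X \<in> {X. X \<in> square n \<rightarrow>\<^sub>E {-1, 1} \<and> (\<forall>i\<in>{- int n..int n}. X (i, 0) = minus_on M i)}"
  then have X: "X \<in> square n \<rightarrow>\<^sub>E {-1, 1}" "\<And>i. i \<in> {- int n..int n} \<Longrightarrow> X (i, 0) = minus_on M i" by auto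
  show "restrict (plus_off (square n) X) (square n) = X"
    using X(1) by (auto simp: fun_eq_iff override_on_def restrict_def PiE_def extensional_def)
  have "plus_off (square n) X (k, 0) = minus_on M k" for k
    using X(2)[of k] M by (auto simp: override_on_def square_def all_plus_def minus_on_def)
  then show "plus_off (square n) X \<in> configs (square n) (minus_on M)"
    using plus_off_spins[OF X(1)] unfolding configs_def
    by (simp add: override_on_def all_plus_def)
  show "weight (exp (- 2 * \<beta>)) (plus_off (square n) X) = ising_weight \<beta> (square n) X"
    using ising_weight_eq[OF fin plus_off_spins[OF X(1)]] by simp
next
  fix \<sigma> assume \<sigma>: "\<sigma> \<in> configs (square n) (minus_on M)"
  show "plus_off (square n) (restrict \<sigma> (square n)) = \<sigma>"
    using configsD(2)[OF \<sigma>] by (auto simp: fun_eq_iff override_on_def all_plus_def)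
  show "restrict \<sigma> (square n) \<in> {X. X \<in> square n \<rightarrow>\<^sub>E {-1, 1} \<and> (\<forall>i\<in>{- int n..int n}. X (i, 0) = minus_on M i)}"
    using configsD(3)[OF \<sigma>] spinsD[OF configsD(1)[OF \<sigma>]] by (auto simp: square_def)
qed

lemma measure_ising_plus:
  assumes "finite \<Lambda>" "A \<subseteq> \<Lambda> \<rightarrow>\<^sub>E {-1, 1}"
  shows "measure (ising_plus \<beta> \<Lambda>) A
    = (\<Sum>X\<in>A. ising_weight \<beta> \<Lambda> X) / (\<Sum>X\<in>\<Lambda> \<rightarrow>\<^sub>E {-1, 1}. ising_weight \<beta> \<Lambda> X)"
proof -
  have fin: "finite (\<Lambda> \<rightarrow>\<^sub>E {-1, 1 :: real})" using assms(1) by (intro finite_PiE) auto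
  have nn: "0 \<le> ising_weight \<beta> \<Lambda> X / (\<Sum>X\<in>\<Lambda> \<rightarrow>\<^sub>E {-1, 1}. ising_weight \<beta> \<Lambda> X)" for X
    by (intro divide_nonneg_nonneg sum_nonneg) (simp_all add: ising_weight_def)
  have "emeasure (ising_plus \<beta> \<Lambda>) A = (\<Sum>X\<in>A. ennreal (ising_weight \<beta> \<Lambda> X
      / (\<Sum>X\<in>\<Lambda> \<rightarrow>\<^sub>E {-1, 1}. ising_weight \<beta> \<Lambda> X)))"
    unfolding ising_plus_def by (rule emeasure_point_measure_finite[OF fin assms(2)])
  also have "\<dots> = ennreal (\<Sum>X\<in>A. ising_weight \<beta> \<Lambda> X / (\<Sum>X\<in>\<Lambda> \<rightarrow>\<^sub>E {-1, 1}. ising_weight \<beta> \<Lambda> X))"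
    by (rule sum_ennreal) (rule nn)
  finally show ?thesis
    unfolding measure_def by (simp add: sum_nonneg nn sum_divide_distrib[symmetric] del: ennreal_eq_0_iff)
      (simp add: sum_divide_distrib sum_nonneg nn)
qed

lemma sum_plus_ratio_pos:
  assumes "0 < q" "1024 * q < 1" "finite V"
  shows "0 < (\<Sum>M\<in>Pow V. plus_ratio q M)"
proof (rule sum_pos)
  show "0 < plus_ratio q M" if "M \<in> Pow V" for M
    using that assms finite_subset by (intro plus_ratio_pos) auto
qed (use assms in auto)

text \<open>
  Given plus spins off \<open>V\<close>, the probability of a layer is its partition function divided by the sum
  over all layers on \<open>V\<close>; dividing both by \<open>Z(\<emptyset>)\<close> makes them converge.
\<close>

lemma spec_eq:
  assumes q: "q = exp (- 2 * \<beta>)" "1024 * q < 1" and V: "finite V" and \<sigma>: "\<sigma> \<in> spins"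
  shows "spec \<beta> V \<sigma> all_plus = plus_ratio q {k\<in>V. \<sigma> k = -1} / (\<Sum>M\<in>Pow V. plus_ratio q M)"
proof -
  have q0: "0 < q" using q by simp
  obtain j i where ji: "V \<subseteq> {j..i}" using finite_interval_cover[OF V] .
  let ?N = "nat (\<bar>j\<bar> + \<bar>i\<bar>)"
  let ?M = "{k\<in>V. \<sigma> k = -1}"
  have cp: "cond_prob (ising_plus \<beta> (square n))
                (\<lambda>X. \<forall>i\<in>V. X (i, 0) = \<sigma> i)
                (\<lambda>X. \<forall>i\<in>{- int n..int n} - V. X (i, 0) = all_plus i)
     = ratio q ?M n / (\<Sum>M\<in>Pow V. ratio q M n)" if n: "n \<ge> ?N" for n
  proof -
    let ?\<Lambda> = "square n" and ?L = "{- int n..int n}"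
    let ?S = "?\<Lambda> \<rightarrow>\<^sub>E {-1, 1 :: real}"
    let ?layer = "\<lambda>M. {X. X \<in> ?S \<and> (\<forall>i\<in>?L. X (i, 0) = minus_on M i)}"
    let ?tot = "\<Sum>X\<in>?S. ising_weight \<beta> ?\<Lambda> X"
    have fin: "finite ?\<Lambda>" by (simp add: square_def)
    have finS: "finite ?S" using fin by (intro finite_PiE) auto
    have VL: "V \<subseteq> ?L" using ji n by force
    have space: "space (ising_plus \<beta> ?\<Lambda>) = ?S" by (simp add: ising_plus_def space_point_measure)
    have num: "{X \<in> ?S. (\<forall>i\<in>V. X (i, 0) = \<sigma> i) \<and> (\<forall>i\<in>?L - V. X (i, 0) = all_plus i)} = ?layer ?M"
    proof -
      have "(\<forall>i\<in>V. X (i, 0) = \<sigma> i) \<and> (\<forall>i\<in>?L - V. X (i, 0) = all_plus i)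
        \<longleftrightarrow> (\<forall>i\<in>?L. X (i, 0) = minus_on ?M i)" for X :: "int \<times> int \<Rightarrow> real"
      proof -
        have "minus_on ?M i = (if i \<in> V then \<sigma> i else all_plus i)" for i
          using spinsD[OF \<sigma>, of i] by (auto simp: minus_on_def all_plus_def)
        then show ?thesis using VL unfolding Ball_def by (smt (verit) DiffE DiffI subsetD)
      qed
      then show ?thesis by (simp only:) 
    qed
    have den: "{X \<in> ?S. \<forall>i\<in>?L - V. X (i, 0) = all_plus i} = (\<Union>M\<in>Pow V. ?layer M)"
    proof (intro equalityI subsetI)
      fix X assume X: "X \<in> {X \<in> ?S. \<forall>i\<in>?L - V. X (i, 0) = all_plus i}"
      have "X (i, 0) = minus_on {i\<in>V. X (i, 0) = -1} i" if "i \<in> ?L" for i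
      proof -
        have "(i, 0) \<in> ?\<Lambda>" using that by (simp add: square_def)
        then have "X (i, 0) \<in> {-1, 1}" using X by blast
        moreover have "X (i, 0) = 1" if "i \<notin> V" using X \<open>i \<in> ?L\<close> that by (simp add: all_plus_def)
        ultimately show ?thesis by (auto simp: minus_on_def)
      qed
      then have "X \<in> ?layer {i\<in>V. X (i, 0) = -1}" using X by blast
      moreover have "{i\<in>V. X (i, 0) = -1} \<in> Pow V" by simp
      ultimately show "X \<in> (\<Union>M\<in>Pow V. ?layer M)" by (rule UN_I[rotated])
    next
      fix X assume "X \<in> (\<Union>M\<in>Pow V. ?layer M)"
      then obtain M where M: "M \<subseteq> V" "X \<in> ?layer M" by blast
      have "X (i, 0) = all_plus i" if i: "i \<in> ?L - V" for i
      proof -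
        have "X (i, 0) = minus_on M i" "i \<notin> M" using M i by blast+
        then show ?thesis by (simp add: minus_on_def all_plus_def)
      qed
      then show "X \<in> {X \<in> ?S. \<forall>i\<in>?L - V. X (i, 0) = all_plus i}" using M(2) by blast
    qed
    have disj: "?layer M \<inter> ?layer M' = {}" if "M \<in> Pow V" "M' \<in> Pow V" "M \<noteq> M'" for M M'
    proof -
      have "\<exists>i. (i \<in> M) \<noteq> (i \<in> M')" using that(3) by blast
      then obtain i where i: "(i \<in> M) \<noteq> (i \<in> M')" ..
      then have "i \<in> ?L" using that VL by blast
      moreover have "minus_on M i \<noteq> minus_on M' i" using i by (auto simp: minus_on_def)
      ultimately show ?thesis by auto
    qed
    have Zs: "(\<Sum>X\<in>?layer M. ising_weight \<beta> ?\<Lambda> X) = part_fun q ?\<Lambda> (minus_on M)" if "M \<subseteq> V" for M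
      unfolding q(1) by (rule sum_layer_weights) (use that VL in auto)
    have mnum: "measure (ising_plus \<beta> ?\<Lambda>) (?layer ?M) = part_fun q ?\<Lambda> (minus_on ?M) / ?tot"
      by (subst measure_ising_plus[OF fin]) (auto simp: Zs)
    have mden: "measure (ising_plus \<beta> ?\<Lambda>) (\<Union>M\<in>Pow V. ?layer M) = (\<Sum>M\<in>Pow V. part_fun q ?\<Lambda> (minus_on M)) / ?tot"
    proof -
      have "(\<Sum>X\<in>(\<Union>M\<in>Pow V. ?layer M). ising_weight \<beta> ?\<Lambda> X) = (\<Sum>M\<in>Pow V. \<Sum>X\<in>?layer M. ising_weight \<beta> ?\<Lambda> X)"
        by (rule sum.UNION_disjoint) (use V finS disj in auto)
      also have "\<dots> = (\<Sum>M\<in>Pow V. part_fun q ?\<Lambda> (minus_on M))" by (rule sum.cong) (auto simp: Zs)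
      finally show ?thesis by (subst measure_ising_plus[OF fin]) auto
    qed
    have tot: "0 < ?tot"
      by (rule sum_pos) (use finS in \<open>auto simp: ising_weight_def PiE_eq_empty_iff\<close>)
    have Z0: "0 < part_fun q ?\<Lambda> (minus_on {})" unfolding minus_on_empty using part_fun_plus_pos[OF q0 fin] .
    have "cond_prob (ising_plus \<beta> ?\<Lambda>) (\<lambda>X. \<forall>i\<in>V. X (i, 0) = \<sigma> i)
                (\<lambda>X. \<forall>i\<in>?L - V. X (i, 0) = all_plus i)
      = (part_fun q ?\<Lambda> (minus_on ?M) / ?tot) / ((\<Sum>M\<in>Pow V. part_fun q ?\<Lambda> (minus_on M)) / ?tot)"
      unfolding cond_prob_def space num den mnum mden ..
    also have "\<dots> = ratio q ?M n / (\<Sum>M\<in>Pow V. ratio q M n)"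
      using tot Z0 unfolding ratio_def by (simp add: sum_divide_distrib[symmetric])
    finally show ?thesis .
  qed
  have "(\<lambda>n. ratio q ?M n / (\<Sum>M\<in>Pow V. ratio q M n))
    \<longlonglongrightarrow> plus_ratio q ?M / (\<Sum>M\<in>Pow V. plus_ratio q M)"
  proof (intro tendsto_divide tendsto_sum ratio_tendsto q0 q)
    show "(\<Sum>M\<in>Pow V. plus_ratio q M) \<noteq> 0" using sum_plus_ratio_pos[OF q0 q(2) V] by simp
  qed (use V finite_subset in auto)
  then have "(\<lambda>n. cond_prob (ising_plus \<beta> (square n))
                (\<lambda>X. \<forall>i\<in>V. X (i, 0) = \<sigma> i)
                (\<lambda>X. \<forall>i\<in>{- int n..int n} - V. X (i, 0) = all_plus i))
    \<longlonglongrightarrow> plus_ratio q ?M / (\<Sum>M\<in>Pow V. plus_ratio q M)"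
  proof (rule Lim_transform_eventually)
    show "eventually (\<lambda>n. ratio q ?M n / (\<Sum>M\<in>Pow V. ratio q M n) = cond_prob (ising_plus \<beta> (square n))
                (\<lambda>X. \<forall>i\<in>V. X (i, 0) = \<sigma> i)
                (\<lambda>X. \<forall>i\<in>{- int n..int n} - V. X (i, 0) = all_plus i)) sequentially"
      using eventually_ge_at_top[of ?N] by (rule eventually_mono) (rule cp[symmetric])
  qed
  then show ?thesis unfolding spec_def by (rule limI)
qed

section \<open>Bounds on the telescoping potential\<close>

definition minuses :: "(int \<Rightarrow> real) \<Rightarrow> int set \<Rightarrow> int set" where
  "minuses \<xi> W = {k\<in>W. \<xi> k = -1}"

lemma finite_minuses: "finite W \<Longrightarrow> finite (minuses \<xi> W)"
  by (simp add: minuses_def)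

lemma spec_plus_off:
  assumes q: "q = exp (- 2 * \<beta>)" "1024 * q < 1" and "finite A" "W \<subseteq> A" and \<xi>: "\<xi> \<in> spins"
  shows "spec \<beta> A (plus_off W \<xi>) all_plus = plus_ratio q (minuses \<xi> W) / (\<Sum>M\<in>Pow A. plus_ratio q M)"
proof -
  have "plus_off W \<xi> \<in> spins" using \<xi> by (auto simp: spins_def override_on_def all_plus_def)
  moreover have "{k\<in>A. plus_off W \<xi> k = -1} = minuses \<xi> W"
    using assms(4) by (auto simp: minuses_def override_on_def all_plus_def)
  ultimately show ?thesis using spec_eq[OF q assms(3)] by simp
qed

lemma potential_zero:
  assumes "\<And>j i. j \<le> i \<Longrightarrow> A \<noteq> {j..i}"
  shows "telescoping_potential \<beta> A \<xi> = 0"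
proof -
  have 1: "(A = {Max A}) = False" using assms[of "Max A" "Max A"] by simp
  have 2: "(Min A < Max A \<and> A = {Min A..Max A}) = False"
    using assms[of "Min A" "Max A"] less_imp_le by blast
  show ?thesis unfolding telescoping_potential_def Let_def 1 2 by (simp only: if_False)
qed

lemma potential_local:
  assumes "\<And>k. k \<in> A \<Longrightarrow> \<xi> k = \<xi>' k"
  shows "telescoping_potential \<beta> A \<xi> = telescoping_potential \<beta> A \<xi>'"
proof (cases "\<exists>j i. j \<le> i \<and> A = {j..i}")
  case True
  then obtain j i where A: "j \<le> i" "A = {j..i}" by blast
  have e: "plus_off W \<xi> = plus_off W \<xi>'" if "W \<subseteq> A" for W
    using assms that by (auto simp: override_on_def fun_eq_iff)
  have "plus_off W \<xi> = plus_off W \<xi>'" if "W \<in> {{i}, {j<..i}, {j..<i}, {j<..<i}, {j..i}}" for W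
    by (rule e) (use A that in auto)
  then show ?thesis using A unfolding telescoping_potential_def Let_def by simp
qed (metis potential_zero)

lemma potential_singleton:
  assumes q: "q = exp (- 2 * \<beta>)" "1024 * q < 1" and \<xi>: "\<xi> \<in> spins"
  shows "telescoping_potential \<beta> {i..i} \<xi> = - ln (plus_ratio q (minuses \<xi> {i}))"
proof -
  have q0: "0 < q" using q by simp
  let ?D = "\<Sum>M\<in>Pow {i}. plus_ratio q M"
  have D: "0 < ?D" by (intro sum_plus_ratio_pos q0 q) simp
  have "spec \<beta> {i} all_plus all_plus = plus_ratio q {} / ?D"
  proof -
    have ap: "all_plus \<in> spins" and em: "{k \<in> {i}. all_plus k = (-1::real)} = {}"
      by (auto simp: spins_def all_plus_def)
    have "finite {i}" by simp
    from spec_eq[OF q this ap] show ?thesis unfolding em .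
  qed
  moreover have "spec \<beta> {i} (plus_off {i} \<xi>) all_plus = plus_ratio q (minuses \<xi> {i}) / ?D"
    by (rule spec_plus_off[OF q _ _ \<xi>]) auto
  moreover have "0 < plus_ratio q (minuses \<xi> {i})" by (intro plus_ratio_pos q0 q finite_minuses) simp
  ultimately show ?thesis
    using D plus_ratio_empty[OF q0] unfolding telescoping_potential_def Let_def
    by (simp add: ln_div)
qed

text \<open>
  The normalization of the specification occurs twice in the numerator and twice in the
  denominator.
\<close>

lemma potential_interval:
  assumes q: "q = exp (- 2 * \<beta>)" "1024 * q < 1" and \<xi>: "\<xi> \<in> spins" and "j < i"
  defines "R \<equiv> \<lambda>W. plus_ratio q (minuses \<xi> W)"
  shows "telescoping_potential \<beta> {j..i} \<xi> = ln ((R {j<..i} * R {j..<i}) / (R {j<..<i} * R {j..i}))"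
proof -
  have q0: "0 < q" using q by simp
  let ?D = "\<Sum>M\<in>Pow {j..i}. plus_ratio q M"
  have D: "0 < ?D" by (intro sum_plus_ratio_pos q0 q) simp
  have g: "spec \<beta> {j..i} (plus_off W \<xi>) all_plus = R W / ?D" if "W \<subseteq> {j..i}" for W
    unfolding R_def by (rule spec_plus_off[OF q _ that \<xi>]) auto
  have sub: "{j<..i} \<subseteq> {j..i}" "{j..<i} \<subseteq> {j..i}" "{j<..<i} \<subseteq> {j..i}" by auto
  have "telescoping_potential \<beta> {j..i} \<xi> = ln ((R {j<..i} / ?D * (R {j..<i} / ?D)) / (R {j<..<i} / ?D * (R {j..i} / ?D)))"
  proof -
    have mm: "Min {j..i} = j" "Max {j..i} = i" using assms(4) by (auto intro: Min_eqI Max_eqI)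
    have "{j..i} \<noteq> {i}" using assms(4) by auto
    then show ?thesis using assms(4) unfolding telescoping_potential_def Let_def mm by (simp add: g sub)
  qed
  also have "(R {j<..i} / ?D * (R {j..<i} / ?D)) / (R {j<..<i} / ?D * (R {j..i} / ?D)) = (R {j<..i} * R {j..<i}) / (R {j<..<i} * R {j..i})"
    using D by (simp add: field_simps)
  finally show ?thesis .
qed

lemma potential_translate:
  assumes q: "q = exp (- 2 * \<beta>)" "1024 * q < 1" and \<xi>: "\<xi> \<in> spins" and "j \<le> i"
  shows "telescoping_potential \<beta> {j + s..i + s} \<xi> = telescoping_potential \<beta> {j..i} (\<lambda>k. \<xi> (k + s))"
proof -
  have q0: "0 < q" using q by simp
  let ?\<xi> = "\<lambda>k. \<xi> (k + s)"
  have \<xi>': "?\<xi> \<in> spins" using \<xi> by (auto simp: spins_def)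
  have t: "plus_ratio q (minuses \<xi> W') = plus_ratio q (minuses ?\<xi> W)" if "W' = (\<lambda>k. k + s) ` W" "finite W" for W W'
  proof -
    have "minuses \<xi> W' = (\<lambda>k. k + s) ` minuses ?\<xi> W" unfolding that(1) by (auto simp: minuses_def)
    then show ?thesis using plus_ratio_translate[OF q0 q(2) finite_minuses[OF that(2)]] by simp
  qed
  show ?thesis
  proof (cases "j = i")
    case True
    then show ?thesis using potential_singleton[OF q \<xi>, of "i + s"] potential_singleton[OF q \<xi>', of i] t[of "{i + s}" "{i}"]
      by simp
  next
    case False
    then have "j < i" using assms(4) by simp
    have im: "{j + s<..i + s} = (\<lambda>k. k + s) ` {j<..i}" "{j + s..<i + s} = (\<lambda>k. k + s) ` {j..<i}"
      "{j + s<..<i + s} = (\<lambda>k. k + s) ` {j<..<i}" "{j + s..i + s} = (\<lambda>k. k + s) ` {j..i}"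
      by (auto intro!: image_eqI[of _ _ "x - s" for x])
    show ?thesis
      using potential_interval[OF q \<xi>, of "j + s" "i + s"] potential_interval[OF q \<xi>' \<open>j < i\<close>] \<open>j < i\<close>
        t[OF im(1)] t[OF im(2)] t[OF im(3)] t[OF im(4)] by simp
  qed
qed

lemma ln_ratio_flip:
  assumes q: "0 < q" "1024 * q < 1" and M: "finite M"
  shows "\<bar>ln (plus_ratio q (insert k M)) - ln (plus_ratio q M)\<bar> \<le> - 4 * ln q"
proof (cases "k \<in> M")
  case False
  have pos: "0 < plus_ratio q M" "0 < plus_ratio q (insert k M)"
    using plus_ratio_pos[OF q] M by auto
  have "ln (q ^ 4 * plus_ratio q M) \<le> ln (plus_ratio q (insert k M))"
    using plus_ratio_flip(1)[OF q M False] pos q by (intro ln_mono) auto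
  moreover have "ln (q ^ 4 * plus_ratio q (insert k M)) \<le> ln (plus_ratio q M)"
    using plus_ratio_flip(2)[OF q M False] pos q by (intro ln_mono) auto
  ultimately show ?thesis using pos q by (simp add: ln_mult ln_realpow)
qed (use q in \<open>simp add: insert_absorb\<close>)

lemma minuses_insert: "\<xi> \<in> spins \<Longrightarrow> minuses \<xi> (insert k W) = (if \<xi> k = 1 then minuses \<xi> W else insert k (minuses \<xi> W))"
  using spinsD[of \<xi> k] by (auto simp: minuses_def)

lemma interval_inserts:
  assumes "(j::int) < i"
  shows "{j<..i} = insert i {j<..<i}" "{j..<i} = insert j {j<..<i}" "{j..i} = insert j (insert i {j<..<i})"
  using assms by auto

text \<open>
  The logarithm compares the effect of a spin flip at one end of the interval with and without a
  flip at the other end, and a single flip changes \<open>ln r\<close> by at most \<open>8 \<beta>\<close>.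
\<close>

lemma potential_bounded:
  assumes q: "q = exp (- 2 * \<beta>)" "1024 * q < 1" and \<xi>: "\<xi> \<in> spins"
  shows "\<bar>telescoping_potential \<beta> A \<xi>\<bar> \<le> 16 * \<beta>"
proof (cases "\<exists>j i. j \<le> i \<and> A = {j..i}")
  case True
  then obtain j i where A: "j \<le> i" "A = {j..i}" by blast
  have q0: "0 < q" using q by simp
  have lnq: "ln q = - 2 * \<beta>" using q by simp
  have q1: "q < 1" using q(2) q0 by linarith
  then have b0: "0 < \<beta>" using q by simp
  have flip: "\<bar>ln (plus_ratio q (minuses \<xi> (insert k W))) - ln (plus_ratio q (minuses \<xi> W))\<bar> \<le> 8 * \<beta>"
    if "finite W" for k W
    using ln_ratio_flip[OF q0 q(2) finite_minuses[OF that], of k \<xi>] b0 lnq by (simp add: minuses_insert[OF \<xi>])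
  show ?thesis
  proof (cases "j = i")
    case True
    have "minuses \<xi> {} = {}" by (simp add: minuses_def)
    then have "\<bar>ln (plus_ratio q (minuses \<xi> {i}))\<bar> \<le> 8 * \<beta>"
      using flip[of "{}" i] plus_ratio_empty[OF q0] by simp
    then show ?thesis using potential_singleton[OF q \<xi>, of i] True A b0 by simp
  next
    case False
    then have ji: "j < i" using A by simp
    have pos: "0 < plus_ratio q (minuses \<xi> W)" if "finite W" for W
      by (intro plus_ratio_pos q0 q finite_minuses that)
    let ?R = "\<lambda>W. ln (plus_ratio q (minuses \<xi> W))"
    have "telescoping_potential \<beta> A \<xi> = (?R {j<..i} + ?R {j..<i}) - (?R {j<..<i} + ?R {j..i})"
      using potential_interval[OF q \<xi> ji] pos A
      by (simp add: ln_div ln_mult less_imp_neq[THEN not_sym])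
    moreover have "\<bar>?R {j<..i} - ?R {j<..<i}\<bar> \<le> 8 * \<beta>"
      unfolding interval_inserts[OF ji] by (rule flip) simp
    moreover have "\<bar>?R {j..i} - ?R {j..<i}\<bar> \<le> 8 * \<beta>"
    proof -
      have "{j..i} = insert i {j..<i}" using ji by auto
      then show ?thesis using flip[of "{j..<i}" i] by simp
    qed
    ultimately show ?thesis by linarith
  qed
next
  case False
  have "0 < q" using q by simp
  then have "q < 1" using q(2) by linarith
  then have "0 < \<beta>" using q by simp
  moreover have "telescoping_potential \<beta> A \<xi> = 0" by (rule potential_zero) (use False in blast)
  ultimately show ?thesis by simp
qed

lemma sum_spins:
  assumes "\<xi> \<in> spins" "finite A"
  shows "(\<Sum>k\<in>A. \<xi> k) = real (card A) - 2 * real (card (minuses \<xi> A))"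
proof -
  have "(\<Sum>k\<in>A. \<xi> k) = (\<Sum>k\<in>A. 1 - 2 * of_bool (\<xi> k = -1))"
    by (rule sum.cong[OF refl]) (use spinsD[OF assms(1)] in fastforce)
  also have "\<dots> = real (card A) - 2 * real (card (minuses \<xi> A))"
    using assms(2) by (simp add: sum_subtractf sum_distrib_left[symmetric] minuses_def Int_def)
  finally show ?thesis .
qed

lemma ln_ratio_bound:
  fixes x y c e :: real
  assumes "0 < c" "c \<le> x" "c \<le> y" "\<bar>x - y\<bar> \<le> e"
  shows "\<bar>ln (x / y)\<bar> \<le> e / c"
proof -
  have "ln (x / y) \<le> x / y - 1" using assms by (intro ln_le_minus_one) auto
  also have "\<dots> = (x - y) / y" using assms by (simp add: field_simps)
  also have "\<dots> \<le> e / c" using assms by (intro frac_le) auto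
  finally have 1: "ln (x / y) \<le> e / c" .
  have "ln (y / x) \<le> y / x - 1" using assms by (intro ln_le_minus_one) auto
  also have "\<dots> = (y - x) / x" using assms by (simp add: field_simps)
  also have "\<dots> \<le> e / c" using assms by (intro frac_le) auto
  finally have "ln (y / x) \<le> e / c" .
  moreover have "ln (y / x) = - ln (x / y)" using assms by (simp add: ln_div)
  ultimately show ?thesis using 1 by linarith
qed

text \<open>
  If an end is plus, the interval has potential zero, and a single minus spin is not dense. For two
  distinct minus ends the cross ratio deviates from \<open>1\<close> by
  at most the Peierls error divided by the smallest possible product of ratios. With
  \<open>s = exp (- \<beta>)\<close> the error is \<open>(const s\<^sup>2) ^ m\<close>, up to a constant factor, for an interval of length \<open>m\<close>, and the
  divisor is \<open>s ^ (16 N)\<close>. The density bound gives \<open>18 N \<le> m\<close>, so a factor \<open>s ^ m\<close> of the error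
  remains, and it beats the constants.
\<close>

lemma potential_decay:
  assumes \<beta>: "exp (- \<beta>) \<le> (1 / 2) ^ 15" and \<xi>: "\<xi> \<in> spins" and "j \<le> i"
    and dense: "8 / 9 * real (card {j..i}) \<le> (\<Sum>k\<in>{j..i}. \<xi> k)"
  shows "\<bar>telescoping_potential \<beta> {j..i} \<xi>\<bar> \<le> exp (4 * \<beta>) * (1 / 2) ^ card {j..i}"
proof -
  define s where "s = exp (- \<beta>)"
  define q where "q = exp (- 2 * \<beta>)"
  have s: "0 < s" "s \<le> (1 / 2) ^ 15" using \<beta> by (auto simp: s_def)
  have qs: "q = s ^ 2" unfolding q_def s_def by (simp add: exp_of_nat_mult[symmetric])
  have s1: "s < 1" using s(2) by (simp add: power_one_over)
  have q0: "0 < q" using s qs by simp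
  have "q \<le> s * 1" unfolding qs power2_eq_square using s s1 by (intro mult_left_mono) auto
  moreover have "1024 * s < 1" using s(2) by (simp add: power_one_over)
  ultimately have q: "q = exp (- 2 * \<beta>)" "1024 * q < 1" unfolding q_def[symmetric] by simp_all
  let ?R = "\<lambda>W. plus_ratio q (minuses \<xi> W)"
  have pos: "0 < ?R W" if "finite W" for W
    by (intro plus_ratio_pos q0 q finite_minuses that)
  have nn: "0 \<le> exp (4 * \<beta>) * (1 / 2) ^ card {j..i}" by simp
  define m where "m = card {j..i}"
  define N where "N = card (minuses \<xi> {j..i})"
  have mji: "int m = i - j + 1" unfolding m_def using assms(3) by simp
  have "8 / 9 * real m \<le> real m - 2 * real N"
    using dense sum_spins[OF \<xi>, of "{j..i}"] unfolding m_def N_def by simp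
  then have "18 * real N \<le> real m" by simp
  then have N: "18 * N \<le> m" by linarith
  consider "j = i" | "j < i" "\<xi> j = 1 \<or> \<xi> i = 1" | "j < i" "\<xi> j = -1" "\<xi> i = -1"
    using assms(3) spinsD[OF \<xi>, of i] spinsD[OF \<xi>, of j] by fastforce
  then show ?thesis
  proof cases
    case 1
    then have "N = 0" using N mji by linarith
    then have "minuses \<xi> {i} = {}" using 1 unfolding N_def by (auto simp: minuses_def)
    then show ?thesis using potential_singleton[OF q \<xi>, of i] plus_ratio_empty[OF q0] 1 by simp
  next
    case 2
    have "?R {j<..i} * ?R {j..<i} = ?R {j<..<i} * ?R {j..i}"
      using 2(2) unfolding interval_inserts[OF 2(1)] by (auto simp: minuses_insert[OF \<xi>])
    moreover have "?R {j<..<i} * ?R {j..i} \<noteq> 0" using pos[of "{j<..<i}"] pos[of "{j..i}"] by simp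
    ultimately have "telescoping_potential \<beta> {j..i} \<xi> = 0"
      using potential_interval[OF q \<xi> 2(1)] by simp
    then show ?thesis by simp
  next
    case 3
    let ?M = "minuses \<xi> {j<..<i}"
    have fM: "finite ?M" "j \<notin> ?M" "i \<notin> ?M" "?M \<subseteq> {j<..<i}" by (auto simp: minuses_def intro: finite_subset[of _ "{j<..<i}"])
    have ms: "minuses \<xi> {j<..i} = insert i ?M" "minuses \<xi> {j..<i} = insert j ?M"
      "minuses \<xi> {j..i} = insert j (insert i ?M)"
      unfolding interval_inserts[OF 3(1)] using 3 by (simp_all add: minuses_insert[OF \<xi>])
    have cN: "N = card ?M + 2" unfolding N_def ms using fM 3(1) by simp
    \<comment> \<open>Two minus ends force a long interval, so that the decoupling of distant ends applies.\<close>
    then have m36: "36 \<le> m" using N by simp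
    then have ji: "j + 2 \<le> i" using mji by linarith
    define e where "e = 2 ^ card (star {j..i}) * (1024 * q) ^ nat (i - j - 1)"
    let ?x = "plus_ratio q (insert j ?M) * plus_ratio q (insert i ?M)"
    let ?y = "plus_ratio q ?M * plus_ratio q (insert j (insert i ?M))"
    have xy: "\<bar>?x - ?y\<bar> \<le> e" unfolding e_def by (rule plus_ratio_decoupling[OF q0 q(2) fM(4) ji])
    have low: "q ^ (8 * N) \<le> plus_ratio q A * plus_ratio q B"
      if "finite A" "finite B" "card A \<le> N" "card B \<le> N" for A B
    proof -
      have "q ^ (4 * N) \<le> plus_ratio q A" if "finite A" "card A \<le> N" for A
      proof -
        have "q \<le> 1" using q(2) q0 by linarith
        then have "q ^ (4 * N) \<le> q ^ (4 * card A)"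
          using that(2) q0 by (intro power_decreasing mult_le_mono) (auto intro: less_imp_le)
        also have "\<dots> \<le> plus_ratio q A" by (rule plus_ratio_ge[OF q0 q(2) that(1)])
        finally show ?thesis .
      qed
      then have "q ^ (4 * N) * q ^ (4 * N) \<le> plus_ratio q A * plus_ratio q B"
        using that q0 by (intro mult_mono) (auto intro: less_imp_le plus_ratio_pos q)
      then show ?thesis by (simp add: power_add[symmetric])
    qed
    have x: "q ^ (8 * N) \<le> ?x" and y: "q ^ (8 * N) \<le> ?y"
      by (rule low; use fM 3(1) cN in simp)+
    have "telescoping_potential \<beta> {j..i} \<xi> = ln (?x / ?y)"
      using potential_interval[OF q \<xi> 3(1)] unfolding ms by (simp add: mult.commute)
    also have "\<bar>\<dots>\<bar> \<le> e / q ^ (8 * N)"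
      by (rule ln_ratio_bound[OF _ x y xy]) (use q0 in simp)
    also have "\<dots> \<le> exp (4 * \<beta>) * (1 / 2) ^ m"
    proof -
      have r: "nat (i - j - 1) = m - 2" using mji by linarith
      \<comment> \<open>The Peierls bound has exponent \<open>m - 2\<close> rather than \<open>m\<close>; the missing \<open>s ^ 4 = q\<^sup>2\<close> is the constant
          \<open>exp (4 * \<beta>)\<close> of the statement.\<close>
      have e4: "exp (4 * \<beta>) = 1 / s ^ 4" unfolding s_def by (simp add: exp_of_nat_mult[symmetric] exp_minus field_simps)
      have "e \<le> 2 ^ (4 * m) * (1024 * q) ^ (m - 2)"
        unfolding e_def r using card_star[of "{j..i}"] q0 unfolding m_def
        by (intro mult_right_mono power_increasing) auto
      also have "\<dots> = 2 ^ (4 * m) * 1024 ^ (m - 2) * s ^ (2 * (m - 2))"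
        unfolding qs by (simp add: power_mult_distrib power_mult)
      finally have "s ^ 4 * e \<le> s ^ 4 * (2 ^ (4 * m) * 1024 ^ (m - 2) * s ^ (2 * (m - 2)))"
        using s by (intro mult_left_mono) auto
      also have "\<dots> = 2 ^ (4 * m) * 1024 ^ (m - 2) * s ^ (2 * m)"
      proof -
        have "s ^ 4 * s ^ (2 * (m - 2)) = s ^ (2 * m)"
        proof -
          have "4 + 2 * (m - 2) = 2 * m" using m36 by linarith
          then show ?thesis by (simp only: power_add[symmetric])
        qed
        then show ?thesis by (simp add: mult.left_commute mult.assoc)
      qed
      also have "\<dots> \<le> 2 ^ (4 * m) * 1024 ^ m * s ^ (2 * m)"
        using s by (intro mult_right_mono mult_left_mono power_increasing) auto
      also have "\<dots> = (2 ^ 14 * s) ^ m * s ^ m"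
        by (simp add: power_mult_distrib power_mult power2_eq_square) (simp add: power_mult_distrib[symmetric])
      also have "\<dots> \<le> (1 / 2) ^ m * s ^ (16 * N)"
        using s s1 N by (intro mult_mono power_mono power_decreasing) (auto simp: power_one_over)
      also have "s ^ (16 * N) = q ^ (8 * N)" unfolding qs by (simp add: power_mult[symmetric])
      finally have "s ^ 4 * e \<le> (1 / 2) ^ m * q ^ (8 * N)" .
      then show ?thesis unfolding e4 using s q0 by (simp add: field_simps)
    qed
    finally show ?thesis unfolding m_def .
  qed
qed

section \<open>Deficits of spin density\<close>

text \<open>
  \<open>b\<close> bounds the deficit of \<open>\<eta>\<close>, read from \<open>x\<close> in direction \<open>s\<close>, relative to the density
  \<open>8 / 9 + \<delta>\<close>. Deficits replace run lengths because they add up when configurations are glued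
  together, and because they depend on \<open>\<eta>\<close> through an inequality that holds at all distances.
\<close>

definition dense_from :: "real \<Rightarrow> int \<Rightarrow> int \<Rightarrow> real \<Rightarrow> (int \<Rightarrow> real) \<Rightarrow> bool" where
  "dense_from \<delta> s x b \<eta> \<longleftrightarrow> (\<forall>n. (8 / 9 + \<delta>) * real n - b \<le> (\<Sum>l<n. \<eta> (x + s * int l)))"

lemma dense_from_nonneg: "dense_from \<delta> s x b \<eta> \<Longrightarrow> 0 \<le> b"
  unfolding dense_from_def by (drule spec[of _ 0]) simp

lemma sum_interval_left:
  fixes \<eta> :: "int \<Rightarrow> real"
  shows "(\<Sum>k\<in>{x - int n<..x}. \<eta> k) = (\<Sum>l<n. \<eta> (x + -1 * int l))"
  by (rule sum.reindex_bij_witness[where i = "\<lambda>l. x - int l" and j = "\<lambda>k. nat (x - k)"]) auto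

lemma sum_interval_right:
  fixes \<eta> :: "int \<Rightarrow> real"
  shows "(\<Sum>k\<in>{x..<x + int n}. \<eta> k) = (\<Sum>l<n. \<eta> (x + 1 * int l))"
  by (rule sum.reindex_bij_witness[where i = "\<lambda>l. x + int l" and j = "\<lambda>k. nat (k - x)"]) auto

lemma dense_interval:
  assumes "dense_from \<delta> (-1) x b \<eta>" "dense_from \<delta> 1 (x + 1) b' \<eta>" "j \<le> x" "x \<le> i"
  shows "(8 / 9 + \<delta>) * real (card {j..i}) - (b + b') \<le> (\<Sum>k\<in>{j..i}. \<eta> k)"
proof -
  define n where "n = nat (x - j + 1)"
  define n' where "n' = nat (i - x)"
  have e: "{j..i} = {x - int n<..x} \<union> {x + 1..<x + 1 + int n'}"
    unfolding n_def n'_def using assms(3,4) by auto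
  have c: "card {j..i} = n + n'" unfolding n_def n'_def using assms(3,4) by simp
  have "(\<Sum>k\<in>{j..i}. \<eta> k) = (\<Sum>l<n. \<eta> (x + -1 * int l)) + (\<Sum>l<n'. \<eta> (x + 1 + 1 * int l))"
    unfolding e sum_interval_left[of \<eta> x n, symmetric] sum_interval_right[of \<eta> "x + 1" n', symmetric]
    by (rule sum.union_disjoint) auto
  moreover have "(8 / 9 + \<delta>) * real n - b \<le> (\<Sum>l<n. \<eta> (x + -1 * int l))"
    using assms(1) unfolding dense_from_def by blast
  moreover have "(8 / 9 + \<delta>) * real n' - b' \<le> (\<Sum>l<n'. \<eta> (x + 1 + 1 * int l))"
    using assms(2) unfolding dense_from_def by blast
  moreover have "(8 / 9 + \<delta>) * real (n + n') = (8 / 9 + \<delta>) * real n + (8 / 9 + \<delta>) * real n'"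
    by (simp add: distrib_left)
  ultimately show ?thesis unfolding c by linarith
qed

text \<open>
  The deficits of the two stretches add up. The spins inside \<open>V\<close> and the boundary condition are
  joined in this way.
\<close>

lemma dense_from_glue:
  assumes \<sigma>: "dense_from \<delta> s x b \<sigma>" and \<omega>: "dense_from \<delta> s (x + s * int m) b' \<omega>"
    and eq: "\<And>l. l < m \<Longrightarrow> \<eta> (x + s * int l) = \<sigma> (x + s * int l)"
      "\<And>l. m \<le> l \<Longrightarrow> \<eta> (x + s * int l) = \<omega> (x + s * int l)"
  shows "dense_from \<delta> s x (b + b') \<eta>"
  unfolding dense_from_def
proof
  fix n
  have split: "(\<Sum>l<n. \<eta> (x + s * int l)) = (\<Sum>l<min n m. \<sigma> (x + s * int l)) + (\<Sum>l<n - m. \<omega> (x + s * int m + s * int l))"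
  proof -
    have e: "{..<min n m} \<union> {m..<n} = {..<n}" by auto
    have "(\<Sum>l<n. \<eta> (x + s * int l)) = (\<Sum>l<min n m. \<eta> (x + s * int l)) + (\<Sum>l\<in>{m..<n}. \<eta> (x + s * int l))"
      unfolding e[symmetric] by (rule sum.union_disjoint) auto
    also have "(\<Sum>l\<in>{m..<n}. \<eta> (x + s * int l)) = (\<Sum>l<n - m. \<omega> (x + s * int m + s * int l))"
    proof (rule sum.reindex_bij_witness[where i = "\<lambda>l. l + m" and j = "\<lambda>l. l - m"])
      fix l assume "l \<in> {m..<n}"
      then have l: "m \<le> l" "l < n" by auto
      show "l - m + m = l" "l - m \<in> {..<n - m}" using l by auto
      have "x + s * int m + s * int (l - m) = x + s * int l" using l by (simp add: of_nat_diff algebra_simps)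
      then show "\<omega> (x + s * int m + s * int (l - m)) = \<eta> (x + s * int l)" by (simp only: eq(2)[OF l(1)])
    qed auto
    also have "(\<Sum>l<min n m. \<eta> (x + s * int l)) = (\<Sum>l<min n m. \<sigma> (x + s * int l))"
      by (rule sum.cong) (auto simp: eq)
    finally show ?thesis .
  qed
  have "real n = real (min n m) + real (n - m)" by (cases "n \<le> m") (simp_all add: of_nat_diff)
  then have "(8 / 9 + \<delta>) * real n = (8 / 9 + \<delta>) * real (min n m) + (8 / 9 + \<delta>) * real (n - m)"
    by (metis distrib_left)
  moreover have "(8 / 9 + \<delta>) * real (min n m) - b \<le> (\<Sum>l<min n m. \<sigma> (x + s * int l))"
    using \<sigma> unfolding dense_from_def by blast
  moreover have "(8 / 9 + \<delta>) * real (n - m) - b' \<le> (\<Sum>l<n - m. \<omega> (x + s * int m + s * int l))"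
    using \<omega> unfolding dense_from_def by blast
  ultimately show "(8 / 9 + \<delta>) * real n - (b + b') \<le> (\<Sum>l<n. \<eta> (x + s * int l))"
    unfolding split by linarith
qed

section \<open>Energies of a decaying potential\<close>

lemma summable_real_abs:
  fixes f :: "'a \<Rightarrow> real"
  shows "f summable_on S \<longleftrightarrow> (\<lambda>A. \<bar>f A\<bar>) summable_on S"
  using summable_on_iff_abs_summable_on_real[of f S] by simp

lemma infsum_abs_bound:
  fixes f :: "'a \<Rightarrow> real"
  assumes "\<And>F. finite F \<Longrightarrow> F \<subseteq> S \<Longrightarrow> (\<Sum>A\<in>F. \<bar>f A\<bar>) \<le> K"
  shows "f summable_on S" and "\<bar>infsum f S\<bar> \<le> K"
proof -
  have s: "(\<lambda>A. \<bar>f A\<bar>) summable_on S"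
    by (rule nonneg_bdd_above_summable_on) (use assms in \<open>auto simp: bdd_above_def\<close>)
  then show "f summable_on S" using summable_real_abs[of f S] by blast
  have "\<bar>infsum f S\<bar> \<le> infsum (\<lambda>A. \<bar>f A\<bar>) S" using norm_infsum_bound[of f S] s by simp
  also have "\<dots> \<le> K" using s assms by (intro infsum_le_finite_sums) auto
  finally show "\<bar>infsum f S\<bar> \<le> K" .
qed

lemma infsum_sum_swap:
  fixes f :: "'b \<Rightarrow> 'a \<Rightarrow> real"
  assumes "finite V" "\<And>x. x \<in> V \<Longrightarrow> f x summable_on S"
  shows "infsum (\<lambda>A. \<Sum>x\<in>V. f x A) S = (\<Sum>x\<in>V. infsum (f x) S)
    \<and> (\<lambda>A. \<Sum>x\<in>V. f x A) summable_on S"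
  using assms
proof (induction V rule: finite_induct)
  case (insert x V)
  then show ?case by (simp add: infsum_add summable_on_add)
qed simp

lemma infsum_minus:
  fixes f g :: "'a \<Rightarrow> real"
  assumes "f summable_on S" "g summable_on S"
  shows "infsum (\<lambda>A. f A - g A) S = infsum f S - infsum g S"
proof -
  have "(\<lambda>A. - g A) summable_on S" using assms(2) by (simp add: summable_on_uminus)
  then show ?thesis using infsum_add[OF assms(1), of "\<lambda>A. - g A"] by (simp add: infsum_uminus)
qed

text \<open>
  The properties of the telescoping potential that the energy estimates use. All dependence on
  the Ising model is in the constants \<open>B\<close> and \<open>C\<close>.
\<close>

locale decaying_potential =
  fixes U :: "int set \<Rightarrow> (int \<Rightarrow> real) \<Rightarrow> real" and B C :: real
  assumes zero: "(\<And>j i. j \<le> i \<Longrightarrow> A \<noteq> {j..i}) \<Longrightarrow> U A \<xi> = 0"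
    and local: "(\<And>k. k \<in> A \<Longrightarrow> \<xi> k = \<xi>' k) \<Longrightarrow> U A \<xi> = U A \<xi>'"
    and bounded: "\<xi> \<in> spins \<Longrightarrow> \<bar>U A \<xi>\<bar> \<le> B"
    and decay: "\<xi> \<in> spins \<Longrightarrow> j \<le> i \<Longrightarrow> 8 / 9 * real (card {j..i}) \<le> (\<Sum>k\<in>{j..i}. \<xi> k) \<Longrightarrow>
      \<bar>U {j..i} \<xi>\<bar> \<le> C * (1 / 2) ^ card {j..i}"
    and translate: "\<xi> \<in> spins \<Longrightarrow> j \<le> i \<Longrightarrow> U {j + s..i + s} \<xi> = U {j..i} (\<lambda>k. \<xi> (k + s))"
begin

lemma nonneg_consts: "0 \<le> B" "0 \<le> C"
proof -
  have p: "(\<lambda>_. 1) \<in> spins" by (auto simp: spins_def)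
  show "0 \<le> B" using bounded[OF p, of "{}"] by linarith
  have "0 \<le> C * (1 / 2)" using decay[OF p, of 0 0] by force
  then show "0 \<le> C" by simp
qed

definition crossing_bound :: "real \<Rightarrow> real \<Rightarrow> real" where
  "crossing_bound \<delta> b = B * (b / \<delta> + 1) ^ 2 + 2 * C"

text \<open>
  Intervals through \<open>x\<close> are indexed by their extents \<open>p\<close> to the left and \<open>k\<close> to the right. Either
  the interval is so long that the slack \<open>\<delta>\<close> outweighs the deficits, and then the potential decays
  geometrically in \<open>p\<close> and in \<open>k\<close>, or both extents are below \<open>(b + b') / \<delta> + 1\<close>.
\<close>

lemma sum_crossing:
  assumes \<eta>: "\<eta> \<in> spins" and \<delta>: "0 < \<delta>"
    and d: "dense_from \<delta> (-1) x b \<eta>" "dense_from \<delta> 1 (x + 1) b' \<eta>"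
    and F: "finite F" "\<And>A. A \<in> F \<Longrightarrow> x \<in> A"
  shows "(\<Sum>A\<in>F. \<bar>U A \<eta>\<bar>) \<le> crossing_bound \<delta> (b + b')"
proof -
  define M where "M = nat \<lfloor>(b + b') / \<delta>\<rfloor> + 1"
  have b0: "0 \<le> b + b'" using d[THEN dense_from_nonneg] by simp
  let ?I = "\<lambda>(p, k). {x - int p..x + int k}"
  have inj: "inj ?I"
    by (rule injI) (auto simp: Icc_eq_Icc)
  define P where "P = {s. ?I s \<in> F}"
  have fP: "finite P"
    unfolding P_def using finite_vimageI[OF F(1) inj] by (simp add: vimage_def)
  \<comment> \<open>A finite grid that contains all extents occurring in \<open>F\<close>.\<close>
  define n where "n = Suc (Max (insert 0 (fst ` P \<union> snd ` P)))"
  have Pn: "P \<subseteq> {..<n} \<times> {..<n}"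
    unfolding n_def using fP by (force intro!: le_imp_less_Suc Max_ge)
  have M: "real M \<le> (b + b') / \<delta> + 1"
    unfolding M_def using b0 \<delta> by simp
  define G :: "nat \<times> nat \<Rightarrow> real" where
    "G = (\<lambda>s. B * of_bool (s \<in> {..<M} \<times> {..<M}) + C / 2 * ((1 / 2) ^ fst s * (1 / 2) ^ snd s))"
  have pointwise: "\<bar>U (?I s) \<eta>\<bar> \<le> G s" for s
  proof -
    obtain p k where s: "s = (p, k)" by (cases s)
    have c: "card {x - int p..x + int k} = p + k + 1" by simp
    have G0: "B * of_bool ((p, k) \<in> {..<M} \<times> {..<M}) \<ge> 0" "C / 2 * ((1 / 2) ^ p * (1 / 2) ^ k) \<ge> 0"
      using nonneg_consts by auto
    show ?thesis
    proof (cases "b + b' \<le> \<delta> * real (p + k + 1)")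
      case True
      have "8 / 9 * real (card {x - int p..x + int k}) \<le> (\<Sum>k\<in>{x - int p..x + int k}. \<eta> k)"
      proof -
        have "(8 / 9 + \<delta>) * real (p + k + 1) - (b + b') \<le> (\<Sum>k\<in>{x - int p..x + int k}. \<eta> k)"
          using dense_interval[OF d, of "x - int p" "x + int k"] unfolding c by simp
        moreover have "(8 / 9 + \<delta>) * real (p + k + 1) = 8 / 9 * real (p + k + 1) + \<delta> * real (p + k + 1)"
          by (rule distrib_right)
        ultimately show ?thesis using True unfolding c by linarith
      qed
      then have "\<bar>U {x - int p..x + int k} \<eta>\<bar> \<le> C * (1 / 2) ^ (p + k + 1)"
        using decay[OF \<eta>, of "x - int p" "x + int k"] unfolding c by simp
      then show ?thesis using G0 unfolding s G_def by (simp add: power_add)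
    next
      case False
      then have "real (p + k + 1) < (b + b') / \<delta>" using \<delta> by (simp add: field_simps)
      then have "p + k + 1 < M" unfolding M_def by linarith
      then show ?thesis using bounded[OF \<eta>, of "?I s"] G0 unfolding s G_def by simp
    qed
  qed
  have geo: "(\<Sum>p<n. (1 / 2) ^ p) \<le> (2 :: real)"
    by (subst sum_gp_strict) (auto simp: field_simps)
  have "(\<Sum>A\<in>F. \<bar>U A \<eta>\<bar>) = (\<Sum>A\<in>?I ` P. \<bar>U A \<eta>\<bar>)"
  proof (rule sum.mono_neutral_right[OF F(1)])
    show "?I ` P \<subseteq> F" unfolding P_def by auto
    show "\<forall>A\<in>F - ?I ` P. \<bar>U A \<eta>\<bar> = 0"
    proof
      fix A assume A: "A \<in> F - ?I ` P"
      have "A \<noteq> {j..i}" if "j \<le> i" for j i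
      proof
        assume e: "A = {j..i}"
        then have "j \<le> x" "x \<le> i" using F(2)[of A] A by auto
        then have "A = ?I (nat (x - j), nat (i - x))" using e by simp
        then show False using A unfolding P_def by blast
      qed
      then show "\<bar>U A \<eta>\<bar> = 0" using zero by simp
    qed
  qed
  also have "\<dots> = (\<Sum>s\<in>P. \<bar>U (?I s) \<eta>\<bar>)"
    by (rule sum.reindex[OF inj_on_subset[OF inj subset_UNIV], unfolded comp_def])
  also have "\<dots> \<le> (\<Sum>s\<in>P. G s)" by (rule sum_mono) (rule pointwise)
  also have "\<dots> \<le> (\<Sum>s\<in>{..<n} \<times> {..<n}. G s)"
    using Pn nonneg_consts by (intro sum_mono2) (auto simp: G_def)
  also have "\<dots> = (\<Sum>s\<in>{..<n} \<times> {..<n}. B * of_bool (s \<in> {..<M} \<times> {..<M}))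
      + C / 2 * (\<Sum>(p, k)\<in>{..<n} \<times> {..<n}. (1 / 2) ^ p * (1 / 2) ^ k)"
    unfolding G_def sum.distrib sum_distrib_left split_def ..
  also have "(\<Sum>(p, k)\<in>{..<n} \<times> {..<n}. (1 / 2) ^ p * (1 / 2 :: real) ^ k) = (\<Sum>p<n. (1 / 2) ^ p) * (\<Sum>p<n. (1 / 2) ^ p)"
    by (simp add: sum_product sum.cartesian_product)
  also have "(\<Sum>s\<in>{..<n} \<times> {..<n}. B * of_bool (s \<in> {..<M} \<times> {..<M})) \<le> B * real M ^ 2"
  proof -
    have "(\<Sum>s\<in>{..<n} \<times> {..<n}. B * of_bool (s \<in> {..<M} \<times> {..<M})) = B * real (card (({..<n} \<times> {..<n}) \<inter> ({..<M} \<times> {..<M})))"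
    proof -
      have count: "(\<Sum>s\<in>S. B * of_bool (s \<in> T)) = B * real (card (S \<inter> T))" if "finite S" for S T :: "(nat \<times> nat) set"
        using that by (simp add: sum_distrib_left[symmetric])
      show ?thesis by (rule count) simp
    qed
    also have "card (({..<n} \<times> {..<n}) \<inter> ({..<M} \<times> {..<M})) \<le> card ({..<M} \<times> {..<M})"
      by (intro card_mono) auto
    finally show ?thesis using nonneg_consts by (simp add: power2_eq_square mult_left_mono)
  qed
  also have "\<dots> \<le> B * ((b + b') / \<delta> + 1) ^ 2"
    using nonneg_consts M by (intro mult_left_mono power_mono) auto
  also have "C / 2 * ((\<Sum>p<n. (1 / 2) ^ p) * (\<Sum>p<n. (1 / 2) ^ p)) \<le> C / 2 * (2 * 2)"
    using nonneg_consts geo by (intro mult_left_mono mult_mono sum_nonneg) auto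
  finally show ?thesis unfolding crossing_bound_def by simp
qed

text \<open>
  Translating sets is a bijection from those that contain \<open>0\<close> onto those that contain \<open>x\<close>.
\<close>

lemma site_energy_translate:
  assumes \<sigma>: "\<sigma> \<in> spins"
  shows "site_energy U (\<lambda>k. \<sigma> (k + x)) = (\<Sum>\<^sub>\<infinity>A\<in>{A. finite A \<and> x \<in> A}. U A \<sigma> / real (card A))"
proof -
  let ?h = "\<lambda>A. (\<lambda>k. k + x) ` A"
  have tr: "U (?h A) \<sigma> = U A (\<lambda>k. \<sigma> (k + x))" for A
  proof (cases "\<exists>j i. j \<le> i \<and> A = {j..i}")
    case True
    then obtain j i where A: "j \<le> i" "A = {j..i}" by blast
    then have "?h A = {j + x..i + x}" by simp
    then show ?thesis using translate[OF \<sigma> A(1)] A(2) by simp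
  next
    case False
    have "?h A \<noteq> {j..i}" if "j \<le> i" for j i
    proof
      assume "?h A = {j..i}"
      then have "(\<lambda>k. k - x) ` ?h A = {j - x..i - x}" by simp
      then have "A = {j - x..i - x}" by (simp add: image_image)
      then show False using False that by force
    qed
    then have "U (?h A) \<sigma> = 0" by (rule zero)
    moreover have "U A (\<lambda>k. \<sigma> (k + x)) = 0" by (rule zero) (use False in blast)
    ultimately show ?thesis by simp
  qed
  have inj: "inj_on (\<lambda>k. k + x) A" for A by simp
  have im: "{A. finite A \<and> x \<in> A} = ?h ` {A. finite A \<and> 0 \<in> A}"
  proof (intro equalityI subsetI)
    fix A assume A: "A \<in> {A. finite A \<and> x \<in> A}"
    have "A = ?h ((\<lambda>k. k - x) ` A)" by (simp add: image_image)
    moreover have "(\<lambda>k. k - x) ` A \<in> {A. finite A \<and> 0 \<in> A}" using A by force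
    ultimately show "A \<in> ?h ` {A. finite A \<and> 0 \<in> A}" by blast
  qed force
  have "inj_on ?h {A. finite A \<and> 0 \<in> A}"
    by (rule inj_onI) (simp add: inj_image_eq_iff[of "\<lambda>k. k + x"])
  then have "(\<Sum>\<^sub>\<infinity>A\<in>{A. finite A \<and> x \<in> A}. U A \<sigma> / real (card A))
    = (\<Sum>\<^sub>\<infinity>A\<in>{A. finite A \<and> 0 \<in> A}. U (?h A) \<sigma> / real (card (?h A)))"
    unfolding im by (subst infsum_reindex) (simp_all add: comp_def)
  also have "\<dots> = site_energy U (\<lambda>k. \<sigma> (k + x))"
    unfolding site_energy_def tr by (simp add: card_image[OF inj])
  finally show ?thesis ..
qed

lemma site_energy_bound:
  assumes \<sigma>: "\<sigma> \<in> spins" and \<delta>: "0 < \<delta>"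
    and d: "dense_from \<delta> (-1) 0 b \<sigma>" "dense_from \<delta> 1 1 b' \<sigma>"
  shows "\<bar>site_energy U \<sigma>\<bar> \<le> crossing_bound \<delta> (b + b')"
  unfolding site_energy_def
proof (rule infsum_abs_bound(2))
  fix F :: "int set set" assume F: "finite F" "F \<subseteq> {A. finite A \<and> 0 \<in> A}"
  have "(\<Sum>A\<in>F. \<bar>U A \<sigma> / real (card A)\<bar>) \<le> (\<Sum>A\<in>F. \<bar>U A \<sigma>\<bar>)"
  proof (rule sum_mono)
    fix A assume "A \<in> F"
    then have "1 \<le> real (card A)" using F(2) by (auto simp: Suc_le_eq card_gt_0_iff)
    then show "\<bar>U A \<sigma> / real (card A)\<bar> \<le> \<bar>U A \<sigma>\<bar>"
      by (simp add: divide_le_eq mult_le_cancel_left1)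
  qed
  also have "\<dots> \<le> crossing_bound \<delta> (b + b')"
    by (rule sum_crossing[OF \<sigma> \<delta> d(1) _ F(1)]) (use d(2) F(2) in auto)
  finally show "(\<Sum>A\<in>F. \<bar>U A \<sigma> / real (card A)\<bar>) \<le> crossing_bound \<delta> (b + b')" .
qed

text \<open>
  A set \<open>A\<close> enters the sum of the site energies in \<open>V\<close> with the factor \<open>card (A \<inter> V) / card A\<close>. For
  \<open>A\<close> inside \<open>V\<close> this is \<open>1\<close>, and the boundary condition is not seen, so that only crossing intervals
  remain. They contain \<open>c\<close> or \<open>a - 1\<close>, and the bound on sums over intervals through a point is applied
  at these two points, for \<open>\<sigma>\<close> and for the glued configuration \<open>\<eta>\<close>. The deficit of \<open>\<eta>\<close> on the side of
  \<open>V\<close> is that of \<open>\<sigma>\<close> plus that of \<open>\<omega>\<close> beyond the opposite end.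
\<close>

lemma hamiltonian_site_energies:
  fixes a c :: int
  assumes \<sigma>: "\<sigma> \<in> spins" and \<omega>: "\<omega> \<in> spins" and \<delta>: "0 < \<delta>" and ac: "a \<le> c"
  defines "\<eta> \<equiv> override_on \<omega> \<sigma> {a..c}"
  assumes \<sigma>d: "dense_from \<delta> (-1) (a - 1) b1 \<sigma>" "dense_from \<delta> 1 a b2 \<sigma>"
      "dense_from \<delta> (-1) c b3 \<sigma>" "dense_from \<delta> 1 (c + 1) b4 \<sigma>"
    and \<omega>d: "dense_from \<delta> (-1) (a - 1) w1 \<omega>" "dense_from \<delta> 1 (c + 1) w2 \<omega>"
  shows "\<bar>hamiltonian U {a..c} \<omega> \<sigma> - (\<Sum>x\<in>{a..c}. site_energy U (\<lambda>k. \<sigma> (k + x)))\<bar>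
    \<le> crossing_bound \<delta> (b1 + b2) + crossing_bound \<delta> (b3 + b4)
      + crossing_bound \<delta> (w1 + (b2 + w2)) + crossing_bound \<delta> ((b3 + w1) + w2)"
proof -
  let ?V = "{a..c}"
  let ?I = "{A. finite A \<and> A \<inter> ?V \<noteq> {}}"
  have \<eta>: "\<eta> \<in> spins" using \<sigma> \<omega> unfolding \<eta>_def by (auto simp: spins_def override_on_def)
  have \<eta>d: "dense_from \<delta> (-1) (a - 1) w1 \<eta>" "dense_from \<delta> 1 (c + 1) w2 \<eta>"
  proof -
    have "\<eta> (a - 1 + -1 * int l) = \<omega> (a - 1 + -1 * int l)" "\<eta> (c + 1 + 1 * int l) = \<omega> (c + 1 + 1 * int l)" for l
      unfolding \<eta>_def override_on_def by auto
    then show "dense_from \<delta> (-1) (a - 1) w1 \<eta>" "dense_from \<delta> 1 (c + 1) w2 \<eta>"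
      using \<omega>d unfolding dense_from_def by simp_all
  qed
  define m where "m = nat (c - a + 1)"
  have mc: "int m = c - a + 1" unfolding m_def using ac by simp
  have \<eta>d2: "dense_from \<delta> 1 a (b2 + w2) \<eta>"
    by (rule dense_from_glue[OF \<sigma>d(2), of m w2 \<omega>]) (use \<omega>d(2) mc in \<open>auto simp: \<eta>_def override_on_def\<close>)
  have \<eta>d3: "dense_from \<delta> (-1) c (b3 + w1) \<eta>"
    by (rule dense_from_glue[OF \<sigma>d(3), of m w1 \<omega>]) (use \<omega>d(1) mc in \<open>auto simp: \<eta>_def override_on_def\<close>)
  have cross: "(\<Sum>A\<in>F. \<bar>U A \<xi>\<bar>) \<le> crossing_bound \<delta> (d1 + d2) + crossing_bound \<delta> (d3 + d4)"
    if "\<xi> \<in> spins" "dense_from \<delta> (-1) (a - 1) d1 \<xi>" "dense_from \<delta> 1 a d2 \<xi>"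
      "dense_from \<delta> (-1) c d3 \<xi>" "dense_from \<delta> 1 (c + 1) d4 \<xi>" and F: "finite F" "F \<subseteq> ?I - Pow ?V"
    for \<xi> F d1 d2 d3 d4
  proof -
    let ?F1 = "{A\<in>F. a - 1 \<in> A}" and ?F2 = "{A\<in>F. c \<in> A}"
    have "(\<Sum>A\<in>F. \<bar>U A \<xi>\<bar>) = (\<Sum>A\<in>?F1 \<union> ?F2. \<bar>U A \<xi>\<bar>)"
    proof (rule sum.mono_neutral_right[OF F(1)])
      show "\<forall>A\<in>F - (?F1 \<union> ?F2). \<bar>U A \<xi>\<bar> = 0"
      proof
        fix A assume A: "A \<in> F - (?F1 \<union> ?F2)"
        have "A \<noteq> {j..i}" if "j \<le> i" for j i
        proof
          assume e: "A = {j..i}"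
          have "A \<inter> ?V \<noteq> {}" "\<not> A \<subseteq> ?V" using A F(2) by blast+
          then have "a - 1 \<in> A \<or> c \<in> A" unfolding e by auto
          then show False using A by blast
        qed
        then show "\<bar>U A \<xi>\<bar> = 0" using zero by simp
      qed
    qed auto
    also have "\<dots> \<le> (\<Sum>A\<in>?F1. \<bar>U A \<xi>\<bar>) + (\<Sum>A\<in>?F2. \<bar>U A \<xi>\<bar>)"
    proof -
      have "0 \<le> (\<Sum>A\<in>?F1 \<inter> ?F2. \<bar>U A \<xi>\<bar>)" by (rule sum_nonneg) simp
      moreover have "(\<Sum>A\<in>?F1 \<union> ?F2. \<bar>U A \<xi>\<bar>) + (\<Sum>A\<in>?F1 \<inter> ?F2. \<bar>U A \<xi>\<bar>)
        = (\<Sum>A\<in>?F1. \<bar>U A \<xi>\<bar>) + (\<Sum>A\<in>?F2. \<bar>U A \<xi>\<bar>)"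
        by (rule sum.union_inter) (use F(1) in auto)
      ultimately show ?thesis by linarith
    qed
    also have "(\<Sum>A\<in>?F1. \<bar>U A \<xi>\<bar>) \<le> crossing_bound \<delta> (d1 + d2)"
      by (rule sum_crossing[OF that(1) \<delta> that(2)]) (use that(3) F(1) in auto)
    also have "(\<Sum>A\<in>?F2. \<bar>U A \<xi>\<bar>) \<le> crossing_bound \<delta> (d3 + d4)"
      by (rule sum_crossing[OF that(1) \<delta> that(4)]) (use that(5) F(1) in auto)
    finally show ?thesis by simp
  qed
  define K\<eta> where "K\<eta> = crossing_bound \<delta> (w1 + (b2 + w2)) + crossing_bound \<delta> ((b3 + w1) + w2)"
  define K\<sigma> where "K\<sigma> = crossing_bound \<delta> (b1 + b2) + crossing_bound \<delta> (b3 + b4)"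
  have c\<eta>: "(\<Sum>A\<in>F. \<bar>U A \<eta>\<bar>) \<le> K\<eta>" if "finite F" "F \<subseteq> ?I - Pow ?V" for F
    unfolding K\<eta>_def by (rule cross[OF \<eta> \<eta>d(1) \<eta>d2 \<eta>d3 \<eta>d(2) that])
  have c\<sigma>: "(\<Sum>A\<in>F. \<bar>U A \<sigma>\<bar>) \<le> K\<sigma>" if "finite F" "F \<subseteq> ?I - Pow ?V" for F
    unfolding K\<sigma>_def by (rule cross[OF \<sigma> \<sigma>d that])
  have summ: "f summable_on ?I"
    if "\<And>A. A \<in> ?I \<Longrightarrow> \<bar>f A\<bar> \<le> \<bar>U A \<xi>\<bar>" "\<And>F. finite F \<Longrightarrow> F \<subseteq> ?I - Pow ?V \<Longrightarrow> (\<Sum>A\<in>F. \<bar>U A \<xi>\<bar>) \<le> K" for f \<xi> K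
  proof -
    have "(\<Sum>A\<in>F. \<bar>f A\<bar>) \<le> (\<Sum>A\<in>Pow ?V. \<bar>U A \<xi>\<bar>) + K" if F: "finite F" "F \<subseteq> ?I" for F
    proof -
      have "(\<Sum>A\<in>F. \<bar>f A\<bar>) \<le> (\<Sum>A\<in>F. \<bar>U A \<xi>\<bar>)" using that F by (intro sum_mono \<open>\<And>A. A \<in> ?I \<Longrightarrow> \<bar>f A\<bar> \<le> \<bar>U A \<xi>\<bar>\<close>) auto
      also have "\<dots> = (\<Sum>A\<in>F \<inter> Pow ?V. \<bar>U A \<xi>\<bar>) + (\<Sum>A\<in>F - Pow ?V. \<bar>U A \<xi>\<bar>)"
        by (rule sum.Int_Diff[OF F(1)])
      also have "(\<Sum>A\<in>F \<inter> Pow ?V. \<bar>U A \<xi>\<bar>) \<le> (\<Sum>A\<in>Pow ?V. \<bar>U A \<xi>\<bar>)"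
        by (rule sum_mono2) auto
      also have "(\<Sum>A\<in>F - Pow ?V. \<bar>U A \<xi>\<bar>) \<le> K"
        by (rule \<open>\<And>F. finite F \<Longrightarrow> F \<subseteq> ?I - Pow ?V \<Longrightarrow> (\<Sum>A\<in>F. \<bar>U A \<xi>\<bar>) \<le> K\<close>) (use F in auto)
      finally show ?thesis by simp
    qed
    then show ?thesis by (rule infsum_abs_bound(1))
  qed
  let ?r = "\<lambda>x A. of_bool (x \<in> A) * U A \<sigma> / real (card A)"
  have rle: "\<bar>?r x A\<bar> \<le> \<bar>U A \<sigma>\<bar>" if "A \<in> ?I" for x A
  proof -
    have "1 \<le> real (card A)" using that by (auto simp: Suc_le_eq card_gt_0_iff)
    then show ?thesis by (auto simp: divide_le_eq mult_le_cancel_left1)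
  qed
  have rs: "?r x summable_on ?I" for x
    by (rule summ[of _ \<sigma>, OF rle c\<sigma>])
  have "(\<Sum>x\<in>?V. site_energy U (\<lambda>k. \<sigma> (k + x))) = (\<Sum>x\<in>?V. infsum (?r x) ?I)"
  proof (rule sum.cong[OF refl])
    fix x assume "x \<in> ?V"
    then show "site_energy U (\<lambda>k. \<sigma> (k + x)) = infsum (?r x) ?I"
      unfolding site_energy_translate[OF \<sigma>] by (intro infsum_cong_neutral) auto
  qed
  also have "\<dots> = infsum (\<lambda>A. \<Sum>x\<in>?V. ?r x A) ?I"
    using infsum_sum_swap[of ?V ?r ?I] rs by simp
  finally have E: "(\<Sum>x\<in>?V. site_energy U (\<lambda>k. \<sigma> (k + x))) = infsum (\<lambda>A. \<Sum>x\<in>?V. ?r x A) ?I" .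
  have rsum: "(\<Sum>x\<in>?V. ?r x A) = U A \<sigma> * (real (card (A \<inter> ?V)) / real (card A))" for A
  proof -
    have "(\<Sum>x\<in>?V. ?r x A) = (\<Sum>x\<in>?V. of_bool (x \<in> A) * (U A \<sigma> / real (card A)))"
      by (simp only: times_divide_eq_right)
    also have "\<dots> = (\<Sum>x\<in>?V. of_bool (x \<in> A)) * (U A \<sigma> / real (card A))"
      by (rule sum_distrib_right[symmetric])
    also have "(\<Sum>x\<in>?V. of_bool (x \<in> A)) = real (card (A \<inter> ?V))"
      by (simp add: Int_def conj_commute)
    finally show ?thesis by simp
  qed
  have frac: "0 \<le> real (card (A \<inter> ?V)) / real (card A)" "real (card (A \<inter> ?V)) / real (card A) \<le> 1" if "A \<in> ?I" for A
  proof -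
    have "card (A \<inter> ?V) \<le> card A" using that by (intro card_mono) auto
    then show "0 \<le> real (card (A \<inter> ?V)) / real (card A)" "real (card (A \<inter> ?V)) / real (card A) \<le> 1"
      by (auto simp: divide_le_eq_1)
  qed
  have h: "hamiltonian U ?V \<omega> \<sigma> = infsum (\<lambda>A. U A \<eta>) ?I" unfolding hamiltonian_def \<eta>_def ..
  have s1: "(\<lambda>A. U A \<eta>) summable_on ?I" by (rule summ[of _ \<eta>, OF _ c\<eta>]) auto
  have s2: "(\<lambda>A. \<Sum>x\<in>?V. ?r x A) summable_on ?I"
    using infsum_sum_swap[of ?V ?r ?I] rs by simp
  have "hamiltonian U ?V \<omega> \<sigma> - (\<Sum>x\<in>?V. site_energy U (\<lambda>k. \<sigma> (k + x)))
    = infsum (\<lambda>A. U A \<eta> - (\<Sum>x\<in>?V. ?r x A)) ?I"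
    unfolding h E by (rule infsum_minus[symmetric, OF s1 s2])
  also have "\<bar>\<dots>\<bar> \<le> K\<eta> + K\<sigma>"
  proof (rule infsum_abs_bound(2))
    fix F assume F: "finite F" "F \<subseteq> ?I"
    have "(\<Sum>A\<in>F. \<bar>U A \<eta> - (\<Sum>x\<in>?V. ?r x A)\<bar>) = (\<Sum>A\<in>F - Pow ?V. \<bar>U A \<eta> - (\<Sum>x\<in>?V. ?r x A)\<bar>)"
    proof (rule sum.mono_neutral_right[OF F(1)])
      show "\<forall>A\<in>F - (F - Pow ?V). \<bar>U A \<eta> - (\<Sum>x\<in>?V. ?r x A)\<bar> = 0"
      proof
        fix A assume A: "A \<in> F - (F - Pow ?V)"
        then have "A \<inter> ?V = A" "card A \<noteq> 0" using F(2) by auto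
        moreover have "U A \<eta> = U A \<sigma>" by (rule local) (use A in \<open>auto simp: \<eta>_def override_on_def\<close>)
        ultimately show "\<bar>U A \<eta> - (\<Sum>x\<in>?V. ?r x A)\<bar> = 0" unfolding rsum by simp
      qed
    qed auto
    also have "\<dots> \<le> (\<Sum>A\<in>F - Pow ?V. \<bar>U A \<eta>\<bar> + \<bar>U A \<sigma>\<bar>)"
    proof (rule sum_mono)
      fix A assume "A \<in> F - Pow ?V"
      then have "A \<in> ?I" using F(2) by blast
      then have "\<bar>\<Sum>x\<in>?V. ?r x A\<bar> \<le> \<bar>U A \<sigma>\<bar>"
        using frac[of A] unfolding rsum abs_mult by (intro mult_left_le) auto
      then show "\<bar>U A \<eta> - (\<Sum>x\<in>?V. ?r x A)\<bar> \<le> \<bar>U A \<eta>\<bar> + \<bar>U A \<sigma>\<bar>" by linarith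
    qed
    also have "\<dots> \<le> K\<eta> + K\<sigma>"
      unfolding sum.distrib using F by (intro add_mono c\<eta> c\<sigma>) auto
    finally show "(\<Sum>A\<in>F. \<bar>U A \<eta> - (\<Sum>x\<in>?V. ?r x A)\<bar>) \<le> K\<eta> + K\<sigma>" .
  qed
  finally show ?thesis unfolding K\<eta>_def K\<sigma>_def by linarith
qed

end

section \<open>Measurability\<close>

lemma space_line_space: "space line_space = spins"
  unfolding line_space_def spins_def by (auto simp: space_PiM PiE_def Pi_def)

lemma measurable_spin: "(\<lambda>\<sigma>. \<sigma> k) \<in> borel_measurable line_space"
proof -
  have "(\<lambda>\<sigma>. \<sigma> k) \<in> measurable line_space (count_space {-1, 1})"
    unfolding line_space_def by (rule measurable_component_singleton) simp
  then show ?thesis by (rule measurable_compose) simp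
qed

lemma measurable_line_space:
  assumes "\<And>k. (\<lambda>x. f x k) \<in> borel_measurable N" "\<And>x. x \<in> space N \<Longrightarrow> f x \<in> spins"
  shows "f \<in> measurable N line_space"
  unfolding line_space_def
proof (rule measurable_PiM_single')
  fix k :: int
  show "(\<lambda>x. f x k) \<in> measurable N (count_space {-1, 1})"
  proof (rule measurable_count_space_eq2[THEN iffD2], simp, intro conjI ballI)
    show "(\<lambda>x. f x k) \<in> space N \<rightarrow> {-1, 1}" using spinsD[OF assms(2)] by auto
    show "(\<lambda>x. f x k) -` {a} \<inter> space N \<in> sets N" for a
      by (rule measurable_sets[OF assms(1)]) simp
  qed
qed (use spinsD[OF assms(2)] in \<open>auto simp: PiE_def Pi_def\<close>)

lemma measurable_shift: "(\<lambda>\<sigma> i. \<sigma> (i + k)) \<in> measurable line_space line_space"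
  by (rule measurable_line_space) (auto intro: measurable_spin simp: space_line_space spins_def)

lemma measurable_override:
  assumes "\<omega> \<in> spins"
  shows "(\<lambda>\<sigma>. override_on \<omega> \<sigma> V) \<in> measurable line_space line_space"
proof (rule measurable_line_space)
  fix k
  show "(\<lambda>\<sigma>. override_on \<omega> \<sigma> V k) \<in> borel_measurable line_space"
    using measurable_spin[of k] by (cases "k \<in> V") (simp_all add: override_on_def)
qed (use assms in \<open>auto simp: space_line_space spins_def override_on_def\<close>)

text \<open>
  Both sides are zero for sums that do not converge absolutely. As an integral, the sum is
  measurable in a parameter even where it does not converge.
\<close>

lemma infsum_eq_integral:
  fixes f :: "'a \<Rightarrow> real"
  shows "infsum f S = (\<integral>A. f A \<partial>count_space S)"
proof (cases "Infinite_Set_Sum.abs_summable_on f S")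
  case True
  then show ?thesis using infsetsum_infsum[OF True] by (simp add: infsetsum_def)
next
  case False
  then have "\<not> f summable_on S"
    using summable_on_iff_abs_summable_on_real[of f S] abs_summable_equivalent[of f S] by blast
  moreover have "\<not> integrable (count_space S) f"
    using False by (simp add: Infinite_Set_Sum.abs_summable_on_def)
  ultimately show ?thesis by (simp add: infsum_not_exists not_integrable_integral_eq)
qed

lemma measurable_infsum:
  fixes f :: "'a \<Rightarrow> 'b \<Rightarrow> real"
  assumes "countable S" "\<And>A. A \<in> S \<Longrightarrow> f A \<in> borel_measurable N"
  shows "(\<lambda>\<sigma>. infsum (\<lambda>A. f A \<sigma>) S) \<in> borel_measurable N"
proof -
  interpret sigma_finite_measure "count_space S"
    by (rule sigma_finite_measure_count_space_countable[OF assms(1)])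
  have "(\<lambda>(A, \<sigma>). f A \<sigma>) \<in> borel_measurable (count_space S \<Otimes>\<^sub>M N)"
    by (rule measurable_pair_measure_countable1[OF assms(1)]) (use assms(2) in simp)
  from measurable_pair_swap[OF this]
  have "(\<lambda>(\<sigma>, A). f A \<sigma>) \<in> borel_measurable (N \<Otimes>\<^sub>M count_space S)" by simp
  then have "(\<lambda>\<sigma>. \<integral>A. f A \<sigma> \<partial>count_space S) \<in> borel_measurable N"
    by (rule borel_measurable_lebesgue_integral)
  then show ?thesis unfolding infsum_eq_integral .
qed

section \<open>Run lengths and deficits\<close>

lemma run_len_le_iff:
  "run_len s \<alpha> i \<sigma> \<le> enat n \<longleftrightarrow>
    n \<ge> 1 \<and> (\<forall>k\<ge>n. (\<Sum>j<k. \<sigma> (i + s * int j)) / real k \<ge> 8 / 9 * \<alpha>)"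
proof
  let ?S = "{n. n \<ge> 1 \<and> (\<forall>k\<ge>n. (\<Sum>j<k. \<sigma> (i + s * int j)) / real k \<ge> 8 / 9 * \<alpha>)}"
  assume "run_len s \<alpha> i \<sigma> \<le> enat n"
  then have "run_len s \<alpha> i \<sigma> < enat (Suc n)" by (rule le_less_trans) simp
  then obtain m where "m \<in> ?S" "m \<le> n" unfolding run_len_def INF_less_iff by auto
  then show "n \<ge> 1 \<and> (\<forall>k\<ge>n. (\<Sum>j<k. \<sigma> (i + s * int j)) / real k \<ge> 8 / 9 * \<alpha>)" by auto
next
  assume "n \<ge> 1 \<and> (\<forall>k\<ge>n. (\<Sum>j<k. \<sigma> (i + s * int j)) / real k \<ge> 8 / 9 * \<alpha>)"
  then show "run_len s \<alpha> i \<sigma> \<le> enat n" unfolding run_len_def by (intro INF_lower) auto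
qed

text \<open>
  Beyond the run length the density holds without deficit. Before it the deficit is at most two
  per site.
\<close>

lemma dense_from_run_len:
  assumes \<alpha>: "1 < \<alpha>" "\<alpha> < 9 / 8" and \<sigma>: "\<sigma> \<in> spins" and l: "run_len s \<alpha> i \<sigma> \<le> enat l"
  shows "dense_from (8 / 9 * (\<alpha> - 1)) s i (2 * real l) \<sigma>"
  unfolding dense_from_def
proof
  fix n
  have e: "8 / 9 + 8 / 9 * (\<alpha> - 1) = 8 / 9 * \<alpha>" by (simp add: right_diff_distrib diff_divide_distrib)
  show "(8 / 9 + 8 / 9 * (\<alpha> - 1)) * real n - 2 * real l \<le> (\<Sum>l<n. \<sigma> (i + s * int l))"
  proof (cases "n \<ge> l")
    case True
    then have "n \<ge> 1" "8 / 9 * \<alpha> \<le> (\<Sum>j<n. \<sigma> (i + s * int j)) / real n"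
      using l unfolding run_len_le_iff by auto
    then have "8 / 9 * \<alpha> * real n \<le> (\<Sum>j<n. \<sigma> (i + s * int j))" by (simp add: pos_le_divide_eq)
    then show ?thesis unfolding e by simp
  next
    case False
    have "(\<Sum>l<n. -1) \<le> (\<Sum>l<n. \<sigma> (i + s * int l))"
    proof (rule sum_mono)
      show "-1 \<le> \<sigma> (i + s * int l)" for l using spinsD[OF \<sigma>, of "i + s * int l"] by auto
    qed
    then have "- real n \<le> (\<Sum>l<n. \<sigma> (i + s * int l))" by simp
    moreover have "8 / 9 * \<alpha> * real n \<le> 1 * real n" using \<alpha> by (intro mult_right_mono) auto
    moreover have "real n \<le> real l" using False by simp
    ultimately show ?thesis unfolding e by linarith
  qed
qed

lemma dense_from_shift: "dense_from \<delta> s 0 b (\<lambda>i. \<sigma> (i + x)) \<longleftrightarrow> dense_from \<delta> s x b \<sigma>"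
  unfolding dense_from_def by (simp add: add.commute)

text \<open>
  The exponent is below \<open>1 / 3\<close>, so the squares of the deficits grow sublinearly.
\<close>

lemma good_configs_dense:
  assumes \<alpha>: "1 < \<alpha>" "\<alpha> < 9 / 8" and \<omega>: "\<omega> \<in> good_configs \<alpha>"
  shows "\<exists>N::nat. N \<ge> 1 \<and> (\<forall>i s. \<bar>i\<bar> \<ge> int N \<longrightarrow> s = 1 \<or> s = -1 \<longrightarrow>
    (\<exists>w. dense_from (8 / 9 * (\<alpha> - 1)) s i w \<omega> \<and> w\<^sup>2 \<le> 4 * real_of_int \<bar>i\<bar> powr (2 / 3)))"
proof -
  have sp: "\<omega> \<in> spins" using \<omega> unfolding good_configs_def space_line_space by auto
  obtain \<epsilon> N where \<epsilon>: "0 < \<epsilon>" and N: "N \<ge> (1::nat)" and r: "\<And>i s. \<bar>i\<bar> \<ge> int N \<Longrightarrow> s \<in> {1, -1} \<Longrightarrow>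
     ereal_of_enat (run_len s \<alpha> i \<omega>) \<le> ereal (real_of_int \<bar>i\<bar> powr (1 / (3 + \<epsilon>)))"
    using \<omega> unfolding good_configs_def by fastforce
  show ?thesis
  proof (intro exI[of _ N] conjI allI impI N)
    fix i s :: int assume i: "\<bar>i\<bar> \<ge> int N" and s: "s = 1 \<or> s = -1"
    have "s \<in> {1, -1}" using s by auto
    note ri = r[OF i this]
    obtain l where l: "run_len s \<alpha> i \<omega> = enat l"
      using ri by (cases "run_len s \<alpha> i \<omega>") auto
    have i1: "1 \<le> real_of_int \<bar>i\<bar>" using i N by linarith
    have "real l \<le> real_of_int \<bar>i\<bar> powr (1 / (3 + \<epsilon>))" using ri unfolding l by simp
    also have "\<dots> \<le> real_of_int \<bar>i\<bar> powr (1 / 3)"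
      using i1 \<epsilon> by (intro powr_mono) (auto simp: field_simps)
    finally have "(2 * real l)\<^sup>2 \<le> (2 * real_of_int \<bar>i\<bar> powr (1 / 3))\<^sup>2" by (intro power_mono) auto
    also have "\<dots> = 4 * real_of_int \<bar>i\<bar> powr (2 / 3)"
      by (simp add: power2_eq_square powr_add[symmetric])
    finally have "(2 * real l)\<^sup>2 \<le> 4 * real_of_int \<bar>i\<bar> powr (2 / 3)" .
    moreover have "dense_from (8 / 9 * (\<alpha> - 1)) s i (2 * real l) \<omega>"
      by (rule dense_from_run_len[OF \<alpha> sp]) (simp add: l)
    ultimately show "\<exists>w. dense_from (8 / 9 * (\<alpha> - 1)) s i w \<omega> \<and> w\<^sup>2 \<le> 4 * real_of_int \<bar>i\<bar> powr (2 / 3)"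
      by blast
  qed
qed

lemma sum_odd_squares: "(\<Sum>n<l. 2 * real n + 1) = (real l)\<^sup>2"
  by (induction l) (simp_all add: power2_eq_square algebra_simps)

text \<open>
  The square of a run length is a sum of odd numbers over all smaller integers, so it is
  bounded by \<open>G \<sigma>\<close>, the sum of \<open>2 n + 1\<close> over the \<open>n\<close> below the run length. The exponential tail makes
  \<open>G\<close> integrable; in particular it is almost surely finite, and then so is the run length.
\<close>

lemma good_measures_second_moment:
  assumes \<alpha>: "1 < \<alpha>" "\<alpha> < 9 / 8" and \<mu>: "\<mu> \<in> good_measures \<alpha>" and s: "s = 1 \<or> s = -1"
  shows "\<exists>g. integrable \<mu> g \<and>
    (AE \<sigma> in \<mu>. \<exists>b. dense_from (8 / 9 * (\<alpha> - 1)) s 0 b \<sigma> \<and> b\<^sup>2 \<le> g \<sigma>)"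
proof -
  have sets: "sets \<mu> = sets line_space" and ps: "prob_space \<mu>" using \<mu> unfolding good_measures_def by auto
  have sp: "space \<mu> = spins" using sets_eq_imp_space_eq[OF sets] space_line_space by simp
  interpret prob_space \<mu> by (rule ps)
  obtain c where c: "0 < c" and tail: "\<And>n. n \<ge> 1 \<Longrightarrow>
     measure \<mu> {\<sigma>\<in>space \<mu>. run_len s \<alpha> 0 \<sigma> > enat n} \<le> exp (- c * real n)"
    using \<mu> s unfolding good_measures_def by fastforce
  define E where "E n = {\<sigma>\<in>space \<mu>. run_len s \<alpha> 0 \<sigma> > enat n}" for n
  have mspin: "(\<lambda>\<sigma>. \<sigma> k) \<in> borel_measurable \<mu>" for k
    using measurable_spin[of k] measurable_cong_sets[OF sets refl] by blast
  have Em: "E n \<in> sets \<mu>" for n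
  proof -
    have e: "E n = {\<sigma>\<in>space \<mu>. \<not> (n \<ge> 1 \<and> (\<forall>k\<ge>n. (\<Sum>j<k. \<sigma> (0 + s * int j)) / real k \<ge> 8 / 9 * \<alpha>))}"
      unfolding E_def run_len_le_iff[symmetric] by (simp add: not_le)
    have m: "(\<lambda>\<sigma>. (\<Sum>j<k. \<sigma> (0 + s * int j)) / real k) \<in> borel_measurable \<mu>" for k
      by (intro borel_measurable_divide borel_measurable_sum mspin) simp
    note [measurable] = m
    show ?thesis unfolding e by measurable
  qed
  have Eb: "measure \<mu> (E n) \<le> exp (- c) ^ n" for n
  proof (cases "n = 0")
    case False
    then show ?thesis using tail[of n] unfolding E_def by (simp add: exp_of_nat_mult[symmetric] mult.commute)
  qed simp
  note [measurable] = Em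
  define G where "G \<sigma> = (\<Sum>n. ennreal (2 * real n + 1) * indicator (E n) \<sigma>)" for \<sigma>
  have Gm[measurable]: "G \<in> borel_measurable \<mu>" unfolding G_def by measurable
  have "(\<integral>\<^sup>+\<sigma>. G \<sigma> \<partial>\<mu>) = (\<Sum>n. \<integral>\<^sup>+\<sigma>. ennreal (2 * real n + 1) * indicator (E n) \<sigma> \<partial>\<mu>)"
    unfolding G_def by (rule nn_integral_suminf) measurable
  also have "\<dots> = (\<Sum>n. ennreal ((2 * real n + 1) * measure \<mu> (E n)))"
    using Em by (simp add: nn_integral_cmult_indicator emeasure_eq_measure ennreal_mult)
  also have "\<dots> < \<infinity>"
  proof -
    have "norm (exp (- c)) < 1" using c by simp
    then have "summable (\<lambda>n. of_nat (Suc n) * exp (- c) ^ n)" by (rule geometric_deriv_sums[THEN sums_summable])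
    then have "summable (\<lambda>n. 2 * (of_nat (Suc n) * exp (- c) ^ n))" by (rule summable_mult)
    then have "summable (\<lambda>n. (2 * real n + 1) * measure \<mu> (E n))"
    proof (rule summable_comparison_test'[where N = 0])
      fix n :: nat
      have "(2 * real n + 1) * measure \<mu> (E n) \<le> (2 * real (Suc n)) * exp (- c) ^ n"
        by (intro mult_mono Eb) auto
      moreover have "\<bar>(2 * real n + 1) * measure \<mu> (E n)\<bar> = (2 * real n + 1) * measure \<mu> (E n)"
        by (rule abs_of_nonneg) simp
      moreover have "2 * real (Suc n) * exp (- c) ^ n = 2 * (of_nat (Suc n) * exp (- c) ^ n)"
        by (rule mult.assoc)
      ultimately show "norm ((2 * real n + 1) * measure \<mu> (E n)) \<le> 2 * (of_nat (Suc n) * exp (- c) ^ n)"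
        unfolding real_norm_def by linarith
    qed
    then have "(\<Sum>n. ennreal ((2 * real n + 1) * measure \<mu> (E n))) \<noteq> top"
      by (rule ennreal_suminf_neq_top) simp
    then show ?thesis unfolding infinity_ennreal_def by (rule less_top[THEN iffD1])
  qed
  finally have Gfin: "(\<integral>\<^sup>+\<sigma>. G \<sigma> \<partial>\<mu>) < \<infinity>" .
  have AEfin: "AE \<sigma> in \<mu>. G \<sigma> \<noteq> \<infinity>"
    using Gfin by (intro nn_integral_PInf_AE Gm) simp
  have lower: "(real l)\<^sup>2 \<le> enn2real (G \<sigma>)" if "\<sigma> \<in> space \<mu>" "enat l \<le> run_len s \<alpha> 0 \<sigma>" "G \<sigma> \<noteq> \<infinity>" for l \<sigma>
  proof -
    have "\<sigma> \<in> E n" if "n < l" for n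
    proof -
      have "enat n < enat l" using that by simp
      also note \<open>enat l \<le> run_len s \<alpha> 0 \<sigma>\<close>
      finally show ?thesis using \<open>\<sigma> \<in> space \<mu>\<close> unfolding E_def by simp
    qed
    then have "(\<Sum>n<l. ennreal (2 * real n + 1)) = (\<Sum>n<l. ennreal (2 * real n + 1) * indicator (E n) \<sigma>)"
      by (intro sum.cong) auto
    also have "\<dots> \<le> G \<sigma>" unfolding G_def by (rule sum_le_suminf) auto
    finally have "(\<Sum>n<l. ennreal (2 * real n + 1)) \<le> G \<sigma>" .
    moreover have "(\<Sum>n<l. ennreal (2 * real n + 1)) = ennreal (\<Sum>n<l. 2 * real n + 1)"
      by (rule sum_ennreal) simp
    ultimately have "ennreal (\<Sum>n<l. 2 * real n + 1) \<le> G \<sigma>" by simp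
    then have "ennreal ((real l)\<^sup>2) \<le> G \<sigma>" unfolding sum_odd_squares .
    then have "enn2real (ennreal ((real l)\<^sup>2)) \<le> enn2real (G \<sigma>)"
      using that(3) by (intro enn2real_mono) (auto simp: less_top)
    then show ?thesis by simp
  qed
  show ?thesis
  proof (intro exI[of _ "\<lambda>\<sigma>. 4 * enn2real (G \<sigma>)"] conjI)
    have "integrable \<mu> (\<lambda>\<sigma>. enn2real (G \<sigma>))"
    proof (rule integrableI_nonneg)
      have "(\<integral>\<^sup>+\<sigma>. ennreal (enn2real (G \<sigma>)) \<partial>\<mu>) \<le> (\<integral>\<^sup>+\<sigma>. G \<sigma> \<partial>\<mu>)"
        by (intro nn_integral_mono) (simp add: ennreal_enn2real_if)
      then show "(\<integral>\<^sup>+\<sigma>. ennreal (enn2real (G \<sigma>)) \<partial>\<mu>) < \<infinity>" using Gfin by (rule le_less_trans)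
    qed auto
    then show "integrable \<mu> (\<lambda>\<sigma>. 4 * enn2real (G \<sigma>))" by simp
    show "AE \<sigma> in \<mu>. \<exists>b. dense_from (8 / 9 * (\<alpha> - 1)) s 0 b \<sigma> \<and> b\<^sup>2 \<le> 4 * enn2real (G \<sigma>)"
      using AEfin AE_space
    proof eventually_elim
      case (elim \<sigma>)
      have "run_len s \<alpha> 0 \<sigma> \<noteq> \<infinity>"
      proof
        assume inf: "run_len s \<alpha> 0 \<sigma> = \<infinity>"
        obtain l where l: "enn2real (G \<sigma>) < real l" using reals_Archimedean2 by blast
        have "real l \<le> (real l)\<^sup>2" by (cases l) (auto simp: power2_eq_square)
        moreover have "(real l)\<^sup>2 \<le> enn2real (G \<sigma>)" using elim inf by (intro lower) auto
        ultimately show False using l by linarith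
      qed
      then obtain l where l: "run_len s \<alpha> 0 \<sigma> = enat l" by auto
      have "dense_from (8 / 9 * (\<alpha> - 1)) s 0 (2 * real l) \<sigma>"
        by (rule dense_from_run_len[OF \<alpha>]) (use elim sp l in auto)
      moreover have "(2 * real l)\<^sup>2 \<le> 4 * enn2real (G \<sigma>)"
        using lower[of \<sigma> l] elim l by (simp add: power_mult_distrib)
      ultimately show ?case by blast
    qed
  qed
qed

section \<open>Mean energies\<close>

lemma square_sum2: "(x + y)\<^sup>2 \<le> 2 * x\<^sup>2 + 2 * (y::real)\<^sup>2"
  using zero_le_power2[of "x - y"] by (simp add: power2_eq_square algebra_simps)

context decaying_potential
begin

text \<open>
  The potential of a finite set depends only on which of its spins are minus, a variable with
  finitely many values.
\<close>

lemma measurable_potential: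
  assumes "finite A"
  shows "U A \<in> borel_measurable line_space"
proof -
  have m: "(\<lambda>\<sigma>. minuses \<sigma> A) \<in> measurable line_space (count_space (Pow A))"
  proof (rule measurable_count_space_eq2[THEN iffD2], simp add: assms, intro conjI ballI)
    show "(\<lambda>\<sigma>. minuses \<sigma> A) \<in> space line_space \<rightarrow> Pow A" by (auto simp: minuses_def)
    fix M assume "M \<in> Pow A"
    then have e: "(\<lambda>\<sigma>. minuses \<sigma> A) -` {M} \<inter> space line_space
      = {\<sigma>\<in>space line_space. \<forall>k\<in>A. \<sigma> k = (if k \<in> M then -1 else 1)}"
    proof -
      have "minuses \<sigma> A = M \<longleftrightarrow> (\<forall>k\<in>A. \<sigma> k = (if k \<in> M then -1 else 1))" if "\<sigma> \<in> spins" for \<sigma>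
      proof
        assume "minuses \<sigma> A = M"
        then show "\<forall>k\<in>A. \<sigma> k = (if k \<in> M then -1 else 1)"
          using spinsD[OF that] by (auto simp: minuses_def)
      next
        assume *: "\<forall>k\<in>A. \<sigma> k = (if k \<in> M then -1 else 1)"
        have "k \<in> minuses \<sigma> A \<longleftrightarrow> k \<in> M" for k
          using *[rule_format, of k] \<open>M \<in> Pow A\<close> by (auto simp: minuses_def split: if_splits)
        then show "minuses \<sigma> A = M" by blast
      qed
      then show ?thesis unfolding space_line_space by blast
    qed
    have "{\<sigma>\<in>space line_space. \<sigma> k = c} \<in> sets line_space" for k and c :: real
    proof -
      note [measurable] = measurable_spin
      show ?thesis by measurable
    qed
    then show "(\<lambda>\<sigma>. minuses \<sigma> A) -` {M} \<inter> space line_space \<in> sets line_space"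
      unfolding e using assms by (intro sets.sets_Collect_finite_All) auto
  qed
  have "(\<lambda>\<sigma>. U A (minus_on (minuses \<sigma> A))) \<in> borel_measurable line_space"
    by (rule measurable_compose[OF m]) simp
  moreover have "U A \<sigma> = U A (minus_on (minuses \<sigma> A))" if "\<sigma> \<in> space line_space" for \<sigma>
    by (rule local) (use that spinsD[of \<sigma>] in \<open>auto simp: space_line_space minus_on_def minuses_def\<close>)
  ultimately show ?thesis by (simp cong: measurable_cong)
qed

lemma countable_finite_sets: "countable {A :: int set. finite A \<and> P A}"
  by (rule countable_subset[OF _ countable_Collect_finite]) auto

lemma measurable_site_energy: "site_energy U \<in> borel_measurable line_space"
  unfolding site_energy_def[abs_def]
  by (rule measurable_infsum[OF countable_finite_sets])
     (auto intro!: borel_measurable_divide measurable_potential)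

lemma measurable_hamiltonian: "\<omega> \<in> spins \<Longrightarrow> hamiltonian U V \<omega> \<in> borel_measurable line_space"
  unfolding hamiltonian_def[abs_def]
  by (rule measurable_infsum[OF countable_finite_sets])
     (auto intro!: measurable_compose[OF measurable_override measurable_potential])

lemma crossing_bound_square:
  assumes "0 < \<delta>" "0 \<le> b"
  shows "crossing_bound \<delta> b \<le> (2 * B / \<delta>\<^sup>2 + 2 * B + 2 * C) * (1 + b\<^sup>2)"
proof -
  have "(b / \<delta> + 1)\<^sup>2 \<le> 2 * (b / \<delta>)\<^sup>2 + 2"
    using square_sum2[of "b / \<delta>" 1] by simp
  then have "B * (b / \<delta> + 1)\<^sup>2 \<le> B * (2 * (b / \<delta>)\<^sup>2 + 2)"
    using nonneg_consts by (intro mult_left_mono) auto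
  also have "\<dots> = 2 * B / \<delta>\<^sup>2 * b\<^sup>2 + 2 * B" by (simp add: power_divide algebra_simps)
  also have "\<dots> \<le> (2 * B / \<delta>\<^sup>2 + 2 * B) * (1 + b\<^sup>2)"
  proof -
    have "0 \<le> 2 * B / \<delta>\<^sup>2" "0 \<le> 2 * B * b\<^sup>2" using nonneg_consts by auto
    then show ?thesis by (simp add: distrib_left distrib_right)
  qed
  finally have "B * (b / \<delta> + 1)\<^sup>2 \<le> (2 * B / \<delta>\<^sup>2 + 2 * B) * (1 + b\<^sup>2)" .
  moreover have "2 * C \<le> 2 * C * (1 + b\<^sup>2)" using nonneg_consts by (simp add: mult_le_cancel_left1)
  ultimately show ?thesis unfolding crossing_bound_def by (simp add: distrib_right)
qed

lemma square_sum3: "(x + y + z)\<^sup>2 \<le> 3 * x\<^sup>2 + 3 * y\<^sup>2 + 3 * (z::real)\<^sup>2"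
  using zero_le_power2[of "x - y"] zero_le_power2[of "y - z"] zero_le_power2[of "x - z"]
  by (simp add: power2_eq_square algebra_simps)

lemma hamiltonian_site_energies_square:
  fixes a c :: int
  assumes "\<sigma> \<in> spins" "\<omega> \<in> spins" and \<delta>: "0 < \<delta>" and "a \<le> c"
    and d: "dense_from \<delta> (-1) (a - 1) b1 \<sigma>" "dense_from \<delta> 1 a b2 \<sigma>"
      "dense_from \<delta> (-1) c b3 \<sigma>" "dense_from \<delta> 1 (c + 1) b4 \<sigma>"
      "dense_from \<delta> (-1) (a - 1) w1 \<omega>" "dense_from \<delta> 1 (c + 1) w2 \<omega>"
  shows "\<bar>hamiltonian U {a..c} \<omega> \<sigma> - (\<Sum>x\<in>{a..c}. site_energy U (\<lambda>k. \<sigma> (k + x)))\<bar>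
    \<le> 8 * (2 * B / \<delta>\<^sup>2 + 2 * B + 2 * C) * (1 + b1\<^sup>2 + b2\<^sup>2 + b3\<^sup>2 + b4\<^sup>2 + w1\<^sup>2 + w2\<^sup>2)"
proof -
  define K where "K = 2 * B / \<delta>\<^sup>2 + 2 * B + 2 * C"
  have K: "0 \<le> K" unfolding K_def using nonneg_consts by simp
  note nn = d[THEN dense_from_nonneg]
  have cb: "crossing_bound \<delta> b \<le> K * (1 + b\<^sup>2)" if "0 \<le> b" for b
    unfolding K_def by (rule crossing_bound_square[OF \<delta> that])
  have "\<bar>hamiltonian U {a..c} \<omega> \<sigma> - (\<Sum>x\<in>{a..c}. site_energy U (\<lambda>k. \<sigma> (k + x)))\<bar>
    \<le> crossing_bound \<delta> (b1 + b2) + crossing_bound \<delta> (b3 + b4)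
      + crossing_bound \<delta> (w1 + (b2 + w2)) + crossing_bound \<delta> ((b3 + w1) + w2)"
    by (rule hamiltonian_site_energies) fact+
  also have "\<dots> \<le> K * (1 + (b1 + b2)\<^sup>2) + K * (1 + (b3 + b4)\<^sup>2) + K * (1 + (w1 + (b2 + w2))\<^sup>2) + K * (1 + ((b3 + w1) + w2)\<^sup>2)"
    using nn by (intro add_mono cb) auto
  also have "\<dots> = K * (4 + (b1 + b2)\<^sup>2 + (b3 + b4)\<^sup>2 + (w1 + b2 + w2)\<^sup>2 + (b3 + w1 + w2)\<^sup>2)"
    by (simp add: algebra_simps)
  also have "\<dots> \<le> K * (8 + 8 * b1\<^sup>2 + 8 * b2\<^sup>2 + 8 * b3\<^sup>2 + 8 * b4\<^sup>2 + 8 * w1\<^sup>2 + 8 * w2\<^sup>2)"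
    using square_sum2[of b1 b2] square_sum2[of b3 b4] square_sum3[of w1 b2 w2] square_sum3[of b3 w1 w2]
      zero_le_power2[of b1] zero_le_power2[of b2] zero_le_power2[of b3] zero_le_power2[of b4]
      zero_le_power2[of w1] zero_le_power2[of w2]
    by (intro mult_left_mono K) linarith
  also have "\<dots> = 8 * K * (1 + b1\<^sup>2 + b2\<^sup>2 + b3\<^sup>2 + b4\<^sup>2 + w1\<^sup>2 + w2\<^sup>2)"
    by (simp add: algebra_simps)
  finally show ?thesis unfolding K_def .
qed

text \<open>
  Integrating the pointwise bound. Both the deficits of \<open>\<sigma>\<close> at the ends of the interval and the site
  energies are translates of a fixed function, so their integrals do not depend on the place.
\<close>

lemma mean_energy_bound:
  fixes a c :: int
  assumes \<mu>: "sets \<mu> = sets line_space" "prob_space \<mu>" "\<And>k. distr \<mu> line_space (\<lambda>\<sigma> i. \<sigma> (i + k)) = \<mu>"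
    and gm: "integrable \<mu> gm" "AE \<sigma> in \<mu>. \<exists>b. dense_from \<delta> (-1) 0 b \<sigma> \<and> b\<^sup>2 \<le> gm \<sigma>"
    and gp: "integrable \<mu> gp" "AE \<sigma> in \<mu>. \<exists>b. dense_from \<delta> 1 0 b \<sigma> \<and> b\<^sup>2 \<le> gp \<sigma>"
    and \<omega>: "\<omega> \<in> spins" and \<delta>: "0 < \<delta>" and ac: "a \<le> c"
    and w: "dense_from \<delta> (-1) (a - 1) w1 \<omega>" "dense_from \<delta> 1 (c + 1) w2 \<omega>"
  shows "\<bar>(\<integral>\<sigma>. hamiltonian U {a..c} \<omega> \<sigma> \<partial>\<mu>) - real (card {a..c}) * energy_density U \<mu>\<bar>
    \<le> 8 * (2 * B / \<delta>\<^sup>2 + 2 * B + 2 * C) * (1 + 2 * integral\<^sup>L \<mu> gm + 2 * integral\<^sup>L \<mu> gp + w1\<^sup>2 + w2\<^sup>2)"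
proof -
  interpret prob_space \<mu> by (rule \<mu>(2))
  have sp: "space \<mu> = spins" using sets_eq_imp_space_eq[OF \<mu>(1)] space_line_space by simp
  have mb: "f \<in> borel_measurable \<mu> \<longleftrightarrow> f \<in> borel_measurable line_space" for f :: "(int \<Rightarrow> real) \<Rightarrow> real"
    using measurable_cong_sets[OF \<mu>(1) refl] by blast
  have sh: "(\<lambda>\<sigma> i. \<sigma> (i + k)) \<in> measurable \<mu> line_space" for k
    using measurable_shift[of k] measurable_cong_sets[OF \<mu>(1) refl] by blast
  have intsh: "integrable \<mu> (\<lambda>\<sigma>. f (\<lambda>i. \<sigma> (i + k)))" "(\<integral>\<sigma>. f (\<lambda>i. \<sigma> (i + k)) \<partial>\<mu>) = integral\<^sup>L \<mu> f"
    if "integrable \<mu> f" for f :: "(int \<Rightarrow> real) \<Rightarrow> real" and k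
  proof -
    have fm: "f \<in> borel_measurable line_space" using that mb by auto
    show "integrable \<mu> (\<lambda>\<sigma>. f (\<lambda>i. \<sigma> (i + k)))"
      using that integrable_distr_eq[OF sh fm, of k] \<mu>(3)[of k] by simp
    show "(\<integral>\<sigma>. f (\<lambda>i. \<sigma> (i + k)) \<partial>\<mu>) = integral\<^sup>L \<mu> f"
      using integral_distr[OF sh fm, of k] \<mu>(3)[of k] by simp
  qed
  have AEsh: "AE \<sigma> in \<mu>. \<exists>b. dense_from \<delta> s k b \<sigma> \<and> b\<^sup>2 \<le> g (\<lambda>i. \<sigma> (i + k))"
    if "AE \<sigma> in \<mu>. \<exists>b. dense_from \<delta> s 0 b \<sigma> \<and> b\<^sup>2 \<le> g \<sigma>" for s k and g :: "(int \<Rightarrow> real) \<Rightarrow> real"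
  proof -
    have "AE \<sigma> in distr \<mu> line_space (\<lambda>\<sigma> i. \<sigma> (i + k)). \<exists>b. dense_from \<delta> s 0 b \<sigma> \<and> b\<^sup>2 \<le> g \<sigma>"
      unfolding \<mu>(3)[of k] by (rule that)
    from AE_distrD[OF sh this] show ?thesis unfolding dense_from_shift .
  qed
  define K where "K = 2 * B / \<delta>\<^sup>2 + 2 * B + 2 * C"
  have K: "0 \<le> K" unfolding K_def using nonneg_consts by simp
  let ?f = "site_energy U"
  have fint: "integrable \<mu> ?f"
  proof (rule Bochner_Integration.integrable_bound)
    show "integrable \<mu> (\<lambda>\<sigma>. K * (1 + (2 * gm \<sigma> + 2 * gp (\<lambda>i. \<sigma> (i + 1)))))"
      using gm(1) intsh(1)[OF gp(1), of 1] by (intro Bochner_Integration.integrable_mult_right Bochner_Integration.integrable_add) auto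
    show "?f \<in> borel_measurable \<mu>" unfolding mb by (rule measurable_site_energy)
    show "AE \<sigma> in \<mu>. norm (?f \<sigma>) \<le> norm (K * (1 + (2 * gm \<sigma> + 2 * gp (\<lambda>i. \<sigma> (i + 1)))))"
      using gm(2) AEsh[OF gp(2), of 1] AE_space
    proof eventually_elim
      case (elim \<sigma>)
      then obtain b b' where b: "dense_from \<delta> (-1) 0 b \<sigma>" "b\<^sup>2 \<le> gm \<sigma>" "dense_from \<delta> 1 1 b' \<sigma>" "b'\<^sup>2 \<le> gp (\<lambda>i. \<sigma> (i + 1))"
        by blast
      have "\<bar>?f \<sigma>\<bar> \<le> crossing_bound \<delta> (b + b')"
        using elim sp by (intro site_energy_bound[OF _ \<delta> b(1,3)]) auto
      also have "\<dots> \<le> K * (1 + (b + b')\<^sup>2)"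
        unfolding K_def using b(1,3)[THEN dense_from_nonneg] by (intro crossing_bound_square \<delta>) simp
      also have "\<dots> \<le> K * (1 + (2 * gm \<sigma> + 2 * gp (\<lambda>i. \<sigma> (i + 1))))"
        using b(2,4) square_sum2[of b b'] by (intro mult_left_mono K) linarith
      finally show ?case by simp
    qed
  qed
  let ?S = "\<lambda>\<sigma>. \<Sum>x\<in>{a..c}. ?f (\<lambda>k. \<sigma> (k + x))"
  have Sint: "integrable \<mu> ?S" by (intro Bochner_Integration.integrable_sum intsh(1) fint)
  have S: "integral\<^sup>L \<mu> ?S = real (card {a..c}) * energy_density U \<mu>"
    unfolding energy_density_def using intsh[OF fint]
    by (subst Bochner_Integration.integral_sum) simp_all
  define R where "R \<sigma> = 8 * K * (1 + gm (\<lambda>i. \<sigma> (i + (a - 1))) + gp (\<lambda>i. \<sigma> (i + a))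
    + gm (\<lambda>i. \<sigma> (i + c)) + gp (\<lambda>i. \<sigma> (i + (c + 1))) + w1\<^sup>2 + w2\<^sup>2)" for \<sigma>
  have Rint: "integrable \<mu> R"
    unfolding R_def by (intro Bochner_Integration.integrable_mult_right Bochner_Integration.integrable_add integrable_const intsh(1)[OF gm(1)] intsh(1)[OF gp(1)])
  have RI: "integral\<^sup>L \<mu> R = 8 * K * (1 + 2 * integral\<^sup>L \<mu> gm + 2 * integral\<^sup>L \<mu> gp + w1\<^sup>2 + w2\<^sup>2)"
    unfolding R_def using intsh[OF gm(1)] intsh[OF gp(1)] by (simp add: prob_space)
  let ?H = "hamiltonian U {a..c} \<omega>"
  have Hm: "?H \<in> borel_measurable \<mu>" unfolding mb by (rule measurable_hamiltonian[OF \<omega>])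
  have AE: "AE \<sigma> in \<mu>. \<bar>?H \<sigma> - ?S \<sigma>\<bar> \<le> R \<sigma>"
    using AEsh[OF gm(2), of "a - 1"] AEsh[OF gp(2), of a] AEsh[OF gm(2), of c] AEsh[OF gp(2), of "c + 1"] AE_space
  proof eventually_elim
    case (elim \<sigma>)
    then obtain b1 b2 b3 b4 where b: "dense_from \<delta> (-1) (a - 1) b1 \<sigma>" "dense_from \<delta> 1 a b2 \<sigma>"
      "dense_from \<delta> (-1) c b3 \<sigma>" "dense_from \<delta> 1 (c + 1) b4 \<sigma>"
      and le: "b1\<^sup>2 \<le> gm (\<lambda>i. \<sigma> (i + (a - 1)))" "b2\<^sup>2 \<le> gp (\<lambda>i. \<sigma> (i + a))"
        "b3\<^sup>2 \<le> gm (\<lambda>i. \<sigma> (i + c))" "b4\<^sup>2 \<le> gp (\<lambda>i. \<sigma> (i + (c + 1)))"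
      by blast
    have "\<sigma> \<in> spins" using elim sp by simp
    then have "\<bar>?H \<sigma> - ?S \<sigma>\<bar> \<le> 8 * K * (1 + b1\<^sup>2 + b2\<^sup>2 + b3\<^sup>2 + b4\<^sup>2 + w1\<^sup>2 + w2\<^sup>2)"
      unfolding K_def by (rule hamiltonian_site_energies_square[OF _ \<omega> \<delta> ac b w])
    also have "\<dots> \<le> R \<sigma>"
      unfolding R_def using le K by (intro mult_left_mono) auto
    finally show ?case .
  qed
  have Dint: "integrable \<mu> (\<lambda>\<sigma>. ?H \<sigma> - ?S \<sigma>)"
    by (rule Bochner_Integration.integrable_bound[OF Rint])
       (use Hm Sint AE in \<open>auto elim!: eventually_mono\<close>)
  have Hint: "integrable \<mu> ?H" using Bochner_Integration.integrable_add[OF Dint Sint] by simp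
  have "\<bar>integral\<^sup>L \<mu> ?H - integral\<^sup>L \<mu> ?S\<bar> = \<bar>\<integral>\<sigma>. ?H \<sigma> - ?S \<sigma> \<partial>\<mu>\<bar>"
    by (subst Bochner_Integration.integral_diff[OF Hint Sint]) simp
  also have "\<dots> \<le> (\<integral>\<sigma>. \<bar>?H \<sigma> - ?S \<sigma>\<bar> \<partial>\<mu>)" by (rule integral_abs_bound)
  also have "\<dots> \<le> integral\<^sup>L \<mu> R" by (rule integral_mono_AE) (use Dint Rint AE in auto)
  finally show ?thesis unfolding S RI K_def .
qed

text \<open>
  The error is of order \<open>n powr (2 / 3)\<close> for intervals of \<open>n\<close> sites that contain the origin.
\<close>

theorem energy_density_limit:
  assumes \<alpha>: "1 < \<alpha>" "\<alpha> < 9 / 8" and \<mu>: "\<mu> \<in> good_measures \<alpha>" and \<omega>: "\<omega> \<in> good_configs \<alpha>"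
  shows "((\<lambda>V. (\<integral>\<sigma>. hamiltonian U V \<omega> \<sigma> \<partial>\<mu>) / real (card V)) \<longlongrightarrow> energy_density U \<mu>) thermodynamic"
proof -
  define \<delta> where "\<delta> = 8 / 9 * (\<alpha> - 1)"
  have \<delta>: "0 < \<delta>" unfolding \<delta>_def using \<alpha> by simp
  have \<mu>': "sets \<mu> = sets line_space" "prob_space \<mu>" "\<And>k. distr \<mu> line_space (\<lambda>\<sigma> i. \<sigma> (i + k)) = \<mu>"
    using \<mu> unfolding good_measures_def by auto
  have sp: "\<omega> \<in> spins" using \<omega> unfolding good_configs_def space_line_space by auto
  obtain gm where gm: "integrable \<mu> gm" "AE \<sigma> in \<mu>. \<exists>b. dense_from \<delta> (-1) 0 b \<sigma> \<and> b\<^sup>2 \<le> gm \<sigma>"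
    unfolding \<delta>_def using good_measures_second_moment[OF \<alpha> \<mu>] by blast
  obtain gp where gp: "integrable \<mu> gp" "AE \<sigma> in \<mu>. \<exists>b. dense_from \<delta> 1 0 b \<sigma> \<and> b\<^sup>2 \<le> gp \<sigma>"
    unfolding \<delta>_def using good_measures_second_moment[OF \<alpha> \<mu>] by blast
  obtain N :: nat where N: "N \<ge> 1" "\<And>i s. \<bar>i\<bar> \<ge> int N \<Longrightarrow> s = 1 \<or> s = -1 \<Longrightarrow>
    \<exists>w. dense_from \<delta> s i w \<omega> \<and> w\<^sup>2 \<le> 4 * real_of_int \<bar>i\<bar> powr (2 / 3)"
    unfolding \<delta>_def using good_configs_dense[OF \<alpha> \<omega>] by blast
  define K where "K = 8 * (2 * B / \<delta>\<^sup>2 + 2 * B + 2 * C)"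
  have K: "0 \<le> K" unfolding K_def using nonneg_consts by simp
  define D where "D = 1 + 2 * integral\<^sup>L \<mu> gm + 2 * integral\<^sup>L \<mu> gp"
  define h where "h x = K * (D + 8 * x powr (2 / 3)) / x" for x :: real
  let ?e = "\<lambda>V. (\<integral>\<sigma>. hamiltonian U V \<omega> \<sigma> \<partial>\<mu>) / real (card V)"
  have bound: "norm (?e {a..c} - energy_density U \<mu>) \<le> h (real (card {a..c}))"
    if a: "a \<le> - int N" and c: "c \<ge> int N" for a c
  proof -
    have ac: "a \<le> c" using a c by linarith
    obtain w1 where w1: "dense_from \<delta> (-1) (a - 1) w1 \<omega>" "w1\<^sup>2 \<le> 4 * real_of_int \<bar>a - 1\<bar> powr (2 / 3)"
      using N(2)[of "a - 1" "-1"] a by auto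
    obtain w2 where w2: "dense_from \<delta> 1 (c + 1) w2 \<omega>" "w2\<^sup>2 \<le> 4 * real_of_int \<bar>c + 1\<bar> powr (2 / 3)"
      using N(2)[of "c + 1" 1] c by auto
    let ?n = "real (card {a..c})"
    have n: "?n = real_of_int (c - a + 1)" using ac by simp
    have n0: "0 < ?n" unfolding n using ac by linarith
    have "real_of_int \<bar>a - 1\<bar> powr (2 / 3) \<le> ?n powr (2 / 3)" "real_of_int \<bar>c + 1\<bar> powr (2 / 3) \<le> ?n powr (2 / 3)"
      unfolding n using a c by (auto intro!: powr_mono2)
    then have "1 + 2 * integral\<^sup>L \<mu> gm + 2 * integral\<^sup>L \<mu> gp + w1\<^sup>2 + w2\<^sup>2 \<le> D + 8 * ?n powr (2 / 3)"
      using w1(2) w2(2) unfolding D_def by linarith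
    then have "K * (1 + 2 * integral\<^sup>L \<mu> gm + 2 * integral\<^sup>L \<mu> gp + w1\<^sup>2 + w2\<^sup>2) \<le> K * (D + 8 * ?n powr (2 / 3))"
      using K by (rule mult_left_mono)
    then have "\<bar>(\<integral>\<sigma>. hamiltonian U {a..c} \<omega> \<sigma> \<partial>\<mu>) - ?n * energy_density U \<mu>\<bar> \<le> K * (D + 8 * ?n powr (2 / 3))"
      using mean_energy_bound[OF \<mu>' gm gp sp \<delta> ac w1(1) w2(1)] unfolding K_def by linarith
    then have "\<bar>(\<integral>\<sigma>. hamiltonian U {a..c} \<omega> \<sigma> \<partial>\<mu>) - ?n * energy_density U \<mu>\<bar> / ?n \<le> h ?n"
      unfolding h_def using n0 by (intro divide_right_mono) auto
    moreover have "\<bar>(\<integral>\<sigma>. hamiltonian U {a..c} \<omega> \<sigma> \<partial>\<mu>) - ?n * energy_density U \<mu>\<bar> / ?n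
      = \<bar>?e {a..c} - energy_density U \<mu>\<bar>"
    proof -
      have "?e {a..c} - energy_density U \<mu> = ((\<integral>\<sigma>. hamiltonian U {a..c} \<omega> \<sigma> \<partial>\<mu>) - ?n * energy_density U \<mu>) / ?n"
        using n0 by (simp add: field_simps)
      then show ?thesis using n0 by (simp add: abs_divide)
    qed
    ultimately show ?thesis by simp
  qed
  let ?F = "at_bot \<times>\<^sub>F at_top :: (int \<times> int) filter"
  have ev: "eventually (\<lambda>(a, c). a \<le> - int N \<and> c \<ge> int N) ?F"
    unfolding split_def
    by (intro eventually_conj filterlim_fst[THEN filterlim_iff[THEN iffD1], rule_format]
          filterlim_snd[THEN filterlim_iff[THEN iffD1], rule_format] eventually_le_at_bot eventually_ge_at_top)
  have h0: "(h \<longlongrightarrow> 0) at_top" 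
  proof -
    have "((\<lambda>x. K * D * inverse x + 8 * K * x powr (- (1 / 3))) \<longlongrightarrow> K * D * 0 + 8 * K * 0) at_top"
      by (intro tendsto_add tendsto_mult_left tendsto_inverse_0_at_top filterlim_ident tendsto_neg_powr) auto
    moreover have "eventually (\<lambda>x. K * D * inverse x + 8 * K * x powr (- (1 / 3)) = h x) at_top"
      using eventually_gt_at_top[of 0]
    proof eventually_elim
      case (elim x)
      have "x powr (2 / 3) / x = x powr (2 / 3 - 1)" using elim powr_diff[of x "2 / 3" 1] by simp
      then have "x powr (- (1 / 3)) = x powr (2 / 3) / x" by simp
      then have "8 * K * x powr (- (1 / 3)) = 8 * K * (x powr (2 / 3)) / x" by simp
      moreover have "K * D * inverse x = K * D / x" by (rule divide_inverse[symmetric])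
      ultimately have "K * D * inverse x + 8 * K * x powr (- (1 / 3)) = (K * D + 8 * K * x powr (2 / 3)) / x"
        by (simp only: add_divide_distrib)
      also have "K * D + 8 * K * x powr (2 / 3) = K * (D + 8 * x powr (2 / 3))"
        by (simp add: distrib_left)
      finally show ?case unfolding h_def .
    qed
    ultimately show ?thesis using Lim_transform_eventually by fastforce
  qed
  have card: "filterlim (\<lambda>(a, c). real (card {a..c})) at_top ?F"
  proof (rule filterlim_at_top_mono)
    show "filterlim (\<lambda>p. real_of_int (snd p)) at_top ?F"
      by (rule filterlim_compose[OF filterlim_real_of_int_at_top filterlim_snd])
    show "eventually (\<lambda>p. real_of_int (snd p) \<le> (case p of (a, c) \<Rightarrow> real (card {a..c}))) ?F"
      using ev by eventually_elim auto
  qed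
  have "((\<lambda>(a, c). ?e {a..c} - energy_density U \<mu>) \<longlongrightarrow> 0) ?F"
  proof (rule Lim_null_comparison)
    show "eventually (\<lambda>p. norm (case p of (a, c) \<Rightarrow> ?e {a..c} - energy_density U \<mu>)
        \<le> (case p of (a, c) \<Rightarrow> h (real (card {a..c})))) ?F"
      using ev by eventually_elim (use bound in auto)
    show "((\<lambda>(a, c). h (real (card {a..c}))) \<longlongrightarrow> 0) ?F"
      using filterlim_compose[OF h0 card] by (simp add: split_def)
  qed
  then have "((\<lambda>p. ?e ((\<lambda>(a, c). {a..c}) p) - energy_density U \<mu>) \<longlongrightarrow> 0) ?F"
    by (simp add: split_def)
  then have "((\<lambda>p. ?e ((\<lambda>(a, c). {a..c}) p)) \<longlongrightarrow> energy_density U \<mu>) ?F"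
    by (rule LIM_zero_cancel)
  then show ?thesis unfolding thermodynamic_def filterlim_filtermap .
qed

end

section \<open>The energy density of the plus phase\<close>

text \<open>
  \<open>exp (- 15) \<le> 2 ^ -15\<close> is what the Peierls estimate asks of \<open>exp (- \<beta>)\<close>: \<open>2 ^ 14\<close> for the
  entropy of contours, and a factor \<open>1 / 2\<close> that is left as decay.
\<close>

lemma telescoping_decaying:
  assumes "15 \<le> \<beta>"
  shows "decaying_potential (telescoping_potential \<beta>) (16 * \<beta>) (exp (4 * \<beta>))"
proof -
  have two: "2 \<le> exp (1::real)" using exp_ge_add_one_self[of 1] by simp
  have "exp (- \<beta>) \<le> exp (- 15)" using assms by simp
  also have "\<dots> = (1 / exp 1) ^ 15" by (simp add: exp_of_nat_mult[symmetric] power_one_over exp_minus inverse_eq_divide)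
  also have "\<dots> \<le> (1 / 2) ^ 15" using two by (intro power_mono divide_left_mono) auto
  finally have s: "exp (- \<beta>) \<le> (1 / 2) ^ 15" .
  define q where "q = exp (- 2 * \<beta>)"
  have "q = exp (- \<beta>) * exp (- \<beta>)" unfolding q_def by (simp add: exp_add[symmetric])
  also have "\<dots> \<le> (1 / 2) ^ 15 * 1" using s assms by (intro mult_mono) auto
  finally have q: "q = exp (- 2 * \<beta>)" "1024 * q < 1" unfolding q_def[symmetric] by (auto simp: power_one_over)
  show ?thesis
  proof
    show "telescoping_potential \<beta> A \<xi> = 0" if "\<And>j i. j \<le> i \<Longrightarrow> A \<noteq> {j..i}" for A \<xi>
      by (rule potential_zero[OF that])
    show "telescoping_potential \<beta> A \<xi> = telescoping_potential \<beta> A \<xi>'" if "\<And>k. k \<in> A \<Longrightarrow> \<xi> k = \<xi>' k" for A \<xi> \<xi>'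
      by (rule potential_local[OF that])
  qed (rule potential_bounded[OF q] potential_decay[OF s] potential_translate[OF q]; assumption)+
qed

theorem proposition6p2:
  shows "\<exists>\<beta>\<^sub>0::real. \<forall>\<beta>\<ge>\<beta>\<^sub>0. \<forall>(\<alpha>::real) \<mu> \<omega>.
    1 < \<alpha> \<longrightarrow> \<alpha> < 9 / 8 \<longrightarrow> \<mu> \<in> good_measures \<alpha> \<longrightarrow> \<omega> \<in> good_configs \<alpha> \<longrightarrow>
    (let U = telescoping_potential \<beta> in
      ((\<lambda>V. (\<integral>\<sigma>. hamiltonian U V \<omega> \<sigma> \<partial>\<mu>) / real (card V))
        \<longlongrightarrow> energy_density U \<mu>) thermodynamic)"
  unfolding Let_def
  using decaying_potential.energy_density_limit[OF telescoping_decaying] by blast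

end
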